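(* Let $N\geq1$. As functions of a classical non-framed link $L$ with $N$ connected components, all the invariants $L\mapsto P_L^{\rho_d}$, for $d\geq1$ and $\{\rho_{d,n}\}_{n\geq1}$ any Markov trace on $\{Y_{d,n}\}_{n\geq1}$ in the span of the basic Markov traces $\{\rho_{d,n}^{S}\}_{n\geq1}$ ($\emptyset\neq S\subseteq\{1,\dots,d\}$), are linear combinations of the $N$ invariants $$P_L^{1,\{1\}}\,,\ P_L^{2,\{1,2\}}\,,\ \dots\,,\ P_L^{N,\{1,\dots,N\}}\ ,$$ the first of which, $P_L^{1,\{1\}}$, is the HOMFLYPT polynomial of $L$.
   Context: Let $u,v,\gamma$ be indeterminates, $R=\mathbb{C}[u^{\pm1},v^{\pm1},\gamma^{\pm1}]$; all algebras are over $R$. Spans and linear combinations are with coefficients in $\mathbb{C}[u^{\pm1},v^{\pm1}]$. $s_i=(i,i+1)\in\mathfrak{S}_n$, $\ell$ is the length function. Yokonuma--Hecke algebra: $Y_{d,n}$ is the unital associative algebra generated by $g_1,\dots,g_{n-1},t_1,\dots,t_n$ with relations: $g_ig_j=g_jg_i$ for $|i-j|>1$; $g_ig_{i+1}g_i=g_{i+1}g_ig_{i+1}$; $t_it_j=t_jt_i$; $g_it_j=t_{s_i(j)}g_i$; $t_j^d=1$; $g_i^2=u^2+v\,e_ig_i$, where $e_i=\frac1d\sum_{s=1}^{d}t_i^st_{i+1}^{-s}$. For $w$ with reduced expression $s_{i_1}\cdots s_{i_r}$, $g_w=g_{i_1}\cdots g_{i_r}$. $Y_{d,n}\subset Y_{d,n+1}$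 via the generators with the same names. The Hecke algebra is $H_n=Y_{1,n}$ ($t_j=1$, $e_i=1$), with generators $\overline{g}_i$ and elements $\overline{g}_w$; $H_0$ is the ground ring. Markov traces: a Markov trace on $\{Y_{d,n}\}_{n\geq1}$ is a family of linear maps $\rho_{d,n}$ on $Y_{d,n}$ with values in $\mathbb{C}[u^{\pm1},v^{\pm1}]$ (extended $R$-linearly) such that $\rho_{d,n}(xy)=\rho_{d,n}(yx)$ for $x,y\in Y_{d,n}$, and $\rho_{d,n+1}(xg_n)=\rho_{d,n+1}(xg_n^{-1})=\rho_{d,n}(x)$ for $x\in Y_{d,n}$, $n\geq1$. On $\{H_n\}_{n\geq1}$ (the case $d=1$) there is a unique Markov trace up to normalisation; $\{\tau_n\}_{n\geq1}$ denotes the one with $\tau_1(1)=1$. The resulting link invariant $\tau_n(\beta_L)$ (image of the braid under $\sigma_i\mapsto\overline{g}_i$) is the HOMFLYPT polynomial, here normalised to be $1$ on the unknot with skein relation $P_{L_+}-u^2P_{L_-}=vP_{L_0}$, $L_+$, $L_-$, $L_0$ being closures of braids which differ only by a factor $\sigma_i$, $\sigma_i^{-1}$, $1$ respectively. Isomorphism: a $d$-composition of $n$ is $\mu\in\mathbb{Z}_{\geq0}^d$ with $\sum_a\mu_a=n$. $\mathfrak{S}^{\mu}$ is the Young subgroup permuting the consecutive blocks of sizes $\mu_1,\dots,\mu_d$; $m_{\mu}=\frac{n!}{\mu_1!\cdots\mu_d!}$; $H^{\mu}=H_{\mu_1}\otimes\dots\otimes H_{\mu_d}$, identified with the subalgebra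 of $H_n$ generated by the $\overline{g}_i$ with $s_i\in\mathfrak{S}^{\mu}$. Let $\xi_1,\dots,\xi_d$ be the $d$-th roots of unity. $\mathcal{T}_{d,n}=\langle t_1,\dots,t_n\rangle$ is the group algebra of $(\mathbb{Z}/d\mathbb{Z})^n$, $\operatorname{Irr}(\mathcal{T}_{d,n})$ its set of characters ($\chi(t_j)\in\{\xi_1,\dots,\xi_d\}$), $E_{\chi}$ the primitive idempotent of $\chi$, $\operatorname{Comp}(\chi)=\mu$ with $\mu_a=\#\{j:\chi(t_j)=\xi_a\}$. $\mathfrak{S}_n$ acts by $w(\chi)(t_i)=\chi(t_{w^{-1}(i)})$. $\chi_0^{\mu}$ takes the value $\xi_1$ on the first $\mu_1$ of the $t_j$, $\xi_2$ on the next $\mu_2$, etc.; $\pi_{\chi}$ is the element of minimal length with $\pi_{\chi}(\chi_0^{\mu})=\chi$, $\mu=\operatorname{Comp}(\chi)$. Matrices in $\operatorname{Mat}_{m_{\mu}}(H^{\mu})$ are indexed by the characters $\chi$ with $\operatorname{Comp}(\chi)=\mu$, with matrix units $\boldsymbol{1}_{\chi,\chi'}$. $\Psi_{d,n}:Y_{d,n}\to\bigoplus_{\mu}\operatorname{Mat}_{m_{\mu}}(H^{\mu})$ is the algebra isomorphism $$E_{\chi}g_{w^{-1}}\mapsto u^{\ell(w^{-1})-\ell(\pi_{\chi}^{-1}w^{-1}\pi_{w(\chi)})}\boldsymbol{1}_{\chi,w(\chi)}\,\overline{g}_{\pi_{\chi}^{-1}w^{-1}\pi_{w(\chi)}}.$$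 Basic Markov traces: for a non-empty $S\subseteq\{1,\dots,d\}$, $\rho_{d,n}^{S}(x)=\sum_{\mu}\bigl(\bigotimes_{a\in S}\tau_{\mu_a}\bigr)\bigl(\operatorname{Tr}(\Psi_{d,n}(x)_{\mu})\bigr)$, the sum being over the $d$-compositions $\mu$ of $n$ such that $\mu_a\neq0$ if and only if $a\in S$, where $\Psi_{d,n}(x)_{\mu}$ is the component in $\operatorname{Mat}_{m_{\mu}}(H^{\mu})$, $\operatorname{Tr}$ is the usual matrix trace with values in $H^{\mu}$, and factors $H_0$ are treated by the identity. These families are Markov traces on $\{Y_{d,n}\}_{n\geq1}$. Links and invariants: a classical non-framed link $L$ is the closure of a braid $\beta_L$ in the classical braid group $B_n$ (generators $\sigma_1,\dots,\sigma_{n-1}$); its number of components is the number of cycles (fixed points included) of the image of $\beta_L$ in $\mathfrak{S}_n$ under $\sigma_i\mapsto s_i$. Let $\delta_{d,n}:R[B_n]\to Y_{d,n}$ be the algebra morphism $\sigma_i\mapsto(\gamma+(1-\gamma)e_i)g_i$. For a Markov trace $\{\rho_{d,n}\}_{n\geq1}$ on $\{Y_{d,n}\}_{n\geq1}$, $P_L^{\rho_d}=\rho_{d,n}(\delta_{d,n}(\beta_L))\in R$, which does not depend on the choice of $\beta_L$. $P_L^{d,S}$ is $P_L^{\rho_d}$ for $\rho_{d,n}=\rho_{d,n}^{S}$. *)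

theory Defs
  imports
    Complex_Main
    "HOL-Library.Poly_Mapping"
    "HOL-Library.Product_Plus"
    "HOL-Library.FuncSet"
    "HOL-Combinatorics.Combinatorics"
    "HOL-Algebra.Algebra"
begin

section \<open>The ground ring\<close>

text \<open>Laurent polynomials in \<open>u, v, \<gamma>\<close> are the group algebra of \<open>\<int>\<^sup>3\<close> over the complex numbers.\<close>

type_synonym laurent = "(int \<times> int \<times> int) \<Rightarrow>\<^sub>0 complex"

definition Lu :: laurent where "Lu = Poly_Mapping.single (1, 0, 0) 1"
definition Lv :: laurent where "Lv = Poly_Mapping.single (0, 1, 0) 1"
definition Lgam :: laurent where "Lgam = Poly_Mapping.single (0, 0, 1) 1"

definition upow :: "int \<Rightarrow> laurent" where
  "upow k = Poly_Mapping.single (k, 0, 0) 1"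

definition cst :: "complex \<Rightarrow> laurent" where
  "cst z = Poly_Mapping.single 0 z"

text \<open>The subring of Laurent polynomials in \<open>u, v\<close> only.\<close>

definition laurent_uv :: "laurent set" where
  "laurent_uv = {p. \<forall>(a, b, c) \<in> Poly_Mapping.keys p. c = 0}"


section \<open>Yokonuma--Hecke algebras\<close>

text \<open>The free monoid; \<open>monoid_add\<close> does not require commutativity, so that polynomial
  mappings on lists form the free associative algebra.\<close>

instantiation list :: (type) monoid_add
begin

definition zero_list :: "'a list" where "zero_list = []"
definition plus_list :: "'a list \<Rightarrow> 'a list \<Rightarrow> 'a list" where "plus_list = append"

instance by standard (simp_all add: zero_list_def plus_list_def)

end

datatype gen = GenG nat | GenT nat

type_synonym free_alg = "gen list \<Rightarrow>\<^sub>0 laurent"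

definition scal :: "laurent \<Rightarrow> free_alg" where "scal r = Poly_Mapping.single 0 r"
definition gg :: "nat \<Rightarrow> free_alg" where "gg i = Poly_Mapping.single [GenG i] 1"
definition tt :: "nat \<Rightarrow> free_alg" where "tt j = Poly_Mapping.single [GenT j] 1"

definition gens :: "nat \<Rightarrow> gen set" where
  "gens n = GenG ` {1..<n} \<union> GenT ` {1..n}"

definition free_ring :: "nat \<Rightarrow> free_alg ring" where
  "free_ring n = \<lparr>carrier = {p. Poly_Mapping.keys p \<subseteq> lists (gens n)},
     mult = (*), one = 1, ring.zero = 0, add = (+)\<rparr>"

text \<open>As \<open>t\<^sub>j\<^sup>d = 1\<close>, the power \<open>t\<^sub>j\<^bsup>-s\<^esup>\<close> is written \<open>t\<^sub>j\<^bsup>d-s\<^esup>\<close> for \<open>s \<le> d\<close>.\<close>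

definition ee :: "nat \<Rightarrow> nat \<Rightarrow> free_alg" where
  "ee d i = scal (cst (1 / of_nat d)) * (\<Sum>s = 1..d. tt i ^ s * tt (Suc i) ^ (d - s))"

definition rels :: "nat \<Rightarrow> nat \<Rightarrow> free_alg set" where
  "rels d n =
     {gg i * gg j - gg j * gg i | i j. i \<in> {1..<n} \<and> j \<in> {1..<n} \<and> (i + 1 < j \<or> j + 1 < i)}
   \<union> {gg i * gg (Suc i) * gg i - gg (Suc i) * gg i * gg (Suc i) | i. i \<in> {1..<n} \<and> Suc i \<in> {1..<n}}
   \<union> {tt i * tt j - tt j * tt i | i j. i \<in> {1..n} \<and> j \<in> {1..n}}
   \<union> {gg i * tt j - tt (Transposition.transpose i (Suc i) j) * gg i | i j. i \<in> {1..<n} \<and> j \<in> {1..n}}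
   \<union> {tt j ^ d - 1 | j. j \<in> {1..n}}
   \<union> {gg i * gg i - (scal (Lu ^ 2) + scal Lv * ee d i * gg i) | i. i \<in> {1..<n}}"

definition yh_ideal :: "nat \<Rightarrow> nat \<Rightarrow> free_alg set" where
  "yh_ideal d n = genideal (free_ring n) (rels d n)"

definition yh :: "nat \<Rightarrow> nat \<Rightarrow> free_alg set ring" where
  "yh d n = free_ring n Quot yh_ideal d n"

abbreviation hecke :: "nat \<Rightarrow> free_alg set ring" where
  "hecke n \<equiv> yh 1 n"

definition cls :: "nat \<Rightarrow> nat \<Rightarrow> free_alg \<Rightarrow> free_alg set" where
  "cls d n p = a_r_coset (free_ring n) (yh_ideal d n) p"

definition smul :: "nat \<Rightarrow> nat \<Rightarrow> laurent \<Rightarrow> free_alg set \<Rightarrow> free_alg set" where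
  "smul d n r A = cls d n (scal r) \<otimes>\<^bsub>yh d n\<^esub> A"

definition yg :: "nat \<Rightarrow> nat \<Rightarrow> nat \<Rightarrow> free_alg set" where
  "yg d n i = cls d n (gg i)"

text \<open>The form of the algebra over the Laurent polynomials in \<open>u, v\<close>.\<close>

definition yh_uv :: "nat \<Rightarrow> nat \<Rightarrow> free_alg set set" where
  "yh_uv d n = cls d n ` {p \<in> carrier (free_ring n). \<forall>w. Poly_Mapping.lookup p w \<in> laurent_uv}"

text \<open>The morphism \<open>Y\<^bsub>d,m\<^esub> \<rightarrow> Y\<^bsub>d,n\<^esub>\<close> shifting the indices of all generators by \<open>k\<close> (for
  \<open>k + m \<le> n\<close>). For \<open>k = 0\<close> and \<open>n = m + 1\<close> this is the inclusion of the tower.\<close>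

fun shift_gen :: "nat \<Rightarrow> gen \<Rightarrow> gen" where
  "shift_gen k (GenG i) = GenG (i + k)"
| "shift_gen k (GenT j) = GenT (j + k)"

definition shift :: "nat \<Rightarrow> free_alg \<Rightarrow> free_alg" where
  "shift k p = (\<Sum>w \<in> Poly_Mapping.keys p.
     Poly_Mapping.single (map (shift_gen k) w) (Poly_Mapping.lookup p w))"

definition yh_embed :: "nat \<Rightarrow> nat \<Rightarrow> nat \<Rightarrow> free_alg set \<Rightarrow> free_alg set" where
  "yh_embed d n k A = (shift k ` A) <+>\<^bsub>free_ring n\<^esub> yh_ideal d n"


section \<open>Markov traces\<close>

definition linear_form :: "nat \<Rightarrow> nat \<Rightarrow> free_alg set set \<Rightarrow> (free_alg set \<Rightarrow> laurent) \<Rightarrow> bool" where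
  "linear_form d n M f \<longleftrightarrow>
     (\<forall>x \<in> M. \<forall>y \<in> M. f (x \<oplus>\<^bsub>yh d n\<^esub> y) = f x + f y) \<and>
     (\<forall>r. \<forall>x \<in> M. f (smul d n r x) = r * f x)"

definition markov_trace :: "nat \<Rightarrow> (nat \<Rightarrow> free_alg set \<Rightarrow> laurent) \<Rightarrow> bool" where
  "markov_trace d \<rho> \<longleftrightarrow> (\<forall>n \<ge> 1.
     linear_form d n (carrier (yh d n)) (\<rho> n) \<and>
     (\<forall>x \<in> yh_uv d n. \<rho> n x \<in> laurent_uv) \<and>
     (\<forall>x \<in> carrier (yh d n). \<forall>y \<in> carrier (yh d n).
        \<rho> n (x \<otimes>\<^bsub>yh d n\<^esub> y) = \<rho> n (y \<otimes>\<^bsub>yh d n\<^esub> x)) \<and>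
     (\<forall>x \<in> carrier (yh d n).
        \<rho> (n + 1) (yh_embed d (n + 1) 0 x \<otimes>\<^bsub>yh d (n + 1)\<^esub> yg d (n + 1) n) = \<rho> n x \<and>
        \<rho> (n + 1) (yh_embed d (n + 1) 0 x \<otimes>\<^bsub>yh d (n + 1)\<^esub> inv\<^bsub>yh d (n + 1)\<^esub> yg d (n + 1) n) = \<rho> n x))"


section \<open>Permutations and standard elements\<close>

definition perm_word :: "nat list \<Rightarrow> nat \<Rightarrow> nat" where
  "perm_word is = foldr (\<lambda>i p. Transposition.transpose i (Suc i) \<circ> p) is id"

definition plen :: "nat \<Rightarrow> (nat \<Rightarrow> nat) \<Rightarrow> nat" where
  "plen n w = (LEAST r. \<exists>is. set is \<subseteq> {1..<n} \<and> length is = r \<and> perm_word is = w)"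

definition reduced_expr :: "nat \<Rightarrow> (nat \<Rightarrow> nat) \<Rightarrow> nat list \<Rightarrow> bool" where
  "reduced_expr n w is \<longleftrightarrow> set is \<subseteq> {1..<n} \<and> perm_word is = w \<and> length is = plen n w"

text \<open>The choice of the reduced expression does not matter, because of the braid relations.\<close>

definition yg_perm :: "nat \<Rightarrow> nat \<Rightarrow> (nat \<Rightarrow> nat) \<Rightarrow> free_alg set" where
  "yg_perm d n w = cls d n (prod_list (map gg (SOME is. reduced_expr n w is)))"


section \<open>Compositions, Young subgroups, characters\<close>

definition comps :: "nat \<Rightarrow> nat \<Rightarrow> (nat \<Rightarrow> nat) set" where
  "comps d n = {\<mu>. (\<forall>a. a \<notin> {1..d} \<longrightarrow> \<mu> a = 0) \<and> (\<Sum>a = 1..d. \<mu> a) = n}"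

definition offset :: "(nat \<Rightarrow> nat) \<Rightarrow> nat \<Rightarrow> nat" where
  "offset \<mu> a = (\<Sum>b \<in> {1..<a}. \<mu> b)"

definition block :: "(nat \<Rightarrow> nat) \<Rightarrow> nat \<Rightarrow> nat set" where
  "block \<mu> a = {offset \<mu> a <.. offset \<mu> a + \<mu> a}"

definition young :: "nat \<Rightarrow> (nat \<Rightarrow> nat) \<Rightarrow> (nat \<Rightarrow> nat) set" where
  "young n \<mu> = {w. w permutes {1..n} \<and> (\<forall>a. w ` block \<mu> a = block \<mu> a)}"

text \<open>The algebra \<open>H\<^sup>\<mu>\<close> as a subalgebra of \<open>H\<^sub>n\<close>: subring generated by the scalars and the
  relevant generators.\<close>

definition hecke_comp :: "nat \<Rightarrow> (nat \<Rightarrow> nat) \<Rightarrow> free_alg set set" where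
  "hecke_comp n \<mu> = generate_ring (hecke n)
     (range (\<lambda>r. cls 1 n (scal r)) \<union>
      {yg 1 n i | i. i \<in> {1..<n} \<and> Transposition.transpose i (Suc i) \<in> young n \<mu>})"

text \<open>A character is given by its values on \<open>t\<^sub>1, \<dots>, t\<^sub>n\<close>. Here and below, \<open>\<xi>\<close> enumerates the
  \<open>d\<close>-th roots of unity as \<open>\<xi> 1, \<dots>, \<xi> d\<close>.\<close>

definition chars :: "(nat \<Rightarrow> complex) \<Rightarrow> nat \<Rightarrow> nat \<Rightarrow> (nat \<Rightarrow> complex) set" where
  "chars \<xi> d n = {1..n} \<rightarrow>\<^sub>E \<xi> ` {1..d}"

definition Comp :: "(nat \<Rightarrow> complex) \<Rightarrow> nat \<Rightarrow> nat \<Rightarrow> (nat \<Rightarrow> complex) \<Rightarrow> nat \<Rightarrow> nat" where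
  "Comp \<xi> d n \<chi> = (\<lambda>a. if a \<in> {1..d} then card {j \<in> {1..n}. \<chi> j = \<xi> a} else 0)"

definition chars_of :: "(nat \<Rightarrow> complex) \<Rightarrow> nat \<Rightarrow> nat \<Rightarrow> (nat \<Rightarrow> nat) \<Rightarrow> (nat \<Rightarrow> complex) set" where
  "chars_of \<xi> d n \<mu> = {\<chi> \<in> chars \<xi> d n. Comp \<xi> d n \<chi> = \<mu>}"

definition act :: "nat \<Rightarrow> (nat \<Rightarrow> nat) \<Rightarrow> (nat \<Rightarrow> complex) \<Rightarrow> nat \<Rightarrow> complex" where
  "act n w \<chi> = (\<lambda>i \<in> {1..n}. \<chi> (inv_into UNIV w i))"

definition chi0 :: "(nat \<Rightarrow> complex) \<Rightarrow> nat \<Rightarrow> (nat \<Rightarrow> nat) \<Rightarrow> nat \<Rightarrow> complex" where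
  "chi0 \<xi> n \<mu> = (\<lambda>j \<in> {1..n}. \<xi> (THE a. j \<in> block \<mu> a))"

definition pi_char :: "(nat \<Rightarrow> complex) \<Rightarrow> nat \<Rightarrow> nat \<Rightarrow> (nat \<Rightarrow> complex) \<Rightarrow> nat \<Rightarrow> nat" where
  "pi_char \<xi> d n \<chi> =
     (ARG_MIN (plen n) w. w permutes {1..n} \<and> act n w (chi0 \<xi> n (Comp \<xi> d n \<chi>)) = \<chi>)"

text \<open>The primitive idempotent \<open>E\<^sub>\<chi> = \<Prod>\<^sub>j (1/d) \<Sum>\<^sub>s \<chi>(t\<^sub>j)\<^sup>s t\<^sub>j\<^bsup>-s\<^esup>\<close>.\<close>

definition char_idem :: "nat \<Rightarrow> nat \<Rightarrow> (nat \<Rightarrow> complex) \<Rightarrow> free_alg set" where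
  "char_idem d n \<chi> = cls d n (prod_list (map (\<lambda>j. scal (cst (1 / of_nat d)) *
     (\<Sum>s = 1..d. scal (cst (\<chi> j ^ s)) * tt j ^ (d - s))) [1..<Suc n]))"


section \<open>The isomorphism with a direct sum of matrix algebras\<close>

type_synonym mats =
  "(nat \<Rightarrow> nat) \<Rightarrow> (nat \<Rightarrow> complex) \<Rightarrow> (nat \<Rightarrow> complex) \<Rightarrow> free_alg set"

definition mk_mats :: "(nat \<Rightarrow> complex) \<Rightarrow> nat \<Rightarrow> nat \<Rightarrow> mats \<Rightarrow> mats" where
  "mk_mats \<xi> d n A =
     (\<lambda>\<mu> \<in> comps d n. \<lambda>\<chi> \<in> chars_of \<xi> d n \<mu>. \<lambda>\<chi>' \<in> chars_of \<xi> d n \<mu>. A \<mu> \<chi> \<chi>')"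

definition mat_sum :: "(nat \<Rightarrow> complex) \<Rightarrow> nat \<Rightarrow> nat \<Rightarrow> mats ring" where
  "mat_sum \<xi> d n =
     \<lparr>carrier = (\<Pi>\<^sub>E \<mu> \<in> comps d n. \<Pi>\<^sub>E \<chi> \<in> chars_of \<xi> d n \<mu>. \<Pi>\<^sub>E \<chi>' \<in> chars_of \<xi> d n \<mu>. hecke_comp n \<mu>),
      mult = (\<lambda>A B. mk_mats \<xi> d n (\<lambda>\<mu> \<chi> \<chi>'.
        finsum (hecke n) (\<lambda>\<psi>. A \<mu> \<chi> \<psi> \<otimes>\<^bsub>hecke n\<^esub> B \<mu> \<psi> \<chi>') (chars_of \<xi> d n \<mu>))),
      one = mk_mats \<xi> d n (\<lambda>\<mu> \<chi> \<chi>'. if \<chi> = \<chi>' then \<one>\<^bsub>hecke n\<^esub> else \<zero>\<^bsub>hecke n\<^esub>),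
      ring.zero = mk_mats \<xi> d n (\<lambda>\<mu> \<chi> \<chi>'. \<zero>\<^bsub>hecke n\<^esub>),
      add = (\<lambda>A B. mk_mats \<xi> d n (\<lambda>\<mu> \<chi> \<chi>'. A \<mu> \<chi> \<chi>' \<oplus>\<^bsub>hecke n\<^esub> B \<mu> \<chi> \<chi>'))\<rparr>"

text \<open>The element \<open>h\<close> times the matrix unit at \<open>(\<chi>, \<chi>')\<close>; the summand is determined by \<open>\<chi>\<close>.\<close>

definition mat_unit ::
  "(nat \<Rightarrow> complex) \<Rightarrow> nat \<Rightarrow> nat \<Rightarrow> (nat \<Rightarrow> complex) \<Rightarrow> (nat \<Rightarrow> complex) \<Rightarrow> free_alg set \<Rightarrow> mats" where
  "mat_unit \<xi> d n \<chi> \<chi>' h = mk_mats \<xi> d n (\<lambda>\<mu> \<psi> \<psi>'. if \<psi> = \<chi> \<and> \<psi>' = \<chi>' then h else \<zero>\<^bsub>hecke n\<^esub>)"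

definition is_Psi :: "(nat \<Rightarrow> complex) \<Rightarrow> nat \<Rightarrow> nat \<Rightarrow> (free_alg set \<Rightarrow> mats) \<Rightarrow> bool" where
  "is_Psi \<xi> d n \<Psi> \<longleftrightarrow>
     \<Psi> \<in> ring_iso (yh d n) (mat_sum \<xi> d n) \<and>
     (\<forall>r. \<forall>x \<in> carrier (yh d n).
        \<Psi> (smul d n r x) = mk_mats \<xi> d n (\<lambda>\<mu> \<chi> \<chi>'. smul 1 n r (\<Psi> x \<mu> \<chi> \<chi>'))) \<and>
     (\<forall>\<chi> \<in> chars \<xi> d n. \<forall>w. w permutes {1..n} \<longrightarrow>
        (let w' = inv_into UNIV w;
             x = inv_into UNIV (pi_char \<xi> d n \<chi>) \<circ> w' \<circ> pi_char \<xi> d n (act n w \<chi>)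
         in \<Psi> (char_idem d n \<chi> \<otimes>\<^bsub>yh d n\<^esub> yg_perm d n w') =
            mat_unit \<xi> d n \<chi> (act n w \<chi>)
              (smul 1 n (upow (int (plen n w') - int (plen n x))) (yg_perm 1 n x))))"


section \<open>Basic Markov traces\<close>

text \<open>The form \<open>\<Otimes>\<^bsub>a\<in>S\<^esub> \<tau>\<^bsub>\<mu> a\<^esub>\<close> on \<open>H\<^sup>\<mu>\<close>, where \<open>S\<close> is the support of \<open>\<mu>\<close>. Under the identification
  of \<open>H\<^sup>\<mu>\<close> with a subalgebra of \<open>H\<^sub>n\<close>, the pure tensor of the \<open>x a\<close> is the product of their images
  under the block embeddings; these images commute, and the order chosen is increasing in \<open>a\<close>.\<close>

definition block_prod :: "nat \<Rightarrow> (nat \<Rightarrow> nat) \<Rightarrow> nat set \<Rightarrow> (nat \<Rightarrow> free_alg set) \<Rightarrow> free_alg set" where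
  "block_prod n \<mu> S x =
     foldr (\<lambda>a y. yh_embed 1 n (offset \<mu> a) (x a) \<otimes>\<^bsub>hecke n\<^esub> y) (sorted_list_of_set S) \<one>\<^bsub>hecke n\<^esub>"

definition tau_tensor ::
  "(nat \<Rightarrow> free_alg set \<Rightarrow> laurent) \<Rightarrow> nat \<Rightarrow> (nat \<Rightarrow> nat) \<Rightarrow> nat set \<Rightarrow> free_alg set \<Rightarrow> laurent" where
  "tau_tensor \<tau> n \<mu> S = (THE f. f \<in> extensional (hecke_comp n \<mu>) \<and>
     linear_form 1 n (hecke_comp n \<mu>) f \<and>
     (\<forall>x \<in> (\<Pi> a \<in> S. carrier (hecke (\<mu> a))).
        f (block_prod n \<mu> S x) = (\<Prod>a \<in> S. \<tau> (\<mu> a) (x a))))"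

definition basic_trace ::
  "(nat \<Rightarrow> nat \<Rightarrow> complex) \<Rightarrow> (nat \<Rightarrow> free_alg set \<Rightarrow> laurent) \<Rightarrow> (nat \<Rightarrow> nat \<Rightarrow> free_alg set \<Rightarrow> mats) \<Rightarrow>
   nat \<Rightarrow> nat set \<Rightarrow> nat \<Rightarrow> free_alg set \<Rightarrow> laurent" where
  "basic_trace \<xi> \<tau> \<Psi> d S n x =
     (\<Sum>\<mu> \<in> {\<mu> \<in> comps d n. \<forall>a \<in> {1..d}. \<mu> a \<noteq> 0 \<longleftrightarrow> a \<in> S}.
        tau_tensor \<tau> n \<mu> S (finsum (hecke n) (\<lambda>\<chi>. \<Psi> d n x \<mu> \<chi> \<chi>) (chars_of (\<xi> d) d n \<mu>)))"

definition in_basic_span ::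
  "(nat \<Rightarrow> nat \<Rightarrow> complex) \<Rightarrow> (nat \<Rightarrow> free_alg set \<Rightarrow> laurent) \<Rightarrow> (nat \<Rightarrow> nat \<Rightarrow> free_alg set \<Rightarrow> mats) \<Rightarrow>
   nat \<Rightarrow> (nat \<Rightarrow> free_alg set \<Rightarrow> laurent) \<Rightarrow> bool" where
  "in_basic_span \<xi> \<tau> \<Psi> d \<rho> \<longleftrightarrow> (\<exists>c. range c \<subseteq> laurent_uv \<and>
     (\<forall>n \<ge> 1. \<forall>x \<in> carrier (yh d n).
        \<rho> n x = (\<Sum>S \<in> Pow {1..d} - {{}}. c S * basic_trace \<xi> \<tau> \<Psi> d S n x)))"


section \<open>Braids and link invariants\<close>

text \<open>\<open>(i, True)\<close> stands for \<open>\<sigma>\<^sub>i\<close> and \<open>(i, False)\<close> for its inverse.\<close>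

type_synonym braid_word = "(nat \<times> bool) list"
type_synonym braid = "braid_word set"

definition braid_words :: "nat \<Rightarrow> braid_word set" where
  "braid_words n = lists ({1..<n} \<times> UNIV)"

definition braid_rels :: "nat \<Rightarrow> (braid_word \<times> braid_word) set" where
  "braid_rels n =
     {([(i, b), (i, \<not> b)], []) | i b. i \<in> {1..<n}}
   \<union> {([(i, True), (j, True)], [(j, True), (i, True)]) | i j.
        i \<in> {1..<n} \<and> j \<in> {1..<n} \<and> (i + 1 < j \<or> j + 1 < i)}
   \<union> {([(i, True), (Suc i, True), (i, True)], [(Suc i, True), (i, True), (Suc i, True)]) | i.
        i \<in> {1..<n} \<and> Suc i \<in> {1..<n}}"

definition braid_step :: "nat \<Rightarrow> (braid_word \<times> braid_word) set" where
  "braid_step n = {(a @ l @ b, a @ r @ b) | a b l r.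
     a \<in> braid_words n \<and> b \<in> braid_words n \<and> (l, r) \<in> braid_rels n}"

definition braid_equiv :: "nat \<Rightarrow> (braid_word \<times> braid_word) set" where
  "braid_equiv n = (braid_step n \<union> (braid_step n)\<inverse>)\<^sup>*"

definition braid_group :: "nat \<Rightarrow> braid monoid" where
  "braid_group n =
     \<lparr>carrier = braid_words n // braid_equiv n,
      mult = (\<lambda>A B. braid_equiv n `` {x @ y | x y. x \<in> A \<and> y \<in> B}),
      one = braid_equiv n `` {[]}\<rparr>"

definition sig :: "nat \<Rightarrow> nat \<Rightarrow> braid" where
  "sig n i = braid_equiv n `` {[(i, True)]}"

text \<open>Value at a braid of the multiplicative map into \<open>M\<close> with \<open>\<sigma>\<^sub>i \<mapsto> f i\<close>. It is meant for
  units \<open>f i\<close> satisfying the braid relations: all words in the class then have the same value.\<close>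

definition braid_map :: "('m, 'k) monoid_scheme \<Rightarrow> (nat \<Rightarrow> 'm) \<Rightarrow> braid \<Rightarrow> 'm" where
  "braid_map M f \<beta> = the_elem
     ((\<lambda>w. foldr (\<lambda>(i, b) y. (if b then f i else inv\<^bsub>M\<^esub> (f i)) \<otimes>\<^bsub>M\<^esub> y) w \<one>\<^bsub>M\<^esub>) ` \<beta>)"

definition braid_perm :: "nat \<Rightarrow> braid \<Rightarrow> nat \<Rightarrow> nat" where
  "braid_perm n \<beta> = braid_map (sym_group n) (\<lambda>i. Transposition.transpose i (Suc i)) \<beta>"

definition num_components :: "nat \<Rightarrow> braid \<Rightarrow> nat" where
  "num_components n \<beta> = card (Orbits.orbit (braid_perm n \<beta>) ` {1..n})"

definition delta :: "nat \<Rightarrow> nat \<Rightarrow> braid \<Rightarrow> free_alg set" where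
  "delta d n \<beta> =
     braid_map (yh d n) (\<lambda>i. cls d n ((scal Lgam + scal (1 - Lgam) * ee d i) * gg i)) \<beta>"

definition link_inv :: "nat \<Rightarrow> (nat \<Rightarrow> free_alg set \<Rightarrow> laurent) \<Rightarrow> nat \<Rightarrow> braid \<Rightarrow> laurent" where
  "link_inv d \<rho> n \<beta> = \<rho> n (delta d n \<beta>)"

definition hecke_inv :: "(nat \<Rightarrow> free_alg set \<Rightarrow> laurent) \<Rightarrow> nat \<Rightarrow> braid \<Rightarrow> laurent" where
  "hecke_inv \<tau> n \<beta> = \<tau> n (braid_map (hecke n) (yg 1 n) \<beta>)"

text \<open>The HOMFLYPT polynomial as a function of braids: invariant under the Markov moves (hence a
  function of the closure), equal to \<open>1\<close> on the unknot, and satisfying the skein relation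
  \<open>P(L\<^sub>+) - u\<^sup>2 P(L\<^sub>-) = v P(L\<^sub>0)\<close>.\<close>

definition is_homflypt :: "(nat \<Rightarrow> braid \<Rightarrow> laurent) \<Rightarrow> bool" where
  "is_homflypt P \<longleftrightarrow>
     (\<forall>n \<ge> 1. \<forall>\<alpha> \<in> carrier (braid_group n). \<forall>\<beta> \<in> carrier (braid_group n).
        P n (\<alpha> \<otimes>\<^bsub>braid_group n\<^esub> \<beta>) = P n (\<beta> \<otimes>\<^bsub>braid_group n\<^esub> \<alpha>)) \<and>
     (\<forall>n \<ge> 1. \<forall>\<beta> \<in> carrier (braid_group n).
        let \<beta>' = braid_map (braid_group (n + 1)) (sig (n + 1)) \<beta> in
        P (n + 1) (\<beta>' \<otimes>\<^bsub>braid_group (n + 1)\<^esub> sig (n + 1) n) = P n \<beta> \<and>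
        P (n + 1) (\<beta>' \<otimes>\<^bsub>braid_group (n + 1)\<^esub> inv\<^bsub>braid_group (n + 1)\<^esub> sig (n + 1) n) = P n \<beta>) \<and>
     P 1 \<one>\<^bsub>braid_group 1\<^esub> = 1 \<and>
     (\<forall>n \<ge> 1. \<forall>i \<in> {1..<n}. \<forall>\<alpha> \<in> carrier (braid_group n). \<forall>\<beta> \<in> carrier (braid_group n).
        P n (\<alpha> \<otimes>\<^bsub>braid_group n\<^esub> sig n i \<otimes>\<^bsub>braid_group n\<^esub> \<beta>)
        - Lu ^ 2 * P n (\<alpha> \<otimes>\<^bsub>braid_group n\<^esub> inv\<^bsub>braid_group n\<^esub> sig n i \<otimes>\<^bsub>braid_group n\<^esub> \<beta>)
        = Lv * P n (\<alpha> \<otimes>\<^bsub>braid_group n\<^esub> \<beta>))"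

end

(*  Conjugating by the isomorphism Psi, the image of a braid is a monomial matrix: the row of a
    character chi has at most one non-zero entry, in the column of chi composed with the permutation
    of the braid. Hence only characters constant on the components of the closure contribute to the
    trace, and such a character takes at most N values. The diagonal entries depend on chi only
    through the relative order of the labels of its values, so the invariant attached to (d, S)
    equals the one attached to (|S|, {1..|S|}), and it vanishes if |S| > N.

    The tensor product of the traces tau_(mu_a) is obtained without a basis of the Hecke algebra:
    the Markov and trace conditions give v tau_(a+b)(x y) = (1 - u^2) tau_a(x) tau_b(y) for x in H_a
    and y in the shifted copy of H_b, so on H^mu the tensor product is tau_n divided by the power
    ((1 - u^2) / v)^(|S| - 1), and 1 - u^2 is not a zero divisor.  *)

theory Submission
  imports Defs
begin

section \<open>Words and congruences in the free algebra\<close>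

text \<open>The factor \<open>(1 - u^2) / v\<close> is the effect of one additional strand on the
  trace: in a Hecke algebra \<open>g_n - u^2 g_n^{-1} = v\<close>, and the Markov conditions give
  \<open>g_n\<close> and its inverse the same effect. Multiplicativity then spreads to arbitrary
  \<open>y\<close> through the spanning statement \<open>H_{b+1} = H_b + H_b g_b H_b\<close>.

  Two obstacles shape the proof. \<open>tau_tensor\<close> and \<open>braid_map\<close> are definite
  descriptions, so each must first be shown to pick out a unique value. And the isomorphism is given
  explicitly only on the elements \<open>E_chi g_w\<close>. Its values for \<open>w = id\<close> and
  \<open>w = s_i\<close> determine the matrices of the generators: left multiplication by
  \<open>E_chi\<close> isolates the row of chi and turns \<open>e_i\<close> into the scalar 1 or 0,
  according to whether two neighbouring values of chi agree. Products of such rows describe all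
  braid words, and relations in \<open>Y_{d,n}\<close> can be read off from the entries because the
  isomorphism is injective.

  As \<open>1 - u^2\<close> has no inverse among Laurent polynomials, identities between traces stay
  multiplied by \<open>(1 - u^2)^(|S| - 1)\<close> until the invariants of two pairs
  \<open>(d, S)\<close> are compared.\<close>

definition words_span :: "gen set \<Rightarrow> free_alg set" where
  "words_span A = {p. Poly_Mapping.keys p \<subseteq> lists A}"

definition gen_elt :: "gen \<Rightarrow> free_alg" where
  "gen_elt x = Poly_Mapping.single [x] 1"

text \<open>The generators of the copy of the algebra on the strands \<open>lo + 1, ..., hi\<close>.
  As \<open>g_i\<close> involves the strands \<open>i\<close> and \<open>i + 1\<close>, its index
  stays strictly below \<open>hi\<close>.\<close>

definition letters :: "nat \<Rightarrow> nat \<Rightarrow> gen set" where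
  "letters lo hi = GenG ` {lo<..<hi} \<union> GenT ` {lo<..hi}"

abbreviation FA :: "nat \<Rightarrow> free_alg set" where
  "FA n \<equiv> carrier (free_ring n)"

lemma gg_gen_elt: "gg i = gen_elt (GenG i)" and tt_gen_elt: "tt i = gen_elt (GenT i)"
  by (simp_all add: gg_def tt_def gen_elt_def)

lemma gens_letters: "gens n = letters 0 n"
  by (auto simp: gens_def letters_def)

lemma FA_eq: "FA n = words_span (gens n)"
  by (simp add: free_ring_def words_span_def)

lemma words_span_0 [simp, intro]: "0 \<in> words_span A"
  by (simp add: words_span_def)

lemma words_span_add [intro]: "p \<in> words_span A \<Longrightarrow> q \<in> words_span A \<Longrightarrow> p + q \<in> words_span A"
  using Poly_Mapping.keys_add[of p q] unfolding words_span_def by blast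

lemma words_span_uminus [intro]: "p \<in> words_span A \<Longrightarrow> - p \<in> words_span A"
  by (simp add: words_span_def)

lemma words_span_diff [intro]: "p \<in> words_span A \<Longrightarrow> q \<in> words_span A \<Longrightarrow> p - q \<in> words_span A"
  using words_span_add[of p A "- q"] words_span_uminus[of q A] by simp

lemma words_span_mult [intro]:
  assumes "p \<in> words_span A" "q \<in> words_span A" shows "p * q \<in> words_span A"
proof -
  have "a + b \<in> lists A" if "a \<in> lists A" "b \<in> lists A" for a b
    using that by (simp add: plus_list_def)
  with assms Poly_Mapping.keys_mult[of p q] show ?thesis unfolding words_span_def by blast
qed

lemma words_span_single [intro]: "w \<in> lists A \<Longrightarrow> Poly_Mapping.single w r \<in> words_span A"
  by (auto simp: words_span_def)

lemma words_span_scal [simp, intro]: "scal r \<in> words_span A"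
  by (auto simp: scal_def zero_list_def)

lemma scal_1: "scal 1 = 1" and scal_0: "scal 0 = 0"
  by (simp_all add: scal_def)

lemma words_span_1 [simp, intro]: "1 \<in> words_span A"
  using words_span_scal[of 1] by (simp add: scal_1)

lemma words_span_gen [intro]: "x \<in> A \<Longrightarrow> gen_elt x \<in> words_span A"
  by (auto simp: gen_elt_def)

lemma words_span_power [intro]: "p \<in> words_span A \<Longrightarrow> p ^ k \<in> words_span A"
  by (induction k) auto

lemma words_span_sum [intro]: "(\<And>i. i \<in> W \<Longrightarrow> f i \<in> words_span A) \<Longrightarrow> sum f W \<in> words_span A"
  by (induction W rule: infinite_finite_induct) auto

lemma words_span_prod_list [intro]:
  "(\<And>p. p \<in> set ps \<Longrightarrow> p \<in> words_span A) \<Longrightarrow> prod_list ps \<in> words_span A"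
  by (induction ps) auto

lemma words_span_mono: "A \<subseteq> B \<Longrightarrow> words_span A \<subseteq> words_span B"
  unfolding words_span_def by auto

lemma letters_mono: "lo' \<le> lo \<Longrightarrow> hi \<le> hi' \<Longrightarrow> letters lo hi \<subseteq> letters lo' hi'"
  unfolding letters_def by (intro Un_mono image_mono) auto

lemma scal_mult: "scal (r * s) = scal r * scal s"
  by (simp add: scal_def mult_single)

lemma scal_add: "scal (r + s) = scal r + scal s"
  by (simp add: scal_def single_add)

lemma scal_uminus: "scal (- r) = - scal r"
  by (simp add: scal_def single_uminus)

lemma poly_mapping_sum_single:
  "p = (\<Sum>w \<in> Poly_Mapping.keys p. Poly_Mapping.single w (Poly_Mapping.lookup p w))"
proof (rule poly_mapping_eqI)
  fix k
  show "Poly_Mapping.lookup p k = Poly_Mapping.lookup (\<Sum>w \<in> Poly_Mapping.keys p. Poly_Mapping.single w (Poly_Mapping.lookup p w)) k"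
    by (simp add: lookup_sum lookup_single when_def sum.delta' in_keys_iff)
qed

text \<open>Words grow at their right end: closure under right multiplication by one letter is the
  form in which \<open>double_coset_all\<close> and \<open>shift_in_HC\<close> can use it.\<close>

lemma words_span_induct [consumes 1, case_names scal gen add]:
  assumes p: "p \<in> words_span A"
    and scal: "\<And>r. P (scal r)"
    and gen: "\<And>p x. p \<in> words_span A \<Longrightarrow> P p \<Longrightarrow> x \<in> A \<Longrightarrow> P (p * gen_elt x)"
    and add: "\<And>p q. p \<in> words_span A \<Longrightarrow> q \<in> words_span A \<Longrightarrow> P p \<Longrightarrow> P q \<Longrightarrow> P (p + q)"
  shows "P p"
proof -
  have single: "P (Poly_Mapping.single w r)" if "w \<in> lists A" for w r
    using that
  proof (induction w rule: rev_induct)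
    case Nil
    show ?case using scal[of r] by (simp add: scal_def zero_list_def)
  next
    case (snoc x w)
    have "Poly_Mapping.single (w @ [x]) r = Poly_Mapping.single w r * gen_elt x"
      by (simp add: gen_elt_def mult_single plus_list_def)
    with snoc gen[of "Poly_Mapping.single w r" x] show ?case by auto
  qed
  have "P (\<Sum>w \<in> W. Poly_Mapping.single w (Poly_Mapping.lookup p w)) \<and>
      (\<Sum>w \<in> W. Poly_Mapping.single w (Poly_Mapping.lookup p w)) \<in> words_span A"
    if "finite W" "W \<subseteq> lists A" for W
    using that
  proof (induction W)
    case empty
    then show ?case using scal[of 0] by (simp add: scal_def)
  next
    case (insert w W)
    then show ?case by (auto intro!: add single)
  qed
  from this[of "Poly_Mapping.keys p"] p
  have "P (\<Sum>w \<in> Poly_Mapping.keys p. Poly_Mapping.single w (Poly_Mapping.lookup p w))"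
    by (simp add: words_span_def)
  then show ?thesis using poly_mapping_sum_single[of p] by argo
qed

lemma scal_commute: "scal r * p = p * scal r"
proof -
  have "p \<in> words_span UNIV" by (auto simp: words_span_def)
  then show ?thesis
  proof (induction p rule: words_span_induct)
    case (scal s)
    show ?case by (simp add: scal_mult[symmetric] mult.commute)
  next
    case (gen p x)
    have "scal r * gen_elt x = gen_elt x * scal r"
      by (simp add: scal_def gen_elt_def mult_single)
    then show ?case using gen(3) by (simp add: mult.assoc[symmetric]) (simp add: mult.assoc)
  next
    case (add p q)
    then show ?case by (simp add: algebra_simps)
  qed
qed

lemma gg_in_span [intro]: "GenG i \<in> A \<Longrightarrow> gg i \<in> words_span A"
  and tt_in_span [intro]: "GenT i \<in> A \<Longrightarrow> tt i \<in> words_span A"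
  by (auto simp: gg_gen_elt tt_gen_elt)

lemma ee_in_span [intro]: "GenT i \<in> A \<Longrightarrow> GenT (Suc i) \<in> A \<Longrightarrow> ee d i \<in> words_span A"
  unfolding ee_def by (intro words_span_mult words_span_scal words_span_sum words_span_power tt_in_span)

lemma GenG_gens [simp]: "GenG i \<in> gens n \<longleftrightarrow> 1 \<le> i \<and> i < n"
  and GenT_gens [simp]: "GenT i \<in> gens n \<longleftrightarrow> 1 \<le> i \<and> i \<le> n"
  by (auto simp: gens_def)

lemma gens_mono: "m \<le> n \<Longrightarrow> gens m \<subseteq> gens n"
  by (auto simp: gens_def)

lemma FA_mono: "m \<le> n \<Longrightarrow> FA m \<subseteq> FA n"
  unfolding FA_eq by (intro words_span_mono gens_mono)

lemma FA_up: "p \<in> FA m \<Longrightarrow> m \<le> n \<Longrightarrow> p \<in> FA n"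
  using FA_mono by blast

lemma FA_intros [intro, simp]:
  "0 \<in> FA n" "1 \<in> FA n" "scal r \<in> FA n"
  "p \<in> FA n \<Longrightarrow> q \<in> FA n \<Longrightarrow> p + q \<in> FA n"
  "p \<in> FA n \<Longrightarrow> q \<in> FA n \<Longrightarrow> p - q \<in> FA n"
  "p \<in> FA n \<Longrightarrow> q \<in> FA n \<Longrightarrow> p * q \<in> FA n"
  "p \<in> FA n \<Longrightarrow> - p \<in> FA n"
  "p \<in> FA n \<Longrightarrow> p ^ k \<in> FA n"
  by (auto simp: FA_eq)

lemma FA_gens [intro, simp]:
  "1 \<le> i \<Longrightarrow> i < n \<Longrightarrow> gg i \<in> FA n"
  "1 \<le> i \<Longrightarrow> i \<le> n \<Longrightarrow> tt i \<in> FA n"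
  "1 \<le> i \<Longrightarrow> i < n \<Longrightarrow> ee d i \<in> FA n"
  "x \<in> gens n \<Longrightarrow> gen_elt x \<in> FA n"
  by (auto simp: FA_eq)

section \<open>The free ring, its quotient and the classes of representatives\<close>

lemma free_ring_simps [simp]:
  "mult (free_ring n) = (*)" "one (free_ring n) = 1" "add (free_ring n) = (+)" "ring.zero (free_ring n) = 0"
  by (simp_all add: free_ring_def)

lemma ring_free_ring: "ring (free_ring n)"
proof (rule ringI)
  show "abelian_group (free_ring n)"
  proof (rule abelian_groupI)
    fix x assume "x \<in> FA n"
    then show "\<exists>y\<in>FA n. y \<oplus>\<^bsub>free_ring n\<^esub> x = \<zero>\<^bsub>free_ring n\<^esub>"
      by (intro bexI[of _ "- x"]) auto
  qed (auto simp: add.assoc add.commute)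
  show "monoid (free_ring n)"
    by (rule monoidI) (auto simp: mult.assoc)
qed (auto simp: algebra_simps)

lemma rels_FA: "rels d n \<subseteq> FA n"
proof -
  have t: "transpose i (Suc i) j \<in> {1..n}" if "i \<in> {1..<n}" "j \<in> {1..n}" for i j
    using that by (auto simp: transpose_def)
  show ?thesis
    unfolding rels_def using t by (auto intro!: FA_intros FA_gens simp del: atLeastAtMost_iff atLeastLessThan_iff) auto
qed

lemma ideal_yh: "ideal (yh_ideal d n) (free_ring n)"
  unfolding yh_ideal_def by (rule ring.genideal_ideal[OF ring_free_ring rels_FA])

lemma ring_yh: "ring (yh d n)"
  unfolding yh_def by (rule ideal.quotient_is_ring[OF ideal_yh])

lemma cls_hom: "cls d n \<in> ring_hom (free_ring n) (yh d n)"
  unfolding yh_def cls_def[abs_def] using ideal.rcos_ring_hom[OF ideal_yh] by simp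

lemma cls_simps:
  "p \<in> FA n \<Longrightarrow> cls d n p \<in> carrier (yh d n)"
  "p \<in> FA n \<Longrightarrow> q \<in> FA n \<Longrightarrow> cls d n (p * q) = cls d n p \<otimes>\<^bsub>yh d n\<^esub> cls d n q"
  "p \<in> FA n \<Longrightarrow> q \<in> FA n \<Longrightarrow> cls d n (p + q) = cls d n p \<oplus>\<^bsub>yh d n\<^esub> cls d n q"
  "cls d n 1 = \<one>\<^bsub>yh d n\<^esub>"
  using ring_hom_closed[OF cls_hom] ring_hom_mult[OF cls_hom] ring_hom_add[OF cls_hom]
    ring_hom_one[OF cls_hom] by simp_all

lemma cls_zero: "cls d n 0 = \<zero>\<^bsub>yh d n\<^esub>"
  using ring_hom_zero[OF cls_hom ring_free_ring ring_yh] by simp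

lemma cls_uminus: "p \<in> FA n \<Longrightarrow> cls d n (- p) = \<ominus>\<^bsub>yh d n\<^esub> cls d n p"
proof -
  assume p: "p \<in> FA n"
  interpret Y: ring "yh d n" by (rule ring_yh)
  have "cls d n (- p) \<oplus>\<^bsub>yh d n\<^esub> cls d n p = \<zero>\<^bsub>yh d n\<^esub>"
    using p cls_simps(3)[of "- p" n p d] by (simp add: cls_zero)
  then show ?thesis using p by (metis FA_intros(7) Y.minus_equality cls_simps(1))
qed

lemma yh_carrier: "carrier (yh d n) = cls d n ` FA n"
  by (auto simp: yh_def cls_def FactRing_def A_RCOSETS_def')

text \<open>Equality in the quotient, expressed on representatives, so that calculations take place
  in the ring type \<open>free_alg\<close>. Membership in the free ring is included to keep
  transitivity and symmetry free of side conditions.\<close>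

definition yeq :: "nat \<Rightarrow> nat \<Rightarrow> free_alg \<Rightarrow> free_alg \<Rightarrow> bool" where
  "yeq d n p q \<longleftrightarrow> p \<in> FA n \<and> q \<in> FA n \<and> p - q \<in> yh_ideal d n"

lemma yeq_cls: "p \<in> FA n \<Longrightarrow> q \<in> FA n \<Longrightarrow> yeq d n p q \<longleftrightarrow> cls d n p = cls d n q"
proof -
  assume p: "p \<in> FA n" and q: "q \<in> FA n"
  interpret R: ring "free_ring n" by (rule ring_free_ring)
  have "p - q = p \<ominus>\<^bsub>free_ring n\<^esub> q"
  proof -
    have "\<ominus>\<^bsub>free_ring n\<^esub> q = - q"
      using q by (intro R.minus_equality) auto
    then show ?thesis by (simp add: a_minus_def)
  qed
  then show ?thesis
    using R.quotient_eq_iff_same_a_r_cos[OF ideal_yh p q] p q by (simp add: yeq_def cls_def)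
qed

lemma yeq_FA: "yeq d n p q \<Longrightarrow> p \<in> FA n" "yeq d n p q \<Longrightarrow> q \<in> FA n"
  by (simp_all add: yeq_def)

lemma yeq_clsD: "yeq d n p q \<Longrightarrow> cls d n p = cls d n q"
proof -
  assume a: "yeq d n p q"
  show ?thesis using iffD1[OF yeq_cls[OF yeq_FA[OF a]] a] .
qed

lemma yeqI: "p \<in> FA n \<Longrightarrow> q \<in> FA n \<Longrightarrow> cls d n p = cls d n q \<Longrightarrow> yeq d n p q"
  by (rule iffD2[OF yeq_cls])

lemma yeq_refl [simp]: "yeq d n p p \<longleftrightarrow> p \<in> FA n"
proof
  show "p \<in> FA n" if "yeq d n p p" using that by (rule yeq_FA)
  show "yeq d n p p" if "p \<in> FA n" using that by (intro yeqI refl)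
qed

lemma yeq_sym: "yeq d n p q \<Longrightarrow> yeq d n q p"
  using yeqI[OF yeq_FA(2) yeq_FA(1) yeq_clsD[symmetric]] .

lemma yeq_trans [trans]: "yeq d n p q \<Longrightarrow> yeq d n q r \<Longrightarrow> yeq d n p r"
  using yeqI[OF yeq_FA(1) yeq_FA(2) trans[OF yeq_clsD yeq_clsD]] .

lemma yeq_mult: "yeq d n p p' \<Longrightarrow> yeq d n q q' \<Longrightarrow> yeq d n (p * q) (p' * q')"
  by (rule yeqI) (simp_all add: yeq_FA[of d n p p'] yeq_FA[of d n q q'] cls_simps yeq_clsD[of d n p p'] yeq_clsD[of d n q q'])

lemma yeq_add: "yeq d n p p' \<Longrightarrow> yeq d n q q' \<Longrightarrow> yeq d n (p + q) (p' + q')"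
  by (rule yeqI) (simp_all add: yeq_FA[of d n p p'] yeq_FA[of d n q q'] cls_simps yeq_clsD[of d n p p'] yeq_clsD[of d n q q'])

lemma yeq_uminus: "yeq d n p p' \<Longrightarrow> yeq d n (- p) (- p')"
  by (rule yeqI) (simp_all add: yeq_FA[of d n p p'] cls_uminus yeq_clsD[of d n p p'])

lemma yeq_diff: "yeq d n p p' \<Longrightarrow> yeq d n q q' \<Longrightarrow> yeq d n (p - q) (p' - q')"
  using yeq_add[OF _ yeq_uminus] by fastforce

lemma yeq_sum: "(\<And>i. i \<in> W \<Longrightarrow> yeq d n (f i) (g i)) \<Longrightarrow> yeq d n (sum f W) (sum g W)"
  by (induction W rule: infinite_finite_induct) (auto intro!: yeq_add)

lemma yeq_mult_left: "yeq d n q q' \<Longrightarrow> p \<in> FA n \<Longrightarrow> yeq d n (p * q) (p * q')"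
  and yeq_mult_right: "yeq d n q q' \<Longrightarrow> p \<in> FA n \<Longrightarrow> yeq d n (q * p) (q' * p)"
  by (simp_all add: yeq_mult)

lemma yeq_rel: "p - q \<in> rels d n \<Longrightarrow> p \<in> FA n \<Longrightarrow> q \<in> FA n \<Longrightarrow> yeq d n p q"
  unfolding yeq_def yh_ideal_def using ring.genideal_self[OF ring_free_ring rels_FA] by blast

lemma yeq_far: "1 \<le> i \<Longrightarrow> i < n \<Longrightarrow> 1 \<le> j \<Longrightarrow> j < n \<Longrightarrow> i + 1 < j \<or> j + 1 < i \<Longrightarrow>
    yeq d n (gg i * gg j) (gg j * gg i)"
proof (rule yeq_rel)
  assume "1 \<le> i" "i < n" "1 \<le> j" "j < n" "i + 1 < j \<or> j + 1 < i"
  then have "i \<in> {1..<n} \<and> j \<in> {1..<n} \<and> (i + 1 < j \<or> j + 1 < i)" by simp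
  then show "gg i * gg j - gg j * gg i \<in> rels d n"
    unfolding rels_def by blast
qed auto

lemma yeq_braid: "1 \<le> i \<Longrightarrow> Suc i < n \<Longrightarrow>
    yeq d n (gg i * gg (Suc i) * gg i) (gg (Suc i) * gg i * gg (Suc i))"
proof (rule yeq_rel)
  assume "1 \<le> i" "Suc i < n"
  then have "i \<in> {1..<n} \<and> Suc i \<in> {1..<n}" by simp
  then show "gg i * gg (Suc i) * gg i - gg (Suc i) * gg i * gg (Suc i) \<in> rels d n"
    unfolding rels_def by blast
qed auto

lemma yeq_tt: "1 \<le> i \<Longrightarrow> i \<le> n \<Longrightarrow> 1 \<le> j \<Longrightarrow> j \<le> n \<Longrightarrow> yeq d n (tt i * tt j) (tt j * tt i)"
proof (rule yeq_rel)
  assume "1 \<le> i" "i \<le> n" "1 \<le> j" "j \<le> n"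
  then have "i \<in> {1..n} \<and> j \<in> {1..n}" by simp
  then show "tt i * tt j - tt j * tt i \<in> rels d n"
    unfolding rels_def by blast
qed auto

lemma yeq_gt:
  assumes "1 \<le> i" "i < n" "1 \<le> j" "j \<le> n"
  shows "yeq d n (gg i * tt j) (tt (transpose i (Suc i) j) * gg i)"
proof (rule yeq_rel)
  have "transpose i (Suc i) j \<in> {1..n}" using assms by (auto simp: transpose_def)
  then show "gg i * tt j \<in> FA n" "tt (transpose i (Suc i) j) * gg i \<in> FA n"
    using assms by auto
  have "i \<in> {1..<n} \<and> j \<in> {1..n}" using assms by simp
  then show "gg i * tt j - tt (transpose i (Suc i) j) * gg i \<in> rels d n"
    unfolding rels_def by blast
qed

lemma yeq_td: "1 \<le> j \<Longrightarrow> j \<le> n \<Longrightarrow> yeq d n (tt j ^ d) 1"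
proof (rule yeq_rel)
  assume "1 \<le> j" "j \<le> n"
  then have "j \<in> {1..n}" by simp
  then show "tt j ^ d - 1 \<in> rels d n"
    unfolding rels_def by blast
qed auto

lemma yeq_gg: "1 \<le> i \<Longrightarrow> i < n \<Longrightarrow> yeq d n (gg i * gg i) (scal (Lu ^ 2) + scal Lv * ee d i * gg i)"
proof (rule yeq_rel)
  assume "1 \<le> i" "i < n"
  then have "i \<in> {1..<n}" by simp
  then show "gg i * gg i - (scal (Lu ^ 2) + scal Lv * ee d i * gg i) \<in> rels d n"
    unfolding rels_def by blast
qed auto

text \<open>Generators on disjoint intervals of strands commute. The bound
  \<open>hi \<le> lo'\<close> makes the indices of two letters \<open>g_i\<close>,
  \<open>g_j\<close> differ by at least 2 and keeps each \<open>g\<close> from moving the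
  \<open>t\<close> of the other side. Induction on one factor and then on the other extends this to
  all elements.\<close>

lemma yeq_commute:
  assumes "p \<in> words_span (letters lo hi)" "q \<in> words_span (letters lo' hi')" "hi \<le> lo'" "hi' \<le> n" "hi \<le> n"
  shows "yeq d n (p * q) (q * p)"
proof -
  have letter: "yeq d n (gen_elt x * gen_elt y) (gen_elt y * gen_elt x)"
    if x: "x \<in> letters lo hi" and y: "y \<in> letters lo' hi'" for x y
  proof -
    consider (GG) i j where "x = GenG i" "y = GenG j" "lo < i" "i < hi" "lo' < j" "j < hi'"
      | (GT) i j where "x = GenG i" "y = GenT j" "lo < i" "i < hi" "lo' < j" "j \<le> hi'"
      | (TG) i j where "x = GenT i" "y = GenG j" "lo < i" "i \<le> hi" "lo' < j" "j < hi'"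
      | (TT) i j where "x = GenT i" "y = GenT j" "lo < i" "i \<le> hi" "lo' < j" "j \<le> hi'"
      using x y unfolding letters_def by auto
    then show ?thesis
    proof cases
      case GG
      then show ?thesis using yeq_far[of i n j d] assms by (simp add: gg_gen_elt)
    next
      case GT
      then have "transpose i (Suc i) j = j" using assms by (simp add: transpose_def)
      with GT show ?thesis using yeq_gt[of i n j d] assms by (simp add: gg_gen_elt tt_gen_elt)
    next
      case TG
      then have "transpose j (Suc j) i = i" using assms by (simp add: transpose_def)
      with TG show ?thesis using yeq_sym[OF yeq_gt[of j n i d]] assms by (simp add: gg_gen_elt tt_gen_elt)
    next
      case TT
      then show ?thesis using yeq_tt[of i n j d] assms by (simp add: tt_gen_elt)
    qed
  qed
  have sub: "words_span (letters lo hi) \<subseteq> FA n" "words_span (letters lo' hi') \<subseteq> FA n"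
    unfolding FA_eq gens_letters using assms by (intro words_span_mono letters_mono; simp)+
  have one: "yeq d n (gen_elt x * q) (q * gen_elt x)" if x: "x \<in> letters lo hi" for x
    using assms(2)
  proof (induction q rule: words_span_induct)
    case (scal r)
    then show ?case using sub x by (auto simp: scal_commute intro!: words_span_gen)
  next
    case (gen p y)
    have [simp]: "gen_elt x \<in> FA n" "gen_elt y \<in> FA n" "p \<in> FA n" using gen sub x by auto
    have "yeq d n (gen_elt x * p * gen_elt y) (p * gen_elt x * gen_elt y)"
      using gen by (intro yeq_mult_right) auto
    also have "yeq d n (p * gen_elt x * gen_elt y) (p * gen_elt y * gen_elt x)"
      using yeq_mult_left[OF letter[OF x gen(2)], of p] by (simp add: mult.assoc)
    finally show ?case by (simp add: mult.assoc)
  next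
    case (add p q)
    then show ?case by (auto simp: algebra_simps intro!: yeq_add)
  qed
  show ?thesis using assms(1)
  proof (induction p rule: words_span_induct)
    case (scal r)
    then show ?case using sub assms(2) by (auto simp: scal_commute)
  next
    case (gen p x)
    have [simp]: "gen_elt x \<in> FA n" "q \<in> FA n" "p \<in> FA n" using gen sub assms(2) by auto
    have "yeq d n (p * gen_elt x * q) (p * (q * gen_elt x))"
      using one[OF gen(2)] by (auto simp: mult.assoc intro!: yeq_mult_left)
    also have "yeq d n (p * (q * gen_elt x)) (q * p * gen_elt x)"
      using gen(3) by (auto simp: mult.assoc[symmetric] intro!: yeq_mult_right)
    finally show ?case by (simp add: mult.assoc)
  next
    case (add p q)
    then show ?case by (auto simp: algebra_simps intro!: yeq_add)
  qed
qed

section \<open>Shifting indices\<close>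

text \<open>A common index set for several polynomials makes additivity of \<open>shift\<close> a
  termwise statement.\<close>

lemma shift_superset:
  assumes "finite B" "Poly_Mapping.keys p \<subseteq> B"
  shows "shift k p = (\<Sum>w \<in> B. Poly_Mapping.single (map (shift_gen k) w) (Poly_Mapping.lookup p w))"
  unfolding shift_def using assms by (intro sum.mono_neutral_left) (auto simp: in_keys_iff)

lemma shift_single: "shift k (Poly_Mapping.single w r) = Poly_Mapping.single (map (shift_gen k) w) r"
  by (subst shift_superset[of "{w}"]) auto

lemma shift_add: "shift k (p + q) = shift k p + shift k q"
proof -
  let ?B = "Poly_Mapping.keys p \<union> Poly_Mapping.keys q"
  have "Poly_Mapping.keys (p + q) \<subseteq> ?B" by (rule Poly_Mapping.keys_add)
  then show ?thesis
    by (simp add: shift_superset[of ?B] lookup_add single_add sum.distrib)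
qed

lemma shift_0: "shift k 0 = 0"
  by (simp add: shift_def)

lemma shift_uminus: "shift k (- p) = - shift k p"
  using shift_add[of k p "- p"] by (simp add: shift_0 eq_neg_iff_add_eq_0 add.commute)

lemma shift_diff: "shift k (p - q) = shift k p - shift k q"
  using shift_add[of k p "- q"] by (simp add: shift_uminus)

lemma shift_sum: "shift k (sum f A) = (\<Sum>a \<in> A. shift k (f a))"
  by (induction A rule: infinite_finite_induct) (simp_all add: shift_0 shift_add)

lemma shift_mult: "shift k (p * q) = shift k p * shift k q"
proof -
  let ?s = "\<lambda>p w. Poly_Mapping.single w (Poly_Mapping.lookup p w)"
  have single: "shift k (?s p w * ?s q w') = shift k (?s p w) * shift k (?s q w')" for w w'
    by (simp add: mult_single shift_single plus_list_def)
  have "shift k ((\<Sum>w \<in> Poly_Mapping.keys p. ?s p w) * (\<Sum>w \<in> Poly_Mapping.keys q. ?s q w))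
      = shift k (\<Sum>w \<in> Poly_Mapping.keys p. ?s p w) * shift k (\<Sum>w \<in> Poly_Mapping.keys q. ?s q w)"
    unfolding sum_product shift_sum single ..
  then show ?thesis by (simp only: poly_mapping_sum_single[symmetric])
qed

lemma shift_scal [simp]: "shift k (scal r) = scal r"
  by (simp add: scal_def shift_single zero_list_def)

lemma shift_1 [simp]: "shift k 1 = 1"
  using shift_scal[of k 1] by (simp only: scal_1)

lemma shift_power: "shift k (p ^ m) = shift k p ^ m"
  by (induction m) (simp_all add: shift_mult)

lemma shift_gen_elt: "shift k (gen_elt x) = gen_elt (shift_gen k x)"
  by (simp add: gen_elt_def shift_single)

lemma shift_gg [simp]: "shift k (gg i) = gg (i + k)" and shift_tt [simp]: "shift k (tt i) = tt (i + k)"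
  by (simp_all add: gg_gen_elt tt_gen_elt shift_gen_elt)

lemma shift_ee [simp]: "shift k (ee d i) = ee d (i + k)"
  by (simp add: ee_def shift_mult shift_sum shift_power)

lemma shift_zero_index [simp]: "shift 0 p = p"
proof -
  have "shift_gen 0 = id"
  proof
    show "shift_gen 0 x = id x" for x by (cases x) auto
  qed
  then show ?thesis by (simp add: shift_def poly_mapping_sum_single[symmetric])
qed

lemma shift_in_span:
  assumes "p \<in> words_span (letters lo hi)"
  shows "shift k p \<in> words_span (letters (lo + k) (hi + k))"
  using assms
proof (induction p rule: words_span_induct)
  case (gen p x)
  have "shift_gen k x \<in> letters (lo + k) (hi + k)" using gen(2) by (auto simp: letters_def)
  with gen show ?case by (auto simp: shift_mult shift_gen_elt)
qed (auto simp: shift_add)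

lemma shift_FA_letters: "p \<in> FA m \<Longrightarrow> shift k p \<in> words_span (letters k (k + m))"
  using shift_in_span[of p 0 m k] by (simp add: FA_eq gens_letters add.commute)

lemma letters_span_FA: "hi \<le> n \<Longrightarrow> words_span (letters lo hi) \<subseteq> FA n"
  unfolding FA_eq gens_letters by (intro words_span_mono letters_mono) auto

lemma shift_FA: "p \<in> FA m \<Longrightarrow> k + m \<le> n \<Longrightarrow> shift k p \<in> FA n"
  using shift_FA_letters letters_span_FA by blast

lemma transpose_shift: "transpose (i + k) (Suc (i + k)) (j + k) = transpose i (Suc i) j + (k::nat)"
  by (auto simp: transpose_def)

lemma shift_rels:
  assumes "k + m \<le> n" "p \<in> rels d m"
  shows "shift k p \<in> rels d n"
proof -
  consider (far) i j where "p = gg i * gg j - gg j * gg i" "i \<in> {1..<m}" "j \<in> {1..<m}" "i + 1 < j \<or> j + 1 < i"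
    | (braid) i where "p = gg i * gg (Suc i) * gg i - gg (Suc i) * gg i * gg (Suc i)" "i \<in> {1..<m}" "Suc i \<in> {1..<m}"
    | (tt) i j where "p = tt i * tt j - tt j * tt i" "i \<in> {1..m}" "j \<in> {1..m}"
    | (gt) i j where "p = gg i * tt j - tt (transpose i (Suc i) j) * gg i" "i \<in> {1..<m}" "j \<in> {1..m}"
    | (td) j where "p = tt j ^ d - 1" "j \<in> {1..m}"
    | (quad) i where "p = gg i * gg i - (scal (Lu ^ 2) + scal Lv * ee d i * gg i)" "i \<in> {1..<m}"
    using assms(2) unfolding rels_def by blast
  then show ?thesis
  proof cases
    case far
    then have "shift k p = gg (i + k) * gg (j + k) - gg (j + k) * gg (i + k)"
      "i + k \<in> {1..<n} \<and> j + k \<in> {1..<n} \<and> (i + k + 1 < j + k \<or> j + k + 1 < i + k)"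
      using assms(1) by (auto simp: shift_diff shift_mult)
    then show ?thesis unfolding rels_def by blast
  next
    case braid
    then have "shift k p = gg (i + k) * gg (Suc (i + k)) * gg (i + k) - gg (Suc (i + k)) * gg (i + k) * gg (Suc (i + k))"
      "i + k \<in> {1..<n} \<and> Suc (i + k) \<in> {1..<n}"
      using assms(1) by (auto simp: shift_diff shift_mult)
    then show ?thesis unfolding rels_def by blast
  next
    case tt
    then have "shift k p = tt (i + k) * tt (j + k) - tt (j + k) * tt (i + k)"
      "i + k \<in> {1..n} \<and> j + k \<in> {1..n}"
      using assms(1) by (auto simp: shift_diff shift_mult)
    then show ?thesis unfolding rels_def by blast
  next
    case gt
    then have "shift k p = gg (i + k) * tt (j + k) - tt (transpose (i + k) (Suc (i + k)) (j + k)) * gg (i + k)"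
      "i + k \<in> {1..<n} \<and> j + k \<in> {1..n}"
      using assms(1) by (auto simp: shift_diff shift_mult transpose_shift)
    then show ?thesis unfolding rels_def by blast
  next
    case td
    then have "shift k p = tt (j + k) ^ d - 1" "j + k \<in> {1..n}"
      using assms(1) by (auto simp: shift_diff shift_power)
    then show ?thesis unfolding rels_def by blast
  next
    case quad
    then have "shift k p = gg (i + k) * gg (i + k) - (scal (Lu ^ 2) + scal Lv * ee d (i + k) * gg (i + k))"
      "i + k \<in> {1..<n}"
      using assms(1) by (auto simp: shift_diff shift_mult shift_add)
    then show ?thesis unfolding rels_def by blast
  qed
qed

text \<open>The preimage of an ideal under the ring homomorphism \<open>shift k\<close> is an ideal.
  It contains the relations on \<open>m\<close> strands, hence the ideal they generate.\<close>

lemma shift_ideal: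
  assumes kmn: "k + m \<le> n" and p: "p \<in> yh_ideal d m"
  shows "shift k p \<in> yh_ideal d n"
proof -
  have hom: "ring_hom_ring (free_ring m) (free_ring n) (shift k)"
    using kmn by (intro ring_hom_ringI ring_free_ring) (auto simp: shift_FA shift_mult shift_add)
  have "ideal {p \<in> FA m. shift k p \<in> yh_ideal d n} (free_ring m)"
    by (rule ring_hom_ring.ideal_vimage[OF hom ideal_yh])
  moreover have "rels d m \<subseteq> {p \<in> FA m. shift k p \<in> yh_ideal d n}"
    using rels_FA shift_rels[OF kmn] ring.genideal_self[OF ring_free_ring rels_FA]
    unfolding yh_ideal_def by blast
  ultimately have "yh_ideal d m \<subseteq> {p \<in> FA m. shift k p \<in> yh_ideal d n}"
    unfolding yh_ideal_def[of d m] by (intro ring.genideal_minimal ring_free_ring)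
  with p show ?thesis by blast
qed

lemma yeq_shift: "yeq d m p q \<Longrightarrow> k + m \<le> n \<Longrightarrow> yeq d n (shift k p) (shift k q)"
  unfolding yeq_def using shift_ideal[of k m n "p - q" d] by (auto simp: shift_FA shift_diff)

lemma yeq_up: "yeq d m p q \<Longrightarrow> m \<le> n \<Longrightarrow> yeq d n p q"
  using yeq_shift[of d m p q 0 n] by simp

text \<open>The shifted coset is in general only part of a coset of the larger ideal; the ideal
  added in \<open>yh_embed\<close> fills it up, and absorbs the shifts of the smaller ideal.\<close>

lemma yh_embed_cls:
  assumes p: "p \<in> FA m" and kmn: "k + m \<le> n"
  shows "yh_embed d n k (cls d m p) = cls d n (shift k p)"
proof -
  interpret I: ideal "yh_ideal d n" "free_ring n" by (rule ideal_yh)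
  interpret J: ideal "yh_ideal d m" "free_ring m" by (rule ideal_yh)
  have cm: "cls d m p = {h + p | h. h \<in> yh_ideal d m}"
    by (auto simp: cls_def a_r_coset_def r_coset_def)
  have cn: "cls d n (shift k p) = {h + shift k p | h. h \<in> yh_ideal d n}"
    by (auto simp: cls_def a_r_coset_def r_coset_def)
  have add: "a + b \<in> yh_ideal d n" if "a \<in> yh_ideal d n" "b \<in> yh_ideal d n" for a b
    using additive_subgroup.a_closed[OF I.additive_subgroup_axioms that] by simp
  have "0 \<in> yh_ideal d m" using additive_subgroup.zero_closed[OF J.additive_subgroup_axioms] by simp
  have e: "yh_embed d n k (cls d m p) = {shift k (h + p) + h' | h h'. h \<in> yh_ideal d m \<and> h' \<in> yh_ideal d n}"
    unfolding yh_embed_def cm set_add_def set_mult_def by auto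
  show ?thesis
  proof (intro subset_antisym subsetI)
    fix x assume "x \<in> yh_embed d n k (cls d m p)"
    then obtain h h' where h: "x = shift k (h + p) + h'" "h \<in> yh_ideal d m" "h' \<in> yh_ideal d n"
      unfolding e by blast
    then have "x = (shift k h + h') + shift k p" by (simp add: shift_add algebra_simps)
    then show "x \<in> cls d n (shift k p)"
      unfolding cn using add[OF shift_ideal[OF kmn h(2)] h(3)] by blast
  next
    fix x assume "x \<in> cls d n (shift k p)"
    then obtain h where h: "x = h + shift k p" "h \<in> yh_ideal d n" unfolding cn by blast
    then have "x = shift k (0 + p) + h" by (simp add: add.commute)
    then show "x \<in> yh_embed d n k (cls d m p)"
      unfolding e using h \<open>0 \<in> yh_ideal d m\<close> by blast
  qed
qed

section \<open>The Hecke algebra\<close>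

text \<open>For \<open>d = 1\<close> only the term \<open>s = 1\<close> is present. So
  \<open>e_i\<close> is the letter \<open>t_i\<close> in the free algebra and becomes 1 only modulo
  the relations, through \<open>yeq_tt_1\<close>.\<close>

lemma ee_1: "ee 1 i = tt i"
  by (simp add: ee_def cst_def scal_1[unfolded scal_def] scal_def)

lemma yeq_tt_1: "1 \<le> i \<Longrightarrow> i \<le> n \<Longrightarrow> yeq 1 n (tt i) 1"
  using yeq_td[of i n 1] by simp

lemma yeq_gg_1:
  assumes "1 \<le> i" "i < n" shows "yeq 1 n (gg i * gg i) (scal (Lu ^ 2) + scal Lv * gg i)"
proof -
  have "yeq 1 n (gg i * gg i) (scal (Lu ^ 2) + scal Lv * tt i * gg i)"
    using yeq_gg[OF assms, of 1] by (simp only: ee_1)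
  also have "yeq 1 n (scal (Lu ^ 2) + scal Lv * tt i * gg i) (scal (Lu ^ 2) + scal Lv * 1 * gg i)"
    using assms by (intro yeq_add yeq_mult yeq_tt_1) auto
  finally show ?thesis by simp
qed

text \<open>Up to the defining relations, \<open>H\<^bsub>n+1\<^esub> = H\<^sub>n + H\<^sub>n g\<^sub>n H\<^sub>n\<close>.\<close>

inductive double_coset :: "nat \<Rightarrow> free_alg \<Rightarrow> bool" for n where
  base: "z \<in> FA n \<Longrightarrow> double_coset n z"
| coset: "1 \<le> n \<Longrightarrow> z \<in> FA n \<Longrightarrow> z' \<in> FA n \<Longrightarrow> double_coset n (z * gg n * z')"
| sum: "double_coset n p \<Longrightarrow> double_coset n q \<Longrightarrow> double_coset n (p + q)"
| cong: "double_coset n p \<Longrightarrow> yeq 1 (Suc n) p q \<Longrightarrow> double_coset n q"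

lemma double_coset_FA: "double_coset n p \<Longrightarrow> p \<in> FA (Suc n)"
proof (induction rule: double_coset.induct)
  case (base z)
  then show ?case by (rule FA_up) simp
next
  case (coset z z')
  then have "z \<in> FA (Suc n)" "z' \<in> FA (Suc n)" by (auto intro: FA_up)
  with coset show ?case by simp
qed (auto simp: yeq_FA)

lemma double_coset_lmult:
  assumes "double_coset n p" "y \<in> FA n" shows "double_coset n (y * p)"
  using assms(1)
proof (induction rule: double_coset.induct)
  case (base z)
  then show ?case using assms(2) by (auto intro: double_coset.base)
next
  case (coset z z')
  then show ?case using double_coset.coset[of n "y * z" z'] assms(2) by (simp add: mult.assoc)
next
  case (sum p q)
  then show ?case by (simp add: distrib_left double_coset.sum)
next
  case (cong p q)
  have "yeq 1 (Suc n) (y * p) (y * q)"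
    using cong assms(2) FA_mono[of n "Suc n"] by (auto intro!: yeq_mult_left)
  with cong show ?case by (auto intro: double_coset.cong)
qed

text \<open>Two occurrences of \<open>g_n\<close> are reduced to one. Elements of
  \<open>H_{n-1}\<close> commute with \<open>g_n\<close>; what remains between the two is either
  nothing, and \<open>g_n^2 = u^2 + v g_n\<close> applies, or \<open>g_{n-1}\<close>, and the braid
  relation gives \<open>g_{n-1} g_n g_{n-1}\<close>.\<close>

lemma gg_double_coset_gg:
  assumes "1 \<le> n" "double_coset (n - 1) p"
  shows "double_coset n (gg n * p * gg n)"
  using assms(2)
proof (induction rule: double_coset.induct)
  case (base z)
  have z: "z \<in> FA n" "z \<in> FA (Suc n)" using base by (auto intro: FA_up)
  have gn: "gg n \<in> words_span (letters (n - 1) (Suc n))"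
    using assms(1) by (auto simp: letters_def)
  have "yeq 1 (Suc n) (z * gg n) (gg n * z)"
    using base gn assms(1)
    by (intro yeq_commute[where lo = 0 and hi = "n - 1" and lo' = "n - 1" and hi' = "Suc n"])
      (auto simp: FA_eq gens_letters)
  have "yeq 1 (Suc n) (z * (gg n * gg n)) (gg n * z * gg n)"
    using yeq_mult_right[OF \<open>yeq 1 (Suc n) (z * gg n) (gg n * z)\<close>, of "gg n"] assms(1) z
    by (simp add: mult.assoc)
  moreover have "yeq 1 (Suc n) (z * (scal (Lu ^ 2) + scal Lv * gg n)) (z * (gg n * gg n))"
    using assms(1) z by (intro yeq_mult_left yeq_sym[OF yeq_gg_1]) auto
  ultimately have "yeq 1 (Suc n) (z * scal (Lu ^ 2) + (z * scal Lv) * gg n * 1) (gg n * z * gg n)"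
    using yeq_trans by (fastforce simp: algebra_simps)
  moreover have "double_coset n (z * scal (Lu ^ 2) + (z * scal Lv) * gg n * 1)"
    using z assms(1) by (intro double_coset.sum double_coset.base double_coset.coset) auto
  ultimately show ?case by (rule double_coset.cong[rotated])
next
  case (coset a b)
  define m where "m = n - 1"
  have n: "n = Suc m" and m: "1 \<le> m" using coset assms(1) by (auto simp: m_def)
  have ab: "a \<in> FA m" "b \<in> FA m" "a \<in> FA n" "b \<in> FA n" "a \<in> FA (Suc n)" "b \<in> FA (Suc n)"
    using coset by (auto simp: m_def intro: FA_up)
  have gn: "gg n \<in> words_span (letters (n - 1) (Suc n))"
    using assms(1) by (auto simp: letters_def)
  have ca: "yeq 1 (Suc n) (a * gg n) (gg n * a)" and cb: "yeq 1 (Suc n) (b * gg n) (gg n * b)"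
    using coset gn assms(1)
    by (intro yeq_commute[where lo = 0 and hi = "n - 1" and lo' = "n - 1" and hi' = "Suc n"];
        auto simp: FA_eq gens_letters)+
  have gF [simp]: "gg n \<in> FA (Suc n)" "gg m \<in> FA (Suc n)" "gg m \<in> FA n" using n m by auto
  have "yeq 1 (Suc n) (a * gg m * gg n * gg m * b) (a * (gg n * gg m * gg n) * b)"
    using yeq_braid[of m "Suc n" 1] n m ab
    by (auto simp: mult.assoc intro!: yeq_mult_left yeq_mult_right)
      (simp add: mult.assoc[symmetric] yeq_mult_right)
  also have "a * (gg n * gg m * gg n) * b = (a * gg n) * gg m * (gg n * b)"
    by (simp add: mult.assoc)
  also have "yeq 1 (Suc n) ((a * gg n) * gg m * (gg n * b)) ((gg n * a) * gg m * (b * gg n))"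
    using ca yeq_sym[OF cb] by (auto intro!: yeq_mult)
  also have "(gg n * a) * gg m * (b * gg n) = gg n * (a * gg (n - 1) * b) * gg n"
    by (simp add: mult.assoc m_def)
  finally have "yeq 1 (Suc n) ((a * gg m) * gg n * (gg m * b)) (gg n * (a * gg (n - 1) * b) * gg n)"
    by (simp add: mult.assoc)
  then show ?case
    using ab assms(1) by (intro double_coset.cong[OF double_coset.coset[of n "a * gg m" "gg m * b"]]) auto
next
  case (sum p q)
  then show ?case by (simp add: algebra_simps double_coset.sum)
next
  case (cong p q)
  have "yeq 1 (Suc n) p q" using cong(2) assms(1) yeq_up[of 1 n p q "Suc n"] by simp
  then have "yeq 1 (Suc n) (gg n * p * gg n) (gg n * q * gg n)"
    using assms(1) by (auto intro!: yeq_mult)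
  with cong show ?case by (auto intro: double_coset.cong)
qed

lemma double_coset_all:
  "p \<in> FA (Suc n) \<Longrightarrow> double_coset n p"
proof (induction n arbitrary: p rule: less_induct)
  case (less n)
  have step: "double_coset n (q * gen_elt x)" if q: "double_coset n q" and x: "x \<in> gens (Suc n)" for q x
    using q
  proof (induction rule: double_coset.induct)
    case (base z)
    consider "x \<in> gens n" | "x = GenT (Suc n)" | "x = GenG n" "1 \<le> n"
      using x by (fastforce simp: gens_def not_less_eq_eq less_Suc_eq le_Suc_eq)
    then show ?case
    proof cases
      case 1
      then show ?thesis using base by (auto intro: double_coset.base)
    next
      case 2
      \<comment> \<open>The new letter \<open>t_{n+1}\<close> equals 1 in the Hecke algebra, so it
        does not lead out of \<open>H_n\<close>.\<close>
      have "yeq 1 (Suc n) (z * 1) (z * gen_elt x)"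
        using 2 base FA_mono[of n "Suc n"] yeq_tt_1[of "Suc n" "Suc n"]
        by (intro yeq_mult_left) (auto simp: tt_gen_elt yeq_sym)
      then show ?thesis using base by (auto intro: double_coset.base double_coset.cong)
    next
      case 3
      then show ?thesis using double_coset.coset[of n z 1] base by (simp add: gg_gen_elt)
    qed
  next
    case (coset z z')
    consider "x \<in> gens n" | "x = GenT (Suc n)" | "x = GenG n" "1 \<le> n"
      using x by (fastforce simp: gens_def not_less_eq_eq less_Suc_eq le_Suc_eq)
    then show ?case
    proof cases
      case 1
      then show ?thesis using coset double_coset.coset[of n z "z' * gen_elt x"] by (simp add: mult.assoc)
    next
      case 2
      have "yeq 1 (Suc n) (z * gg n * z' * 1) (z * gg n * z' * gen_elt x)"
        using 2 coset FA_up[of z n "Suc n"] FA_up[of z' n "Suc n"] yeq_tt_1[of "Suc n" "Suc n"]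
        by (intro yeq_mult_left) (auto simp: tt_gen_elt yeq_sym)
      then show ?thesis using coset double_coset.coset double_coset.cong by fastforce
    next
      case 3
      \<comment> \<open>The element between the two occurrences of \<open>g_n\<close> lies in
        \<open>H_n\<close> and has to be decomposed one level lower; this is where the induction
        hypothesis enters.\<close>
      have "double_coset (n - 1) z'" using less.IH[of "n - 1" z'] coset 3 by simp
      from double_coset_lmult[OF gg_double_coset_gg[OF 3(2) this], of z] coset 3
      show ?thesis by (simp add: gg_gen_elt mult.assoc)
    qed
  next
    case (sum p q)
    then show ?case by (simp add: algebra_simps double_coset.sum)
  next
    case (cong p q)
    have "yeq 1 (Suc n) (p * gen_elt x) (q * gen_elt x)"
      using cong x by (auto intro!: yeq_mult_right)
    with cong show ?case by (auto intro: double_coset.cong)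
  qed
  have "p \<in> words_span (gens (Suc n))" using less by (simp add: FA_eq)
  then show ?case
  proof (induction p rule: words_span_induct)
    case (scal r)
    show ?case by (intro double_coset.base) simp
  next
    case (gen p x)
    then show ?case using step by blast
  next
    case (add p q)
    then show ?case by (intro double_coset.sum)
  qed
qed

section \<open>Laurent polynomials\<close>

lemma upow_add: "upow a * upow b = upow (a + b)"
  by (simp add: upow_def mult_single)

lemma upow_0 [simp]: "upow 0 = 1"
  by (simp add: upow_def zero_prod_def[symmetric])

lemma Lu_power2: "Lu ^ 2 = upow 2"
  by (simp add: Lu_def upow_def power2_eq_square mult_single)

definition Lvinv :: laurent where "Lvinv = Poly_Mapping.single (0, - 1, 0) 1"

lemma Lvinv: "Lvinv * Lv = 1"
  by (simp add: Lvinv_def Lv_def mult_single zero_prod_def[symmetric])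

lemma Lv_cancel: "Lv * p = Lv * q \<Longrightarrow> p = q"
proof -
  assume "Lv * p = Lv * q"
  then have "Lvinv * Lv * p = Lvinv * Lv * q" by (simp only: mult.assoc)
  then show "p = q" by (simp add: Lvinv)
qed

definition Lgaminv :: laurent where "Lgaminv = Poly_Mapping.single (0, 0, - 1) 1"

lemma Lgaminv: "Lgaminv * Lgam = 1"
  by (simp add: Lgaminv_def Lgam_def mult_single zero_prod_def[symmetric])

lemma lookup_single_mult:
  fixes p :: laurent
  shows "Poly_Mapping.lookup (Poly_Mapping.single k 1 * p) (k + m) = Poly_Mapping.lookup p m"
proof -
  have "Poly_Mapping.single k 1 * p
      = (\<Sum>w \<in> Poly_Mapping.keys p. Poly_Mapping.single (k + w) (Poly_Mapping.lookup p w))"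
    by (subst (1) poly_mapping_sum_single[of p]) (simp add: sum_distrib_left mult_single)
  then show ?thesis
    by (simp add: lookup_sum lookup_single when_def in_keys_iff)
qed

text \<open>If \<open>u^2 p = p\<close>, the finite set of exponents of \<open>p\<close> is stable
  under raising the exponent of \<open>u\<close> by 2, which contradicts the choice of a largest
  such exponent.\<close>

lemma one_minus_Lu2_cancel_0:
  assumes "(1 - Lu ^ 2) * p = 0" shows "p = 0"
proof (rule ccontr)
  assume "p \<noteq> 0"
  let ?K = "Poly_Mapping.keys p"
  have eq: "upow 2 * p = p" using assms by (simp add: algebra_simps Lu_power2)
  have step: "(2, 0, 0) + m \<in> ?K" if "m \<in> ?K" for m
    using that lookup_single_mult[of "(2, 0, 0)" p m] eq by (simp add: upow_def in_keys_iff)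
  define M where "M = Max (fst ` ?K)"
  have "fst ` ?K \<noteq> {}" using \<open>p \<noteq> 0\<close> by simp
  then have "M \<in> fst ` ?K" unfolding M_def by (intro Max_in) auto
  then obtain m where m: "m \<in> ?K" "fst m = M" by auto
  have "fst ((2, 0, 0) + m) \<le> M"
    unfolding M_def by (intro Max_ge finite_imageI finite_keys imageI step m)
  then show False using m by simp
qed

lemma one_minus_Lu2_cancel: "(1 - Lu ^ 2) ^ k * p = (1 - Lu ^ 2) ^ k * q \<Longrightarrow> p = q"
proof (induction k)
  case (Suc k)
  have "(1 - Lu ^ 2) * ((1 - Lu ^ 2) ^ k * (p - q)) = 0"
    using Suc.prems by (simp add: algebra_simps)
  then have "(1 - Lu ^ 2) ^ k * (p - q) = 0" by (rule one_minus_Lu2_cancel_0)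
  then show ?case using Suc.IH by (simp add: algebra_simps)
qed simp

section \<open>Inverses of the generators\<close>

text \<open>The quadratic relation reads \<open>(g_i - v e_i) g_i = u^2\<close>; this is the
  resulting inverse of \<open>g_i\<close>.\<close>

definition gginv :: "nat \<Rightarrow> nat \<Rightarrow> free_alg" where
  "gginv d i = scal (upow (- 2)) * (gg i - scal Lv * ee d i)"

lemma gginv_FA [simp, intro]: "1 \<le> i \<Longrightarrow> i < n \<Longrightarrow> gginv d i \<in> FA n"
  by (auto simp: gginv_def)

lemma yeq_gt_power:
  assumes "1 \<le> i" "i < n" "1 \<le> j" "j \<le> n"
  shows "yeq d n (gg i * tt j ^ s) (tt (transpose i (Suc i) j) ^ s * gg i)"
proof (induction s)
  case 0
  show ?case using assms by simp
next
  case (Suc s)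
  define j' where "j' = transpose i (Suc i) j"
  have j': "tt j' \<in> FA n" using assms by (auto simp: j'_def transpose_def)
  have "gg i * tt j ^ Suc s = gg i * tt j ^ s * tt j" by (simp add: mult.assoc power_commutes)
  also have "yeq d n \<dots> (tt j' ^ s * gg i * tt j)"
    using Suc assms by (auto simp: j'_def intro!: yeq_mult_right)
  also have "tt j' ^ s * gg i * tt j = tt j' ^ s * (gg i * tt j)" by (simp add: mult.assoc)
  also have "yeq d n \<dots> (tt j' ^ s * (tt j' * gg i))"
    using yeq_gt[OF assms] j' by (auto simp: j'_def intro!: yeq_mult_left)
  also have "tt j' ^ s * (tt j' * gg i) = tt j' ^ Suc s * gg i"
    by (simp add: mult.assoc[symmetric] power_commutes)
  finally show ?case by (simp add: j'_def)
qed

lemma yeq_tt_power: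
  assumes "1 \<le> i" "i \<le> n" "1 \<le> j" "j \<le> n"
  shows "yeq d n (tt i ^ r * tt j ^ s) (tt j ^ s * tt i ^ r)"
proof -
  have 1: "yeq d n (tt i * tt j ^ s) (tt j ^ s * tt i)" for s
  proof (induction s)
    case 0
    show ?case using assms by simp
  next
    case (Suc s)
    have "yeq d n (tt j * (tt i * tt j ^ s)) (tt j * (tt j ^ s * tt i))"
      using Suc assms by (intro yeq_mult_left) auto
    moreover have "yeq d n (tt i * tt j * tt j ^ s) (tt j * tt i * tt j ^ s)"
      using yeq_tt[OF assms] assms by (intro yeq_mult_right) auto
    ultimately show ?case using yeq_trans by (simp add: mult.assoc)
  qed
  show ?thesis
  proof (induction r)
    case 0
    show ?case using assms by simp
  next
    case (Suc r)
    have "yeq d n (tt i * (tt i ^ r * tt j ^ s)) (tt i * (tt j ^ s * tt i ^ r))"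
      using Suc assms by (intro yeq_mult_left) auto
    moreover have "yeq d n (tt i * tt j ^ s * tt i ^ r) (tt j ^ s * tt i * tt i ^ r)"
      using 1 assms by (intro yeq_mult_right) auto
    ultimately show ?case using yeq_trans by (simp add: mult.assoc)
  qed
qed

lemma mult_scal_left: "p * (scal r * q) = scal r * (p * q)"
  by (simp add: mult.assoc[symmetric] scal_commute[of r p])

text \<open>Passing \<open>g_i\<close> exchanges \<open>t_i\<close> and \<open>t_{i+1}\<close>,
  which amounts to replacing the summation index \<open>s\<close> of \<open>e_i\<close> by
  \<open>d - s\<close>.\<close>

lemma yeq_gg_ee:
  assumes d: "1 \<le> d" and i: "1 \<le> i" "i < n"
  shows "yeq d n (gg i * ee d i) (ee d i * gg i)"
proof -
  define h where "h s = tt i ^ s * tt (Suc i) ^ (d - s)" for s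
  have hF: "h s \<in> FA n" for s using i by (auto simp: h_def)
  have termwise: "yeq d n (gg i * h s) (h (d - s) * gg i)" if "s \<in> {1..d}" for s
  proof -
    have "gg i * h s = gg i * tt i ^ s * tt (Suc i) ^ (d - s)" by (simp add: h_def mult.assoc)
    also have "yeq d n \<dots> (tt (Suc i) ^ s * gg i * tt (Suc i) ^ (d - s))"
      using yeq_gt_power[of i n i d s] i by (intro yeq_mult_right) auto
    also have "tt (Suc i) ^ s * gg i * tt (Suc i) ^ (d - s) = tt (Suc i) ^ s * (gg i * tt (Suc i) ^ (d - s))"
      by (simp add: mult.assoc)
    also have "yeq d n \<dots> (tt (Suc i) ^ s * (tt i ^ (d - s) * gg i))"
      using yeq_gt_power[of i n "Suc i" d "d - s"] i by (intro yeq_mult_left) auto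
    also have "tt (Suc i) ^ s * (tt i ^ (d - s) * gg i) = tt (Suc i) ^ s * tt i ^ (d - s) * gg i"
      by (simp add: mult.assoc)
    also have "yeq d n \<dots> (tt i ^ (d - s) * tt (Suc i) ^ s * gg i)"
      using yeq_tt_power[of "Suc i" n i d s "d - s"] i by (intro yeq_mult_right) auto
    also have "tt i ^ (d - s) * tt (Suc i) ^ s * gg i = h (d - s) * gg i"
      using that by (simp add: h_def)
    finally show ?thesis .
  qed
  \<comment> \<open>Reversing the index turns the range \<open>1..d\<close> into
    \<open>0..d - 1\<close>. The exchanged end terms are \<open>t_{i+1}^d\<close> and
    \<open>t_i^d\<close>, both equal to 1.\<close>
  have h0d: "yeq d n (h 0) (h d)"
  proof -
    have "yeq d n (h 0) 1" "yeq d n (h d) 1"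
      using yeq_td[of "Suc i" n d] yeq_td[of i n d] i by (simp_all add: h_def)
    then show ?thesis using yeq_trans yeq_sym by blast
  qed
  have "(\<Sum>s = 1..d. h (d - s)) = (\<Sum>s = 0..<d. h s)"
    by (rule sum.reindex_bij_witness[of _ "\<lambda>s. d - s" "\<lambda>s. d - s"]) auto
  also have "\<dots> = h 0 + (\<Sum>s = 1..<d. h s)"
    using d by (simp add: sum.atLeast_Suc_lessThan)
  finally have eq: "(\<Sum>s = 1..d. h (d - s)) = h 0 + (\<Sum>s = 1..<d. h s)" .
  have eq': "(\<Sum>s = 1..d. h s) = h d + (\<Sum>s = 1..<d. h s)"
    using d by (simp add: atLeastLessThanSuc_atLeastAtMost[symmetric] add.commute)
  have sF: "(\<Sum>s = 1..<d. h s) \<in> FA n" using hF by (auto simp: FA_eq intro!: words_span_sum)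
  have "gg i * ee d i = scal (cst (1 / of_nat d)) * (\<Sum>s = 1..d. gg i * h s)"
    by (simp add: ee_def h_def mult_scal_left sum_distrib_left)
  also have "yeq d n \<dots> (scal (cst (1 / of_nat d)) * (\<Sum>s = 1..d. h (d - s) * gg i))"
    by (intro yeq_mult_left yeq_sum termwise) auto
  also have "(\<Sum>s = 1..d. h (d - s) * gg i) = (h 0 + (\<Sum>s = 1..<d. h s)) * gg i"
    unfolding sum_distrib_right[symmetric] eq ..
  also have "yeq d n (scal (cst (1 / of_nat d)) * ((h 0 + (\<Sum>s = 1..<d. h s)) * gg i))
      (scal (cst (1 / of_nat d)) * ((h d + (\<Sum>s = 1..<d. h s)) * gg i))"
    using i sF h0d by (intro yeq_mult_left yeq_mult_right yeq_add) auto
  also have "scal (cst (1 / of_nat d)) * ((h d + (\<Sum>s = 1..<d. h s)) * gg i) = ee d i * gg i"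
    unfolding eq'[symmetric] by (simp only: ee_def h_def[abs_def] mult.assoc)
  finally show ?thesis .
qed

lemma scal_mult_left: "scal r * (scal s * p) = scal (r * s) * p"
  by (simp add: scal_mult mult.assoc)

lemma scal_left_commute: "scal r * (scal s * p) = scal s * (scal r * p)"
  by (simp add: scal_mult_left mult.commute)

text \<open>The left inverse is the quadratic relation itself; for the right inverse
  \<open>g_i\<close> must first commute with \<open>e_i\<close>.\<close>

lemma yeq_gg_gginv:
  assumes d: "1 \<le> d" and i: "1 \<le> i" "i < n"
  shows "yeq d n (gg i * gginv d i) 1" "yeq d n (gginv d i * gg i) 1"
proof -
  have F: "gg i \<in> FA n" "ee d i \<in> FA n" using i by auto
  have "gginv d i * gg i = scal (upow (- 2)) * (gg i * gg i - scal Lv * ee d i * gg i)"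
    by (simp add: gginv_def algebra_simps)
  also have "yeq d n \<dots> (scal (upow (- 2)) * (scal (Lu ^ 2) + scal Lv * ee d i * gg i - scal Lv * ee d i * gg i))"
    using F i by (intro yeq_mult_left yeq_diff yeq_gg) auto
  also have "\<dots> = 1" by (simp add: Lu_power2 scal_mult[symmetric] upow_add scal_1)
  finally show 1: "yeq d n (gginv d i * gg i) 1" .
  have "gg i * gginv d i = (gg i * scal (upow (- 2))) * gg i - (gg i * scal (upow (- 2))) * scal Lv * ee d i"
    by (simp add: gginv_def right_diff_distrib mult.assoc)
  also have "(gg i * scal (upow (- 2))) * scal Lv = scal (upow (- 2)) * (scal Lv * gg i)"
    by (simp add: scal_commute[symmetric] scal_left_commute[of Lv])
  also have "(gg i * scal (upow (- 2))) * gg i - scal (upow (- 2)) * (scal Lv * gg i) * ee d i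
      = scal (upow (- 2)) * (gg i * gg i - scal Lv * (gg i * ee d i))"
    by (simp only: scal_commute[symmetric] mult.assoc right_diff_distrib)
  also have "yeq d n \<dots> (scal (upow (- 2)) * (gg i * gg i - scal Lv * (ee d i * gg i)))"
    using F yeq_gg_ee[OF d i] by (intro yeq_mult_left yeq_diff) auto
  also have "\<dots> = gginv d i * gg i" by (simp add: gginv_def algebra_simps)
  finally show "yeq d n (gg i * gginv d i) 1" using 1 yeq_trans by blast
qed

lemma inv_cls:
  assumes "yeq d n (p * q) 1" "yeq d n (q * p) 1" "p \<in> FA n" "q \<in> FA n"
  shows "inv\<^bsub>yh d n\<^esub> cls d n p = cls d n q" "cls d n p \<in> Units (yh d n)"
proof -
  interpret Y: ring "yh d n" by (rule ring_yh)
  have pq: "cls d n p \<otimes>\<^bsub>yh d n\<^esub> cls d n q = \<one>\<^bsub>yh d n\<^esub>" "cls d n q \<otimes>\<^bsub>yh d n\<^esub> cls d n p = \<one>\<^bsub>yh d n\<^esub>"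
    using yeq_clsD[OF assms(1)] yeq_clsD[OF assms(2)] assms by (simp_all add: cls_simps)
  then show U: "cls d n p \<in> Units (yh d n)"
    using assms by (auto simp: Units_def cls_simps)
  show "inv\<^bsub>yh d n\<^esub> cls d n p = cls d n q"
    by (rule Y.inv_char) (use pq assms cls_simps in auto)
qed

lemma inv_yg:
  assumes "1 \<le> d" "1 \<le> i" "i < n"
  shows "inv\<^bsub>yh d n\<^esub> yg d n i = cls d n (gginv d i)" "yg d n i \<in> Units (yh d n)"
  unfolding yg_def using inv_cls[OF yeq_gg_gginv[OF assms]] assms by auto

section \<open>Markov traces of Hecke algebras are multiplicative up to a factor\<close>

locale hecke_trace =
  fixes \<tau> :: "nat \<Rightarrow> free_alg set \<Rightarrow> laurent"
  assumes markov: "markov_trace 1 \<tau>" and tau_1: "\<tau> 1 \<one>\<^bsub>hecke 1\<^esub> = 1"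
begin

definition tr :: "nat \<Rightarrow> free_alg \<Rightarrow> laurent" where
  "tr n p = \<tau> n (cls 1 n p)"

lemma tr_cong: "yeq 1 n p q \<Longrightarrow> tr n p = tr n q"
  unfolding tr_def using yeq_clsD by metis

lemma tau_linear: "1 \<le> n \<Longrightarrow> linear_form 1 n (carrier (hecke n)) (\<tau> n)"
  using markov unfolding markov_trace_def by simp

lemma tr_add: "1 \<le> n \<Longrightarrow> p \<in> FA n \<Longrightarrow> q \<in> FA n \<Longrightarrow> tr n (p + q) = tr n p + tr n q"
  using tau_linear[of n] unfolding tr_def linear_form_def by (simp add: cls_simps del: One_nat_def)

lemma tr_scal: "1 \<le> n \<Longrightarrow> p \<in> FA n \<Longrightarrow> tr n (scal r * p) = r * tr n p"
  using tau_linear[of n] unfolding tr_def linear_form_def smul_def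
  by (simp add: cls_simps del: One_nat_def)

lemma tr_diff: "1 \<le> n \<Longrightarrow> p \<in> FA n \<Longrightarrow> q \<in> FA n \<Longrightarrow> tr n (p - q) = tr n p - tr n q"
  using tr_add[of n p "scal (- 1) * q"] tr_scal[of n q "- 1"] by (simp add: scal_uminus scal_1)

lemma tr_commute: "1 \<le> n \<Longrightarrow> p \<in> FA n \<Longrightarrow> q \<in> FA n \<Longrightarrow> tr n (p * q) = tr n (q * p)"
  using markov unfolding markov_trace_def tr_def by (simp add: cls_simps del: One_nat_def)

lemma tr_gg:
  assumes "1 \<le> n" "p \<in> FA n" shows "tr (Suc n) (p * gg n) = tr n p" "tr (Suc n) (p * gginv 1 n) = tr n p"
proof -
  have p: "p \<in> FA (Suc n)" using assms by (auto intro: FA_up)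
  have e: "yh_embed 1 (n + 1) 0 (cls 1 n p) = cls 1 (n + 1) p"
    using yh_embed_cls[of p n 0 "n + 1" 1] assms by simp
  have inv: "inv\<^bsub>yh 1 (n + 1)\<^esub> yg 1 (n + 1) n = cls 1 (n + 1) (gginv 1 n)"
    using assms by (intro inv_yg) auto
  have c: "cls 1 n p \<in> carrier (yh 1 n)" using assms cls_simps by blast
  have "\<tau> (n + 1) (yh_embed 1 (n + 1) 0 (cls 1 n p) \<otimes>\<^bsub>yh 1 (n + 1)\<^esub> yg 1 (n + 1) n) = \<tau> n (cls 1 n p)"
    "\<tau> (n + 1) (yh_embed 1 (n + 1) 0 (cls 1 n p) \<otimes>\<^bsub>yh 1 (n + 1)\<^esub> inv\<^bsub>yh 1 (n + 1)\<^esub> yg 1 (n + 1) n) = \<tau> n (cls 1 n p)"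
    using markov c assms unfolding markov_trace_def by (auto simp del: One_nat_def)
  then show "tr (Suc n) (p * gg n) = tr n p" "tr (Suc n) (p * gginv 1 n) = tr n p"
    unfolding e inv unfolding yg_def tr_def using p assms
    by (simp_all add: cls_simps Suc_eq_plus1 del: One_nat_def add_Suc_right)
qed

lemma tr_scalar: "tr 1 (scal r) = r"
  using tr_scal[of 1 1 r] tau_1 by (simp add: tr_def cls_simps del: One_nat_def)

lemma tr_Suc:
  assumes n: "1 \<le> n" and p: "p \<in> FA n"
  shows "Lv * tr (Suc n) p = (1 - Lu ^ 2) * tr n p"
proof -
  have pS: "p \<in> FA (Suc n)" using p by (auto intro: FA_up)
  have gF: "gg n \<in> FA (Suc n)" "gginv 1 n \<in> FA (Suc n)" using n by auto
  \<comment> \<open>The quadratic relation in skein form, with \<open>e_n\<close> written as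
    \<open>t_n\<close>. Both terms on the left have trace \<open>tr n p\<close> after multiplication
    by \<open>p\<close>, up to the factor \<open>u^2\<close>.\<close>
  have e': "gg n - scal (Lu ^ 2) * gginv 1 n = scal Lv * tt n"
    by (simp add: gginv_def scal_mult_left Lu_power2 upow_add scal_1 ee_1 del: One_nat_def)
  have e: "p * gg n - scal (Lu ^ 2) * (p * gginv 1 n) = p * (scal Lv * tt n)"
    by (simp only: e'[symmetric] right_diff_distrib mult_scal_left)
  have "tr n p - Lu ^ 2 * tr n p = tr (Suc n) (p * gg n - scal (Lu ^ 2) * (p * gginv 1 n))"
    using pS gF tr_gg[OF n p] by (simp add: tr_diff tr_scal del: One_nat_def)
  also have "\<dots> = tr (Suc n) (p * (scal Lv * 1))"
    unfolding e using n pS by (intro tr_cong yeq_mult_left yeq_tt_1) auto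
  also have "\<dots> = Lv * tr (Suc n) p"
    using pS tr_scal[of "Suc n" p Lv] by (simp add: scal_commute)
  finally show ?thesis by (simp add: algebra_simps)
qed

text \<open>Induction on the number of strands of the second factor: \<open>y\<close> is decomposed
  over \<open>H_b\<close>, a summand without \<open>g_b\<close> costs one factor
  \<open>(1 - u^2) / v\<close> on each side, and a summand with \<open>g_b\<close> loses that letter
  by the Markov condition.\<close>

lemma tr_mult_shift:
  assumes a: "1 \<le> a" and x: "x \<in> FA a" and b: "1 \<le> b" and y: "y \<in> FA b"
  shows "Lv * tr (a + b) (x * shift a y) = (1 - Lu ^ 2) * (tr a x * tr b y)"
  using b y x
proof (induction b arbitrary: x y rule: dec_induct)
  case base
  \<comment> \<open>At level 0 there are no letters: the base case consists of scalars and the coset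
    case is void. So \<open>H_1\<close> consists of scalars.\<close>
  have "double_coset 0 y" using base double_coset_all by simp
  then show ?case
  proof (induction rule: double_coset.induct)
    case (base z)
    have "z \<in> words_span {}" using base by (simp add: FA_eq gens_def)
    then obtain r where z: "z = scal r"
    proof (induction z rule: words_span_induct)
      case (add p q)
      then show ?case using scal_add[symmetric] by blast
    qed auto
    have "tr (Suc a) (x * scal r) = r * tr (Suc a) x"
      using a \<open>x \<in> FA a\<close> by (simp add: scal_commute[symmetric] tr_scal FA_up)
    then have "Lv * tr (Suc a) (x * scal r) = r * (Lv * tr (Suc a) x)" by (simp add: ac_simps)
    then show ?case using tr_Suc[OF a \<open>x \<in> FA a\<close>] tr_scalar[of r] by (simp add: z ac_simps)
  next
    case (sum p q)
    have "p \<in> FA 1" "q \<in> FA 1" using double_coset_FA sum by force+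
    then show ?case using sum a \<open>x \<in> FA a\<close>
      by (simp add: shift_add algebra_simps tr_add shift_FA FA_up[of x a "Suc a"])
  next
    case (cong p q)
    have "yeq 1 (a + 1) (x * shift a p) (x * shift a q)"
      using \<open>x \<in> FA a\<close> cong by (intro yeq_mult_left yeq_shift) (auto intro: FA_up)
    with cong show ?case by (simp add: tr_cong del: One_nat_def) (simp add: tr_cong)
  qed simp
next
  case (step b)
  have "double_coset b y" using step double_coset_all by simp
  then show ?case using step(4,5)
  proof (induction arbitrary: x rule: double_coset.induct)
    case (base z)
    have xz: "x * shift a z \<in> FA (a + b)" using base by (auto intro!: FA_intros(6) shift_FA intro: FA_up)
    have "Lv * tr (Suc (a + b)) (x * shift a z) = (1 - Lu ^ 2) * tr (a + b) (x * shift a z)"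
      using a xz by (intro tr_Suc) auto
    \<comment> \<open>\<open>tr_Suc\<close> removes the idle last strand on both sides. Its factor
      \<open>v\<close> appears once on each side, so the identity is first proved times
      \<open>v\<close> and then cancelled.\<close>
    then have "Lv * (Lv * tr (Suc (a + b)) (x * shift a z)) = (1 - Lu ^ 2) * (Lv * tr (a + b) (x * shift a z))"
      by (simp add: mult.left_commute)
    also have "\<dots> = (1 - Lu ^ 2) * ((1 - Lu ^ 2) * (tr a x * tr b z))"
      using step.IH base by simp
    also have "\<dots> = (1 - Lu ^ 2) * (tr a x * (Lv * tr (Suc b) z))"
      using tr_Suc[of b z] base step(1) by (simp add: mult.left_commute)
    finally have "Lv * (Lv * tr (Suc (a + b)) (x * shift a z)) = Lv * ((1 - Lu ^ 2) * (tr a x * tr (Suc b) z))"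
      by (simp add: algebra_simps)
    then show ?case using Lv_cancel by simp
  next
    case (coset z z')
    have F: "x \<in> FA (a + b)" "shift a z \<in> FA (a + b)" "shift a z' \<in> FA (a + b)"
      using coset by (auto intro!: FA_intros(6) shift_FA intro: FA_up)
    have F': "x \<in> FA (Suc (a + b))" "shift a z \<in> FA (Suc (a + b))" "shift a z' \<in> FA (Suc (a + b))"
      "gg (a + b) \<in> FA (Suc (a + b))"
      using F a by (auto intro: FA_up)
    \<comment> \<open>Cyclicity of the trace has to bring \<open>z'\<close> in front of
      \<open>x\<close>; as the two live on disjoint strands, this exchange can be undone once
      \<open>g_{a+b}\<close> is gone.\<close>
    have comm: "yeq 1 (a + b) (shift a z' * x) (x * shift a z')"
      using coset shift_FA_letters[of z' b a]
      by (intro yeq_sym[OF yeq_commute[where lo = 0 and hi = a and lo' = a and hi' = "a + b"]])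
        (auto simp: FA_eq gens_letters)
    have "tr (Suc (a + b)) (x * shift a (z * gg b * z')) = tr (Suc (a + b)) ((x * shift a z * gg (a + b)) * shift a z')"
      by (simp add: shift_mult mult.assoc add.commute)
    also have "\<dots> = tr (Suc (a + b)) ((shift a z' * x * shift a z) * gg (a + b))"
      using F' by (subst tr_commute) (auto simp: mult.assoc)
    also have "\<dots> = tr (a + b) (shift a z' * x * shift a z)"
      using F a by (intro tr_gg) auto
    also have "\<dots> = tr (a + b) (x * shift a z' * shift a z)"
      using F comm by (intro tr_cong yeq_mult_right)
    also have "\<dots> = tr (a + b) (x * shift a (z' * z))"
      by (simp add: shift_mult mult.assoc)
    finally have 1: "Lv * tr (Suc (a + b)) (x * shift a (z * gg b * z')) = (1 - Lu ^ 2) * (tr a x * tr b (z' * z))"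
      using step.IH[of "z' * z" x] coset by simp
    have "tr (Suc b) (z * gg b * z') = tr (Suc b) ((z' * z) * gg b)"
      using coset FA_up[of z b "Suc b"] FA_up[of z' b "Suc b"]
      by (subst tr_commute) (auto simp: mult.assoc)
    also have "\<dots> = tr b (z' * z)" using coset by (intro tr_gg) auto
    finally show ?case using 1 by simp
  next
    case (sum p q)
    have "p \<in> FA (Suc b)" "q \<in> FA (Suc b)" using double_coset_FA sum by force+
    moreover have "x \<in> FA (Suc (a + b))" using FA_up[OF sum(6)] by simp
    ultimately have "x * shift a p \<in> FA (Suc (a + b))" "x * shift a q \<in> FA (Suc (a + b))"
      by (simp_all add: shift_FA[of _ "Suc b"])
    then show ?case using sum \<open>p \<in> FA (Suc b)\<close> \<open>q \<in> FA (Suc b)\<close>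
      by (simp add: shift_add distrib_left tr_add)
  next
    case (cong p q)
    have "yeq 1 (a + Suc b) (x * shift a p) (x * shift a q)"
      using cong by (intro yeq_mult_left yeq_shift) (auto intro: FA_up)
    then have "tr (a + Suc b) (x * shift a p) = tr (a + Suc b) (x * shift a q)" by (rule tr_cong)
    moreover have "tr (Suc b) p = tr (Suc b) q" using cong tr_cong by blast
    ultimately show ?case using cong yeq_FA by metis
  qed
qed

end

text \<open>Rewriting \<open>1\<close> to \<open>Suc 0\<close> would also hit the parameter \<open>d = 1\<close> of the Hecke algebras.\<close>

declare One_nat_def [simp del] upt_Suc [simp del]

section \<open>Compositions and blocks\<close>

lemma offset_1 [simp]: "offset \<mu> (Suc 0) = 0" "offset \<mu> 1 = 0"
  by (simp_all add: offset_def One_nat_def)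

lemma offset_Suc: "1 \<le> a \<Longrightarrow> offset \<mu> (Suc a) = offset \<mu> a + \<mu> a"
  by (simp add: offset_def)

lemma offset_mono: "a \<le> b \<Longrightarrow> offset \<mu> a \<le> offset \<mu> b"
  unfolding offset_def by (intro sum_mono2) auto

lemma offset_Suc_comps: "\<mu> \<in> comps d n \<Longrightarrow> offset \<mu> (Suc d) = n"
  by (simp add: offset_def comps_def atLeastLessThanSuc_atLeastAtMost)

lemma comps_outside: "\<mu> \<in> comps d n \<Longrightarrow> a \<notin> {1..d} \<Longrightarrow> \<mu> a = 0"
  by (auto simp: comps_def)

lemma block_index: "\<mu> \<in> comps d n \<Longrightarrow> j \<in> block \<mu> a \<Longrightarrow> a \<in> {1..d}"
  using comps_outside[of \<mu> d n a] by (cases "a \<in> {1..d}") (auto simp: block_def)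

lemma block_less:
  assumes "\<mu> \<in> comps d n" "i \<in> block \<mu> a" "j \<in> block \<mu> b" "a < b"
  shows "i < j"
proof -
  have "1 \<le> a" using block_index[OF assms(1,2)] by simp
  then have "offset \<mu> a + \<mu> a \<le> offset \<mu> b"
    using offset_mono[of "Suc a" b \<mu>] assms(4) by (simp add: offset_Suc)
  then show ?thesis using assms(2,3) by (auto simp: block_def)
qed

lemma block_unique:
  assumes "\<mu> \<in> comps d n" "j \<in> block \<mu> a" "j \<in> block \<mu> b" shows "a = b"
  using block_less[OF assms(1)] assms(2,3) by (metis less_irrefl linorder_less_linear)

lemma block_end: "\<mu> \<in> comps d n \<Longrightarrow> a \<in> {1..d} \<Longrightarrow> offset \<mu> a + \<mu> a \<le> n"
  using offset_mono[of "Suc a" "Suc d" \<mu>] offset_Suc[of a \<mu>] offset_Suc_comps[of \<mu> d n] by auto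

lemma block_exists:
  assumes "\<mu> \<in> comps d n" "j \<in> {1..n}"
  obtains a where "a \<in> {1..d}" "j \<in> block \<mu> a"
proof -
  define a where "a = (LEAST a. j \<le> offset \<mu> (Suc a))"
  have ex: "j \<le> offset \<mu> (Suc d)" using assms by (simp add: offset_Suc_comps)
  then have a: "j \<le> offset \<mu> (Suc a)" unfolding a_def by (rule LeastI)
  have "a \<noteq> 0" using a assms(2) by (metis atLeastAtMost_iff not_one_le_zero offset_1(1) order_trans)
  then have "a - 1 < a" by simp
  then have "\<not> j \<le> offset \<mu> (Suc (a - 1))" unfolding a_def by (rule not_less_Least)
  then have "j \<in> block \<mu> a" using a \<open>a \<noteq> 0\<close> by (simp add: block_def offset_Suc)
  with block_index[OF assms(1)] that show ?thesis by blast
qed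

lemma block_subset: "\<mu> \<in> comps d n \<Longrightarrow> block \<mu> a \<subseteq> {1..n}"
  using block_end[of \<mu> d n a] block_index[of \<mu> d n] by (fastforce simp: block_def)

text \<open>Both sides say that \<open>i\<close> and \<open>i + 1\<close> lie in one block;
  \<open>k\<close> is the position of \<open>i\<close> inside it. Thus the generators of
  \<open>H^mu\<close> are exactly the shifted generators of the algebras
  \<open>H_{mu a}\<close>.\<close>

lemma young_transpose_iff:
  assumes \<mu>: "\<mu> \<in> comps d n" and i: "i \<in> {1..<n}"
  shows "transpose i (Suc i) \<in> young n \<mu> \<longleftrightarrow>
    (\<exists>a \<in> {1..d}. \<exists>k. 1 \<le> k \<and> k < \<mu> a \<and> i = k + offset \<mu> a)"
proof
  assume y: "transpose i (Suc i) \<in> young n \<mu>"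
  obtain a where a: "a \<in> {1..d}" "i \<in> block \<mu> a" using block_exists[OF \<mu>, of i] i by auto
  have "transpose i (Suc i) ` block \<mu> a = block \<mu> a" using y by (simp add: young_def)
  then have "Suc i \<in> block \<mu> a" using a(2) by (metis image_eqI transpose_apply_first)
  then have "1 \<le> i - offset \<mu> a \<and> i - offset \<mu> a < \<mu> a \<and> i = (i - offset \<mu> a) + offset \<mu> a"
    using a(2) by (auto simp: block_def)
  then show "\<exists>a \<in> {1..d}. \<exists>k. 1 \<le> k \<and> k < \<mu> a \<and> i = k + offset \<mu> a" using a(1) by blast
next
  assume "\<exists>a \<in> {1..d}. \<exists>k. 1 \<le> k \<and> k < \<mu> a \<and> i = k + offset \<mu> a"
  then obtain a k where a: "a \<in> {1..d}" "1 \<le> k" "k < \<mu> a" "i = k + offset \<mu> a" by blast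
  then have ia: "i \<in> block \<mu> a" "Suc i \<in> block \<mu> a" by (auto simp: block_def)
  have "transpose i (Suc i) ` block \<mu> b = block \<mu> b" for b
  proof (cases "b = a")
    case True
    then show ?thesis using ia by simp
  next
    case False
    then have "i \<notin> block \<mu> b" "Suc i \<notin> block \<mu> b" using block_unique[OF \<mu>] ia by blast+
    then have "transpose i (Suc i) j = j" if "j \<in> block \<mu> b" for j
      using that by (metis transpose_apply_other)
    then show ?thesis by simp
  qed
  then show "transpose i (Suc i) \<in> young n \<mu>"
    using i by (auto simp: young_def intro!: permutes_swap_id)
qed

section \<open>The tensor product of the traces\<close>

locale hecke_trace_comp = hecke_trace +
  fixes d n :: nat and \<mu> :: "nat \<Rightarrow> nat" and S :: "nat set"
  assumes mu: "\<mu> \<in> comps d n" and n: "1 \<le> n" and S: "S = {a \<in> {1..d}. \<mu> a \<noteq> 0}"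
begin

abbreviation "HC \<equiv> hecke_comp n \<mu>"

lemma S_nonempty: "S \<noteq> {}"
proof
  assume "S = {}"
  then have "(\<Sum>a = 1..d. \<mu> a) = 0" using S by auto
  then show False using mu n by (simp add: comps_def)
qed

lemma finite_S: "finite S"
  by (simp add: S)

text \<open>The value 1 off the support lets products run over the consecutive blocks
  \<open>1..d\<close>, although \<open>block_prod\<close> runs over \<open>S\<close>.\<close>

definition family :: "(nat \<Rightarrow> free_alg) \<Rightarrow> bool" where
  "family p \<longleftrightarrow> (\<forall>a. p a \<in> FA (\<mu> a) \<and> (a \<notin> S \<longrightarrow> p a = 1))"

definition factors :: "(nat \<Rightarrow> free_alg) \<Rightarrow> nat list \<Rightarrow> free_alg" where
  "factors p as = prod_list (map (\<lambda>a. shift (offset \<mu> a) (p a)) as)"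

lemma factors_simps [simp]:
  "factors p [] = 1" "factors p (a # as) = shift (offset \<mu> a) (p a) * factors p as"
  "factors p (as @ bs) = factors p as * factors p bs"
  by (simp_all add: factors_def)

lemma factors_span:
  assumes "family p" "1 \<le> lo" "hi \<le> Suc d"
  shows "factors p [lo..<hi] \<in> words_span (letters (offset \<mu> lo) (offset \<mu> hi))"
  unfolding factors_def
proof (rule words_span_prod_list)
  fix q assume "q \<in> set (map (\<lambda>a. shift (offset \<mu> a) (p a)) [lo..<hi])"
  then obtain a where a: "lo \<le> a" "a < hi" "q = shift (offset \<mu> a) (p a)" by auto
  have "q \<in> words_span (letters (offset \<mu> a) (offset \<mu> a + \<mu> a))"
    using assms(1) a by (auto simp: family_def intro: shift_FA_letters)
  also have "\<dots> \<subseteq> words_span (letters (offset \<mu> lo) (offset \<mu> hi))"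
    using a assms offset_Suc[of a \<mu>] offset_mono[of "Suc a" hi \<mu>]
    by (intro words_span_mono letters_mono offset_mono) auto
  finally show "q \<in> words_span (letters (offset \<mu> lo) (offset \<mu> hi))" .
qed

lemma offset_le: "a \<le> Suc d \<Longrightarrow> offset \<mu> a \<le> n"
  using offset_mono[of a "Suc d" \<mu>] offset_Suc_comps[OF mu] by simp

lemma factors_FA: "family p \<Longrightarrow> 1 \<le> lo \<Longrightarrow> hi \<le> Suc d \<Longrightarrow> factors p [lo..<hi] \<in> FA n"
  using factors_span letters_span_FA offset_le by blast

lemma factors_cong: "(\<And>a. a \<in> set as \<Longrightarrow> p a = q a) \<Longrightarrow> factors p as = factors q as"
  by (induction as) auto

abbreviation "bp p \<equiv> factors p [1..<Suc d]"

lemma upt_split: "a \<in> {1..d} \<Longrightarrow> [1..<Suc d] = [1..<a] @ a # [Suc a..<Suc d]"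
  using upt_add_eq_append[of 1 a "Suc d - a"] upt_conv_Cons[of a "Suc d"] by auto

text \<open>A right factor from block \<open>a\<close> commutes past all later blocks and is
  absorbed into the component of block \<open>a\<close>.\<close>

lemma bp_update:
  assumes p: "family p" and a: "a \<in> S" and z: "z \<in> FA (\<mu> a)"
  shows "family (p(a := p a * z))" "yeq 1 n (bp p * shift (offset \<mu> a) z) (bp (p(a := p a * z)))"
proof -
  let ?p' = "p(a := p a * z)"
  have a': "a \<in> {1..d}" using a S by simp
  show p': "family ?p'" using p a z by (auto simp: family_def)
  let ?A = "factors p [1..<a]" and ?B = "factors p [Suc a..<Suc d]"
  have A: "factors ?p' [1..<a] = ?A" and B: "factors ?p' [Suc a..<Suc d] = ?B"
    by (intro factors_cong; simp)+
  have zs: "shift (offset \<mu> a) z \<in> words_span (letters (offset \<mu> a) (offset \<mu> (Suc a)))"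
    using shift_FA_letters[OF z, of "offset \<mu> a"] a' by (simp add: offset_Suc)
  have F: "?A \<in> FA n" "?B \<in> FA n" "shift (offset \<mu> a) (p a) \<in> FA n"
    using factors_FA[OF p] a' block_end[OF mu a'] p by (auto intro!: shift_FA simp: family_def)
  have "yeq 1 n (shift (offset \<mu> a) z * ?B) (?B * shift (offset \<mu> a) z)"
    using zs a' factors_span[OF p, of "Suc a" "Suc d"] offset_le[of "Suc a"] offset_le[of "Suc d"]
    by (intro yeq_commute[where lo = "offset \<mu> a" and hi = "offset \<mu> (Suc a)"
          and lo' = "offset \<mu> (Suc a)" and hi' = "offset \<mu> (Suc d)"]) auto
  then have "yeq 1 n (?A * shift (offset \<mu> a) (p a) * (shift (offset \<mu> a) z * ?B))
      (?A * shift (offset \<mu> a) (p a) * (?B * shift (offset \<mu> a) z))"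
    using F by (intro yeq_mult_left) auto
  then show "yeq 1 n (bp p * shift (offset \<mu> a) z) (bp ?p')"
    unfolding upt_split[OF a'] factors_simps A B
    by (intro yeq_sym[of 1 n _ "_ * shift _ z"]) (simp add: shift_mult mult.assoc)
qed

text \<open>Representatives of the span of the pure tensors. Closure under sums is enough for a span
  over the ground ring, since a scalar can be moved into the factor of any block of the non-empty
  set \<open>S\<close>.\<close>

inductive bspan :: "free_alg \<Rightarrow> bool" where
  base: "family p \<Longrightarrow> bspan (bp p)"
| sum: "bspan p \<Longrightarrow> bspan q \<Longrightarrow> bspan (p + q)"
| congr: "bspan p \<Longrightarrow> yeq 1 n p q \<Longrightarrow> bspan q"

lemma bspan_FA: "bspan p \<Longrightarrow> p \<in> FA n"
  by (induction rule: bspan.induct) (use factors_FA[of _ 1 "Suc d"] in \<open>auto simp: yeq_FA\<close>)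

lemma bspan_mult:
  assumes "bspan q" "a \<in> S" "z \<in> FA (\<mu> a)"
  shows "bspan (q * shift (offset \<mu> a) z)"
  using assms(1)
proof (induction rule: bspan.induct)
  case (base p)
  show ?case using bspan.congr[OF bspan.base yeq_sym] bp_update[OF base assms(2,3)] by blast
next
  case (sum p q)
  then show ?case by (simp add: algebra_simps bspan.sum)
next
  case (congr p q)
  have "shift (offset \<mu> a) z \<in> FA n"
    using assms S block_end[OF mu] by (auto intro!: shift_FA)
  then show ?case by (rule bspan.congr[OF congr(3) yeq_mult_right[OF congr(2)]])
qed

lemma bspan_scal: "bspan q \<Longrightarrow> bspan (q * scal r)"
  using bspan_mult[of q _ "scal r"] S_nonempty by auto

lemma bspan_1: "bspan 1"
proof -
  have "family (\<lambda>a. 1)" by (simp add: family_def)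
  then have "bspan (bp (\<lambda>a. 1))" by (rule bspan.base)
  moreover have "factors (\<lambda>a. 1) as = 1" for as by (induction as) auto
  ultimately show ?thesis by metis
qed

section \<open>\<open>H^mu\<close> consists of the sums of block products\<close>

lemma HC_gens_carrier:
  "range (\<lambda>r. cls 1 n (scal r)) \<union> {yg 1 n i | i. i \<in> {1..<n} \<and> transpose i (Suc i) \<in> young n \<mu>}
    \<subseteq> carrier (hecke n)"
  by (auto simp: yg_def intro!: cls_simps(1))

lemma HC_carrier: "y \<in> HC \<Longrightarrow> y \<in> carrier (hecke n)"
  using ring.generate_ring_incl[OF ring_yh HC_gens_carrier] unfolding hecke_comp_def by blast

lemma HC_closed:
  "x \<in> HC \<Longrightarrow> y \<in> HC \<Longrightarrow> x \<oplus>\<^bsub>hecke n\<^esub> y \<in> HC"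
  "x \<in> HC \<Longrightarrow> y \<in> HC \<Longrightarrow> x \<otimes>\<^bsub>hecke n\<^esub> y \<in> HC"
  "cls 1 n (scal r) \<in> HC"
  unfolding hecke_comp_def by (auto intro: generate_ring.intros)

lemma HC_bspan:
  assumes "y \<in> HC" obtains q where "bspan q" "cls 1 n q = y"
proof -
  interpret H: ring "hecke n" by (rule ring_yh)
  \<comment> \<open>A claim about \<open>y\<close> alone would not pass through products. The
    induction therefore shows that right multiplication by \<open>y\<close> preserves sums of block
    products; the lemma is the case \<open>q = 1\<close>.\<close>
  have "y \<in> carrier (hecke n) \<and> (\<forall>q. bspan q \<longrightarrow> (\<exists>q'. bspan q' \<and> cls 1 n q' = cls 1 n q \<otimes>\<^bsub>hecke n\<^esub> y))"
    using assms unfolding hecke_comp_def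
  proof (induction rule: generate_ring.induct)
    case one
    show ?case using bspan_FA cls_simps(1) by (metis H.one_closed H.r_one)
  next
    case (incl h)
    then consider r where "h = cls 1 n (scal r)"
      | i where "h = yg 1 n i" "i \<in> {1..<n}" "transpose i (Suc i) \<in> young n \<mu>" by blast
    then show ?case
    proof cases
      case 1
      have "bspan (q * scal r) \<and> cls 1 n (q * scal r) = cls 1 n q \<otimes>\<^bsub>hecke n\<^esub> h" if "bspan q" for q
        using that 1 bspan_scal bspan_FA cls_simps(2)[of q n "scal r" 1] by simp
      moreover have "h \<in> carrier (hecke n)" using 1 cls_simps(1) by simp
      ultimately show ?thesis by blast
    next
      case 2
      then obtain a k where a: "a \<in> {1..d}" "1 \<le> k" "k < \<mu> a" "i = k + offset \<mu> a"
        using young_transpose_iff[OF mu] by blast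
      have g: "gg i = shift (offset \<mu> a) (gg k)" using a by simp
      have "bspan (q * gg i)" if "bspan q" for q
        unfolding g by (rule bspan_mult[OF that]) (use a S in auto)
      moreover have "cls 1 n (q * gg i) = cls 1 n q \<otimes>\<^bsub>hecke n\<^esub> h" if "bspan q" for q
        using that 2 bspan_FA cls_simps(2)[of q n "gg i" 1] by (simp add: yg_def)
      moreover have "h \<in> carrier (hecke n)" using 2 by (auto simp: yg_def intro!: cls_simps(1))
      ultimately show ?thesis by blast
    qed
  next
    case (a_inv h)
    have "\<exists>q'. bspan q' \<and> cls 1 n q' = cls 1 n q \<otimes>\<^bsub>hecke n\<^esub> (\<ominus>\<^bsub>hecke n\<^esub> h)" if q: "bspan q" for q
    proof -
      obtain q' where q': "bspan q'" "cls 1 n q' = cls 1 n q \<otimes>\<^bsub>hecke n\<^esub> h" using a_inv q by blast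
      have "cls 1 n (q' * scal (- 1)) = \<ominus>\<^bsub>hecke n\<^esub> (cls 1 n q')"
        using cls_uminus[OF bspan_FA[OF q'(1)], of 1] by (simp add: scal_uminus scal_1)
      also have "\<dots> = cls 1 n q \<otimes>\<^bsub>hecke n\<^esub> (\<ominus>\<^bsub>hecke n\<^esub> h)"
        using a_inv bspan_FA[OF q] cls_simps(1)[of q n 1] q' by (simp add: H.r_minus)
      finally show ?thesis using bspan_scal[OF q'(1)] by blast
    qed
    then show ?case using a_inv by simp
  next
    case (eng_add h1 h2)
    have "\<exists>q'. bspan q' \<and> cls 1 n q' = cls 1 n q \<otimes>\<^bsub>hecke n\<^esub> (h1 \<oplus>\<^bsub>hecke n\<^esub> h2)" if q: "bspan q" for q
    proof -
      obtain q1 q2 where q12: "bspan q1" "cls 1 n q1 = cls 1 n q \<otimes>\<^bsub>hecke n\<^esub> h1"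
          "bspan q2" "cls 1 n q2 = cls 1 n q \<otimes>\<^bsub>hecke n\<^esub> h2"
        using eng_add q by blast
      have "cls 1 n (q1 + q2) = cls 1 n q \<otimes>\<^bsub>hecke n\<^esub> (h1 \<oplus>\<^bsub>hecke n\<^esub> h2)"
        using eng_add q12 bspan_FA q cls_simps(1)[of q n 1] by (simp add: cls_simps(3) H.r_distr)
      then show ?thesis using bspan.sum q12 by blast
    qed
    then show ?case using eng_add by simp
  next
    case (eng_mult h1 h2)
    have "\<exists>q'. bspan q' \<and> cls 1 n q' = cls 1 n q \<otimes>\<^bsub>hecke n\<^esub> (h1 \<otimes>\<^bsub>hecke n\<^esub> h2)" if q: "bspan q" for q
    proof -
      obtain q1 where q1: "bspan q1" "cls 1 n q1 = cls 1 n q \<otimes>\<^bsub>hecke n\<^esub> h1"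
        using eng_mult q by blast
      then obtain q2 where q2: "bspan q2" "cls 1 n q2 = cls 1 n q1 \<otimes>\<^bsub>hecke n\<^esub> h2"
        using eng_mult by blast
      have "cls 1 n q2 = cls 1 n q \<otimes>\<^bsub>hecke n\<^esub> (h1 \<otimes>\<^bsub>hecke n\<^esub> h2)"
        using eng_mult q1 q2 bspan_FA[OF q] cls_simps(1)[of q n 1] by (simp add: H.m_assoc)
      then show ?thesis using q2 by blast
    qed
    then show ?case using eng_mult by simp
  qed
  then show ?thesis using that bspan_1 cls_simps(4)[of 1 n] by (metis H.l_one)
qed

lemma shift_in_HC:
  assumes "a \<in> {1..d}" "p \<in> FA (\<mu> a)"
  shows "cls 1 n (shift (offset \<mu> a) p) \<in> HC"
proof -
  have "p \<in> words_span (gens (\<mu> a))" using assms by (simp add: FA_eq)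
  then show ?thesis
  proof (induction p rule: words_span_induct)
    case (scal r)
    show ?case using HC_closed(3) by simp
  next
    case (gen p x)
    have F: "shift (offset \<mu> a) p \<in> FA n" "shift (offset \<mu> a) (gen_elt x) \<in> FA n"
      using gen by (intro shift_FA[OF _ block_end[OF mu assms(1)]]; simp add: FA_eq words_span_gen)+
    have "cls 1 n (shift (offset \<mu> a) (gen_elt x)) \<in> HC"
    proof (cases x)
      case (GenG i)
      then have i: "1 \<le> i" "i < \<mu> a" "i + offset \<mu> a \<in> {1..<n}"
        using gen block_end[OF mu assms(1)] by auto
      then have "transpose (i + offset \<mu> a) (Suc (i + offset \<mu> a)) \<in> young n \<mu>"
        using young_transpose_iff[OF mu i(3)] assms(1) by blast
      then have "yg 1 n (i + offset \<mu> a) \<in> HC"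
        using i unfolding hecke_comp_def by (intro generate_ring.incl) blast
      then show ?thesis using GenG by (simp add: yg_def gg_gen_elt[symmetric])
    next
      case (GenT i)
      then have i: "1 \<le> i + offset \<mu> a" "i + offset \<mu> a \<le> n"
        using gen block_end[OF mu assms(1)] by auto
      \<comment> \<open>\<open>hecke_comp\<close> has only scalars and letters \<open>g\<close>
        among its generators; the letters \<open>t\<close> enter as the scalar 1.\<close>
      have "cls 1 n (tt (i + offset \<mu> a)) = cls 1 n (scal 1)"
        using yeq_clsD[OF yeq_tt_1[OF i]] by (simp add: scal_1)
      then show ?thesis using GenT HC_closed(3) by (simp add: tt_gen_elt[symmetric])
    qed
    then show ?case using gen F HC_closed(2) cls_simps(2)[OF F, of 1] by (simp add: shift_mult)
  next
    case (add p q)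
    have F: "shift (offset \<mu> a) p \<in> FA n" "shift (offset \<mu> a) q \<in> FA n"
      using add by (intro shift_FA[OF _ block_end[OF mu assms(1)]]; simp add: FA_eq)+
    show ?case using add HC_closed(1) cls_simps(3)[OF F, of 1] by (simp add: shift_add)
  qed
qed

lemma bspan_HC: "bspan q \<Longrightarrow> cls 1 n q \<in> HC"
proof (induction rule: bspan.induct)
  case (base p)
  have "cls 1 n (factors p as) \<in> HC \<and> factors p as \<in> FA n" if "set as \<subseteq> {1..d}" for as
    using that
  proof (induction as)
    case Nil
    show ?case using HC_closed(3)[of 1] by (simp add: scal_1)
  next
    case (Cons a as)
    have "shift (offset \<mu> a) (p a) \<in> FA n"
      using Cons base block_end[OF mu] by (auto intro!: shift_FA simp: family_def)
    then show ?case
      using Cons base shift_in_HC HC_closed(2) cls_simps(2)[of _ n "factors p as" 1]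
      by (simp add: family_def)
  qed
  from this[of "[1..<Suc d]"] show ?case by simp (simp add: atLeastLessThanSuc_atLeastAtMost)
next
  case (sum p q)
  then show ?case using HC_closed(1) by (simp add: bspan_FA cls_simps(3))
next
  case (congr p q)
  then show ?case using yeq_clsD by metis
qed

lemma block_prod_bp:
  assumes "family p"
  shows "block_prod n \<mu> S (\<lambda>a. cls 1 (\<mu> a) (p a)) = cls 1 n (bp p)"
proof -
  have sorted: "sorted_list_of_set S = filter (\<lambda>a. a \<in> S) [1..<Suc d]"
    by (rule sorted_distinct_set_unique)
      (auto simp: S finite_S sorted_wrt_filter[OF sorted_upt])
  have "foldr (\<lambda>a y. yh_embed 1 n (offset \<mu> a) (cls 1 (\<mu> a) (p a)) \<otimes>\<^bsub>hecke n\<^esub> y)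
      (filter (\<lambda>a. a \<in> S) as) \<one>\<^bsub>hecke n\<^esub> = cls 1 n (factors p as) \<and> factors p as \<in> FA n"
    if "set as \<subseteq> {1..d}" for as
    using that
  proof (induction as)
    case Nil
    show ?case by (simp add: cls_simps)
  next
    case (Cons a as)
    have e: "offset \<mu> a + \<mu> a \<le> n" using Cons.prems block_end[OF mu] by simp
    have pa: "p a \<in> FA (\<mu> a)" "a \<notin> S \<Longrightarrow> p a = 1" using assms by (auto simp: family_def)
    have F: "shift (offset \<mu> a) (p a) \<in> FA n" using shift_FA[OF pa(1) e] .
    show ?case
      using Cons F pa(2) yh_embed_cls[OF pa(1) e, of 1] cls_simps(2)[OF F, of "factors p as" 1] by auto
  qed
  from this[of "[1..<Suc d]"] show ?thesis
    unfolding block_prod_def sorted by simp (simp add: atLeastLessThanSuc_atLeastAtMost)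
qed

lemma block_prod_cong: "(\<And>a. a \<in> S \<Longrightarrow> x a = y a) \<Longrightarrow> block_prod n \<mu> S x = block_prod n \<mu> S y"
  unfolding block_prod_def by (intro foldr_cong) (auto simp: finite_S)

lemma Pi_family:
  assumes "x \<in> (\<Pi> a \<in> S. carrier (hecke (\<mu> a)))"
  obtains p where "family p" "\<And>a. a \<in> S \<Longrightarrow> x a = cls 1 (\<mu> a) (p a)"
proof -
  have "\<forall>a. \<exists>q. q \<in> FA (\<mu> a) \<and> (a \<in> S \<longrightarrow> x a = cls 1 (\<mu> a) q) \<and> (a \<notin> S \<longrightarrow> q = 1)"
  proof
    fix a
    show "\<exists>q. q \<in> FA (\<mu> a) \<and> (a \<in> S \<longrightarrow> x a = cls 1 (\<mu> a) q) \<and> (a \<notin> S \<longrightarrow> q = 1)"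
    proof (cases "a \<in> S")
      case True
      then have "x a \<in> cls 1 (\<mu> a) ` FA (\<mu> a)" using assms yh_carrier by blast
      with True show ?thesis by auto
    qed (auto intro: exI[of _ 1])
  qed
  then obtain p where "\<forall>a. p a \<in> FA (\<mu> a) \<and> (a \<in> S \<longrightarrow> x a = cls 1 (\<mu> a) (p a)) \<and> (a \<notin> S \<longrightarrow> p a = 1)"
    by metis
  then show ?thesis by (intro that[of p]) (auto simp: family_def)
qed

text \<open>Blocks are added one at a time. Each non-empty block after the first contributes one
  factor \<open>(1 - u^2) / v\<close> by \<open>tr_mult_shift\<close>, and empty blocks contribute
  nothing; hence the exponent is one less than the number of non-empty blocks.\<close>

lemma tr_factors:
  assumes p: "family p" and M: "M \<le> d" "S \<inter> {1..M} \<noteq> {}"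
  shows "Lv ^ (card (S \<inter> {1..M}) - 1) * tr (offset \<mu> (Suc M)) (factors p [1..<Suc M])
    = (1 - Lu ^ 2) ^ (card (S \<inter> {1..M}) - 1) * (\<Prod>a \<in> S \<inter> {1..M}. tr (\<mu> a) (p a))"
  using M
proof (induction M)
  case (Suc M)
  let ?R = "S \<inter> {1..M}"
  have F: "factors p [1..<Suc M] \<in> FA (offset \<mu> (Suc M))"
    using factors_span[OF p, of 1 "Suc M"] Suc.prems by (simp add: FA_eq gens_letters)
  have snoc: "factors p [1..<Suc (Suc M)] = factors p [1..<Suc M] * shift (offset \<mu> (Suc M)) (p (Suc M))"
    by (simp add: upt_Suc[of 1 "Suc M"])
  have pa: "p (Suc M) \<in> FA (\<mu> (Suc M))" using p by (simp add: family_def)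
  show ?case
  proof (cases "Suc M \<in> S")
    case False
    then have "\<mu> (Suc M) = 0" using S Suc.prems by auto
    moreover have "p (Suc M) = 1" using False p by (simp add: family_def)
    moreover have "S \<inter> {1..Suc M} = ?R" using False by (auto simp: le_Suc_eq)
    ultimately show ?thesis using Suc by (simp add: offset_Suc snoc)
  next
    case True
    then have R: "S \<inter> {1..Suc M} = insert (Suc M) ?R" "Suc M \<notin> ?R" by (auto simp: le_Suc_eq)
    have mu1: "1 \<le> \<mu> (Suc M)" using True S by auto
    show ?thesis
    \<comment> \<open>The first non-empty block has offset 0 and only trivial factors before it, so
      no multiplication formula is applied there.\<close>
    proof (cases "?R = {}")
      case True
      have "offset \<mu> (Suc M) = 0"
        unfolding offset_def
      proof (intro sum.neutral ballI)
        fix b assume "b \<in> {1..<Suc M}"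
        then have "b \<in> {1..M}" "b \<in> {1..d}" using Suc.prems by auto
        then show "\<mu> b = 0" using True unfolding S by blast
      qed
      moreover have "factors p [1..<Suc M] = 1"
      proof -
        have "p a = 1" if "a \<in> {1..M}" for a using True p that by (auto simp: family_def)
        then have "factors p as = 1" if "set as \<subseteq> {1..M}" for as using that by (induction as) auto
        then show ?thesis by (simp add: atLeastLessThanSuc_atLeastAtMost)
      qed
      ultimately show ?thesis using True R by (simp add: offset_Suc snoc)
    next
      case False
      then have card: "card (S \<inter> {1..Suc M}) - 1 = Suc (card ?R - 1)"
        using R card_gt_0_iff[of ?R] by simp
      obtain b where b: "b \<in> ?R" using False by blast
      have "1 \<le> offset \<mu> (Suc M)"
      proof -
        have "1 \<le> \<mu> b" using b S by auto
        also have "\<mu> b \<le> offset \<mu> (Suc M)"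
          unfolding offset_def using b by (intro member_le_sum) auto
        finally show ?thesis .
      qed
      then have step: "Lv * tr (offset \<mu> (Suc M) + \<mu> (Suc M)) (factors p [1..<Suc M] * shift (offset \<mu> (Suc M)) (p (Suc M)))
          = (1 - Lu ^ 2) * (tr (offset \<mu> (Suc M)) (factors p [1..<Suc M]) * tr (\<mu> (Suc M)) (p (Suc M)))"
        using F mu1 pa by (rule tr_mult_shift)
      have IH: "Lv ^ (card ?R - 1) * tr (offset \<mu> (Suc M)) (factors p [1..<Suc M])
          = (1 - Lu ^ 2) ^ (card ?R - 1) * (\<Prod>a \<in> ?R. tr (\<mu> a) (p a))"
        using Suc.IH Suc.prems False by simp
      have "Lv ^ (card ?R - 1) * (Lv * tr (offset \<mu> (Suc M) + \<mu> (Suc M)) (factors p [1..<Suc M] * shift (offset \<mu> (Suc M)) (p (Suc M))))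
         = (1 - Lu ^ 2) * tr (\<mu> (Suc M)) (p (Suc M))
           * (Lv ^ (card ?R - 1) * tr (offset \<mu> (Suc M)) (factors p [1..<Suc M]))"
        unfolding step by (simp only: ac_simps)
      also have "\<dots> = (1 - Lu ^ 2) ^ (card ?R - 1) * (1 - Lu ^ 2) * (tr (\<mu> (Suc M)) (p (Suc M)) * (\<Prod>a \<in> ?R. tr (\<mu> a) (p a)))"
        unfolding IH by (simp only: ac_simps)
      finally have "Lv ^ (card ?R - 1) * (Lv * tr (offset \<mu> (Suc M) + \<mu> (Suc M)) (factors p [1..<Suc M] * shift (offset \<mu> (Suc M)) (p (Suc M))))
         = (1 - Lu ^ 2) ^ (card ?R - 1) * (1 - Lu ^ 2) * (tr (\<mu> (Suc M)) (p (Suc M)) * (\<Prod>a \<in> ?R. tr (\<mu> a) (p a)))" .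
      then show ?thesis unfolding card using R finite_S by (simp add: offset_Suc snoc ac_simps)
    qed
  qed
qed simp

text \<open>On block products the quotient of \<open>\<tau>\<^sub>n\<close> exists by \<open>tr_factors\<close>; additivity extends this to all of
  \<open>H\<^sup>\<mu>\<close>, which gives a well-defined form without knowing that \<open>H\<^sup>\<mu>\<close> is a tensor product.\<close>

definition quot_tr :: "free_alg set \<Rightarrow> laurent \<Rightarrow> bool" where
  "quot_tr y r \<longleftrightarrow> (1 - Lu ^ 2) ^ (card S - 1) * r = Lv ^ (card S - 1) * \<tau> n y"

lemma quot_tr_unique: "quot_tr y r \<Longrightarrow> quot_tr y s \<Longrightarrow> r = s"
  unfolding quot_tr_def by (rule one_minus_Lu2_cancel[of "card S - 1"]) simp

lemma quot_tr_bp: "family p \<Longrightarrow> quot_tr (cls 1 n (bp p)) (\<Prod>a \<in> S. tr (\<mu> a) (p a))"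
proof -
  assume p: "family p"
  have "S \<inter> {1..d} = S" using S by auto
  then show ?thesis
    using tr_factors[OF p, of d] S_nonempty offset_Suc_comps[OF mu] by (simp add: quot_tr_def tr_def)
qed

lemma quot_tr_add:
  "x \<in> HC \<Longrightarrow> y \<in> HC \<Longrightarrow> quot_tr x r \<Longrightarrow> quot_tr y s \<Longrightarrow> quot_tr (x \<oplus>\<^bsub>hecke n\<^esub> y) (r + s)"
  using tau_linear[OF n] HC_carrier unfolding quot_tr_def linear_form_def by (simp add: algebra_simps)

lemma quot_tr_smul: "x \<in> HC \<Longrightarrow> quot_tr x r \<Longrightarrow> quot_tr (smul 1 n s x) (s * r)"
proof -
  assume x: "x \<in> HC" and r: "quot_tr x r"
  have "\<tau> n (smul 1 n s x) = s * \<tau> n x"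
    using tau_linear[OF n] HC_carrier[OF x] unfolding linear_form_def by blast
  then show ?thesis using r unfolding quot_tr_def by (simp add: mult.left_commute)
qed

lemma quot_tr_exists: "y \<in> HC \<Longrightarrow> \<exists>!r. quot_tr y r"
proof -
  assume "y \<in> HC"
  then obtain q where q: "bspan q" "cls 1 n q = y" by (rule HC_bspan)
  from q(1) have "\<exists>r. quot_tr (cls 1 n q) r"
  proof (induction rule: bspan.induct)
    case (base p)
    then show ?case using quot_tr_bp by blast
  next
    case (sum p q)
    then show ?case using quot_tr_add bspan_HC by (metis bspan_FA cls_simps(3))
  next
    case (congr p q)
    then show ?case using yeq_clsD by metis
  qed
  then show ?thesis using q quot_tr_unique by blast
qed

text \<open>\<open>tau_tensor\<close> is a definite description. The quotient of
  \<open>\<tau> n\<close> provides a form with the required properties, and any other one agrees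
  with it on block products and hence on all of \<open>H^mu\<close>.\<close>

lemma tau_tensor_quot:
  assumes "y \<in> HC" shows "quot_tr y (tau_tensor \<tau> n \<mu> S y)"
proof -
  define f where "f = (\<lambda>y \<in> HC. THE r. quot_tr y r)"
  have f: "quot_tr y (f y)" if "y \<in> HC" for y
    using theI'[OF quot_tr_exists[OF that]] that by (simp add: f_def)
  have smul_HC: "smul 1 n r x \<in> HC" if "x \<in> HC" for r x
    using that HC_closed by (simp add: smul_def)
  let ?P = "\<lambda>f. f \<in> extensional HC \<and> linear_form 1 n HC f \<and>
     (\<forall>x \<in> (\<Pi> a \<in> S. carrier (hecke (\<mu> a))). f (block_prod n \<mu> S x) = (\<Prod>a \<in> S. \<tau> (\<mu> a) (x a)))"
  have bprod: "\<exists>p. family p \<and> block_prod n \<mu> S x = cls 1 n (bp p) \<and> (\<Prod>a \<in> S. \<tau> (\<mu> a) (x a)) = (\<Prod>a \<in> S. tr (\<mu> a) (p a))"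
    if x: "x \<in> (\<Pi> a \<in> S. carrier (hecke (\<mu> a)))" for x
  proof -
    obtain p where p: "family p" "\<And>a. a \<in> S \<Longrightarrow> x a = cls 1 (\<mu> a) (p a)"
      using Pi_family[OF x] by blast
    then show ?thesis using block_prod_bp[OF p(1)] block_prod_cong[of x "\<lambda>a. cls 1 (\<mu> a) (p a)"]
      by (auto simp: tr_def)
  qed
  have Pf: "?P f"
  proof (intro conjI ballI)
    show "f \<in> extensional HC" by (simp add: f_def)
    show "linear_form 1 n HC f"
      unfolding linear_form_def
    proof (intro conjI ballI allI)
      fix x y r assume x: "x \<in> HC"
      show "f (smul 1 n r x) = r * f x"
        using quot_tr_unique[OF f[OF smul_HC[OF x]] quot_tr_smul[OF x f[OF x]]] .
      assume y: "y \<in> HC"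
      show "f (x \<oplus>\<^bsub>hecke n\<^esub> y) = f x + f y"
        using quot_tr_unique[OF f[OF HC_closed(1)[OF x y]] quot_tr_add[OF x y f[OF x] f[OF y]]] .
    qed
    show "f (block_prod n \<mu> S x) = (\<Prod>a \<in> S. \<tau> (\<mu> a) (x a))"
      if x: "x \<in> (\<Pi> a \<in> S. carrier (hecke (\<mu> a)))" for x
    proof -
      obtain p where p: "family p" "block_prod n \<mu> S x = cls 1 n (bp p)"
          "(\<Prod>a \<in> S. \<tau> (\<mu> a) (x a)) = (\<Prod>a \<in> S. tr (\<mu> a) (p a))"
        using bprod[OF x] by blast
      show ?thesis
        unfolding p(2,3) by (rule quot_tr_unique[OF f[OF bspan_HC[OF bspan.base[OF p(1)]]] quot_tr_bp[OF p(1)]])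
    qed
  qed
  \<comment> \<open>Uniqueness: additivity carries the prescribed values on block products to their
    sums, and extensionality settles the rest.\<close>
  have "g = f" if g: "?P g" for g
  proof (rule extensionalityI[of _ HC])
    show "g \<in> extensional HC" "f \<in> extensional HC" using g Pf by auto
    fix y assume "y \<in> HC"
    then obtain q where q: "bspan q" "cls 1 n q = y" by (rule HC_bspan)
    from q(1) have "g (cls 1 n q) = f (cls 1 n q)"
    proof (induction rule: bspan.induct)
      case (base p)
      have x: "(\<lambda>a. cls 1 (\<mu> a) (p a)) \<in> (\<Pi> a \<in> S. carrier (hecke (\<mu> a)))"
        using base by (auto simp: family_def intro!: cls_simps(1))
      show ?case
        using bspec[OF conjunct2[OF conjunct2[OF g]] x] bspec[OF conjunct2[OF conjunct2[OF Pf]] x]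
        unfolding block_prod_bp[OF base] by simp
    next
      case (sum p q)
      have "g (cls 1 n p \<oplus>\<^bsub>hecke n\<^esub> cls 1 n q) = g (cls 1 n p) + g (cls 1 n q)"
        "f (cls 1 n p \<oplus>\<^bsub>hecke n\<^esub> cls 1 n q) = f (cls 1 n p) + f (cls 1 n q)"
        using g Pf bspan_HC sum unfolding linear_form_def by blast+
      then show ?case using sum by (simp add: cls_simps(3) bspan_FA)
    next
      case (congr p q)
      then show ?case using yeq_clsD by metis
    qed
    then show "g y = f y" using q by simp
  qed
  then have "tau_tensor \<tau> n \<mu> S = f"
    unfolding tau_tensor_def using Pf by (intro the_equality) blast+
  then show ?thesis using f assms by simp
qed

end

section \<open>Permutations and their standard elements\<close>

lemma perm_word_simps [simp]:
  "perm_word [] = id" "perm_word (i # is) = transpose i (Suc i) \<circ> perm_word is"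
  by (simp_all add: perm_word_def)

lemma perm_word_append: "perm_word (is @ js) = perm_word is \<circ> perm_word js"
  by (induction "is") (simp_all add: comp_assoc)

lemma adjacent_transpositions_generate:
  assumes "w permutes {1..n}" obtains "is" where "set is \<subseteq> {1..<n}" "perm_word is = w"
proof -
  let ?G = "{perm_word is | is. set is \<subseteq> {1..<n}}"
  have comp: "v \<circ> w \<in> ?G" if v: "v \<in> ?G" and w: "w \<in> ?G" for v w
  proof -
    obtain "is" js where "v = perm_word is" "w = perm_word js" "set is \<subseteq> {1..<n}" "set js \<subseteq> {1..<n}"
      using v w by blast
    then have "v \<circ> w = perm_word (is @ js) \<and> set (is @ js) \<subseteq> {1..<n}" by (simp add: perm_word_append)
    then show ?thesis by blast
  qed
  have adj: "transpose i (Suc i) \<in> ?G" if "1 \<le> i" "i < n" for i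
    using that by (intro CollectI exI[of _ "[i]"]) simp
  have less: "b \<le> n \<longrightarrow> transpose a b \<in> ?G" if "1 \<le> a" "Suc a \<le> b" for a b
    using that(2)
  proof (induction b rule: dec_induct)
    case base
    then show ?case using adj that by simp
  next
    case (step b)
    have e: "transpose a (Suc b) = transpose b (Suc b) \<circ> (transpose a b \<circ> transpose b (Suc b))"
      using step(1) by (auto simp: fun_eq_iff transpose_def)
    show ?case
    proof
      assume "Suc b \<le> n"
      then have "transpose b (Suc b) \<in> ?G" "transpose a b \<in> ?G"
        using step that(1) adj[of b] by auto
      then show "transpose a (Suc b) \<in> ?G" unfolding e by (intro comp)
    qed
  qed
  have tr: "transpose a b \<in> ?G" if "a \<in> {1..n}" "b \<in> {1..n}" "a \<noteq> b" for a b
    using less[of a b] less[of b a] that by (cases "a < b") (auto simp: transpose_commute[of a b] simp del: mem_Collect_eq)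
  have "w \<in> ?G"
    using assms finite_atLeastAtMost[of 1 n]
  proof (induction w rule: permutes_induct)
    case id
    show ?case by (intro CollectI exI[of _ "[]"]) simp
  next
    case (swap a b p)
    then show ?case using comp[OF tr] by blast
  qed
  then show ?thesis using that by blast
qed

lemma plen_le: "set is \<subseteq> {1..<n} \<Longrightarrow> perm_word is = w \<Longrightarrow> plen n w \<le> length is"
  unfolding plen_def by (rule Least_le) auto

lemma plen_0_iff: "w permutes {1..n} \<Longrightarrow> plen n w = 0 \<longleftrightarrow> w = id"
proof
  assume "w permutes {1..n}" "plen n w = 0"
  obtain js where "set js \<subseteq> {1..<n}" "perm_word js = w"
    using adjacent_transpositions_generate \<open>w permutes {1..n}\<close> by blast
  then have "\<exists>r. \<exists>is. set is \<subseteq> {1..<n} \<and> length is = r \<and> perm_word is = w" by blast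
  then have "\<exists>is. set is \<subseteq> {1..<n} \<and> length is = plen n w \<and> perm_word is = w"
    unfolding plen_def by (rule LeastI_ex)
  then show "w = id" using \<open>plen n w = 0\<close> by auto
next
  assume "w = id"
  then show "plen n w = 0" using plen_le[of "[]" n w] by simp
qed

lemma adjacent_neq_id: "transpose i (Suc i) \<noteq> id"
  by (metis id_apply n_not_Suc_n transpose_apply_first)

lemma plen_adjacent: "1 \<le> i \<Longrightarrow> i < n \<Longrightarrow> plen n (transpose i (Suc i)) = 1"
  using plen_le[of "[i]" n "transpose i (Suc i)"] plen_0_iff[of "transpose i (Suc i)" n] adjacent_neq_id[of i]
  by (auto simp: permutes_swap_id le_Suc_eq One_nat_def)

text \<open>The identity and, in \<open>yg_perm_adjacent\<close>, an adjacent transposition have a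
  single reduced expression, which determines the choice in \<open>yg_perm\<close>. These two cases
  provide the matrices of the idempotents and of the generators.\<close>

lemma yg_perm_id: "yg_perm d n id = \<one>\<^bsub>yh d n\<^esub>"
proof -
  have "reduced_expr n id is \<longleftrightarrow> is = []" for "is"
    using plen_0_iff[of id n] by (auto simp: reduced_expr_def permutes_id)
  then show ?thesis by (simp add: yg_perm_def cls_simps)
qed

lemma yg_perm_adjacent:
  assumes "1 \<le> i" "i < n" shows "yg_perm d n (transpose i (Suc i)) = yg d n i"
proof -
  have "reduced_expr n (transpose i (Suc i)) is \<longleftrightarrow> is = [i]" for "is"
  proof
    assume "reduced_expr n (transpose i (Suc i)) is"
    then have r: "length is = 1" "perm_word is = transpose i (Suc i)"
      using plen_adjacent[OF assms] by (auto simp: reduced_expr_def)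
    then obtain j where j: "is = [j]" by (auto simp: length_Suc_conv One_nat_def)
    with r have e: "transpose j (Suc j) = transpose i (Suc i)" by simp
    have "j = i"
      using fun_cong[OF e, of i] by (cases "i = j"; cases "i = Suc j") simp_all
    with j show "is = [i]" by simp
  next
    assume "is = [i]"
    then show "reduced_expr n (transpose i (Suc i)) is"
      using assms plen_adjacent[OF assms] by (simp add: reduced_expr_def)
  qed
  then show ?thesis by (simp add: yg_perm_def yg_def)
qed

section \<open>Characters as labellings\<close>

text \<open>A character is encoded by the indices of its values. Off \<open>{1..n}\<close> a
  labelling is arbitrary, so that permutations act by plain composition.\<close>

definition labellings :: "nat \<Rightarrow> nat \<Rightarrow> (nat \<Rightarrow> nat) set" where
  "labellings d n = {c. \<forall>j \<in> {1..n}. c j \<in> {1..d}}"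

definition label_char :: "(nat \<Rightarrow> complex) \<Rightarrow> nat \<Rightarrow> (nat \<Rightarrow> nat) \<Rightarrow> nat \<Rightarrow> complex" where
  "label_char \<xi> n c = (\<lambda>j \<in> {1..n}. \<xi> (c j))"

definition cnt :: "nat \<Rightarrow> (nat \<Rightarrow> nat) \<Rightarrow> nat \<Rightarrow> nat" where
  "cnt n c a = card {j \<in> {1..n}. c j = a}"

text \<open>The permutation \<open>\<pi>\<^sub>\<chi>\<close> only depends on the relative order of the labels of \<open>\<chi>\<close>.\<close>

definition sorter :: "nat \<Rightarrow> (nat \<Rightarrow> nat) \<Rightarrow> nat \<Rightarrow> nat" where
  "sorter n c = (ARG_MIN (plen n) w. w permutes {1..n} \<and> mono_on {1..n} (c \<circ> w))"

lemma label_char_chars: "c \<in> labellings d n \<Longrightarrow> label_char \<xi> n c \<in> chars \<xi> d n"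
  by (auto simp: label_char_def chars_def labellings_def)

lemma chars_label_char:
  assumes "\<chi> \<in> chars \<xi> d n" obtains c where "c \<in> labellings d n" "\<chi> = label_char \<xi> n c"
proof -
  have "\<forall>j. \<exists>a. j \<in> {1..n} \<longrightarrow> a \<in> {1..d} \<and> \<chi> j = \<xi> a"
    using assms by (fastforce simp: chars_def PiE_def Pi_def)
  then obtain c where c: "\<forall>j. j \<in> {1..n} \<longrightarrow> c j \<in> {1..d} \<and> \<chi> j = \<xi> (c j)" by metis
  have "\<chi> = label_char \<xi> n c"
  proof
    fix j show "\<chi> j = label_char \<xi> n c j"
      using assms c by (cases "j \<in> {1..n}") (auto simp: label_char_def chars_def PiE_def extensional_def)
  qed
  then show ?thesis using that[of c] c by (auto simp: labellings_def)
qed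

lemma labellings_comp: "c \<in> labellings d n \<Longrightarrow> w permutes {1..n} \<Longrightarrow> c \<circ> w \<in> labellings d n"
  using permutes_in_image[of w "{1..n}"] by (fastforce simp: labellings_def)

lemma act_label_char: "w permutes {1..n} \<Longrightarrow> act n w (label_char \<xi> n c) = label_char \<xi> n (c \<circ> inv_into UNIV w)"
  using permutes_in_image[OF permutes_inv, of w "{1..n}"] by (auto simp: act_def label_char_def fun_eq_iff)

lemma sum_cnt:
  assumes "finite B" shows "(\<Sum>b \<in> B. cnt n c b) = card {j \<in> {1..n}. c j \<in> B}"
proof -
  have "{j \<in> {1..n}. c j \<in> B} = (\<Union>b \<in> B. {j \<in> {1..n}. c j = b})" by auto
  moreover have "card (\<Union>b \<in> B. {j \<in> {1..n}. c j = b}) = (\<Sum>b \<in> B. card {j \<in> {1..n}. c j = b})"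
    using assms by (intro card_UN_disjoint) auto
  ultimately show ?thesis by (simp add: cnt_def)
qed

lemma cnt_comps:
  assumes "c \<in> labellings d n" shows "cnt n c \<in> comps d n"
proof -
  have "{j \<in> {1..n}. c j \<in> {1..d}} = {1..n}" using assms by (auto simp: labellings_def)
  then have "(\<Sum>a = 1..d. cnt n c a) = n" by (simp add: sum_cnt)
  moreover have "cnt n c a = 0" if "a \<notin> {1..d}" for a
    using assms that by (auto simp: cnt_def labellings_def)
  ultimately show ?thesis by (simp add: comps_def)
qed

lemma Comp_label_char:
  assumes "inj_on \<xi> {1..d}" "c \<in> labellings d n" shows "Comp \<xi> d n (label_char \<xi> n c) = cnt n c"
proof
  fix a
  show "Comp \<xi> d n (label_char \<xi> n c) a = cnt n c a"
  proof (cases "a \<in> {1..d}")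
    case True
    then have "{j \<in> {1..n}. label_char \<xi> n c j = \<xi> a} = {j \<in> {1..n}. c j = a}"
      using assms(2) inj_on_eq_iff[OF assms(1) _ True] by (auto simp: label_char_def labellings_def)
    then show ?thesis using True by (simp add: Comp_def cnt_def)
  next
    case False
    then show ?thesis
      using comps_outside[OF cnt_comps[OF assms(2)] False] by (simp only: Comp_def if_False)
  qed
qed

lemma cnt_comp:
  assumes "w permutes {1..n}" shows "cnt n (c \<circ> w) = cnt n c"
proof
  fix a
  have "bij_betw w {j \<in> {1..n}. c (w j) = a} {j \<in> {1..n}. c j = a}"
  proof (rule bij_betwI[where g = "inv_into UNIV w"])
    show "w \<in> {j \<in> {1..n}. c (w j) = a} \<rightarrow> {j \<in> {1..n}. c j = a}"
      using permutes_in_image[OF assms] by auto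
    show "inv_into UNIV w \<in> {j \<in> {1..n}. c j = a} \<rightarrow> {j \<in> {1..n}. c (w j) = a}"
      using permutes_in_image[OF permutes_inv[OF assms]] permutes_inverses[OF assms] by auto
  qed (use permutes_inverses[OF assms] in auto)
  then show "cnt n (c \<circ> w) a = cnt n c a" by (simp add: cnt_def bij_betw_same_card)
qed

section \<open>Sorted labellings and the permutations of minimal length\<close>

lemma offset_cnt:
  assumes "c \<in> labellings d n" shows "offset (cnt n c) a = card {j \<in> {1..n}. c j < a}"
proof -
  have "{j \<in> {1..n}. c j \<in> {1..<a}} = {j \<in> {1..n}. c j < a}" using assms by (auto simp: labellings_def)
  then show ?thesis by (simp add: offset_def sum_cnt)
qed

text \<open>Sorted labels form consecutive runs, and the run of the label \<open>a\<close> has the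
  length and the offset of block \<open>a\<close>.\<close>

lemma mono_on_iff_block:
  assumes c: "c \<in> labellings d n"
  shows "mono_on {1..n} c \<longleftrightarrow> (\<forall>j \<in> {1..n}. j \<in> block (cnt n c) (c j))"
proof
  assume mono: "mono_on {1..n} c"
  show "\<forall>j \<in> {1..n}. j \<in> block (cnt n c) (c j)"
  proof
    fix j assume j: "j \<in> {1..n}"
    \<comment> \<open>Under monotonicity strictly smaller labels stand strictly before
      \<open>j\<close>, and labels at most \<open>c j\<close> fill all positions up to
      \<open>j\<close>; counting both sets locates \<open>j\<close> in its block.\<close>
    have "{i \<in> {1..n}. c i < c j} \<subseteq> {1..<j}"
    proof
      fix i assume i: "i \<in> {i \<in> {1..n}. c i < c j}"
      then have "\<not> j \<le> i" using mono_onD[OF mono, of j i] j by auto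
      with i show "i \<in> {1..<j}" by auto
    qed
    then have "offset (cnt n c) (c j) \<le> card {1..<j}"
      unfolding offset_cnt[OF c] by (intro card_mono) auto
    moreover have "1 \<le> j" using j by simp
    ultimately have 1: "offset (cnt n c) (c j) < j" unfolding card_atLeastLessThan by arith
    have "{1..j} \<subseteq> {i \<in> {1..n}. c i < Suc (c j)}"
      using mono_onD[OF mono] j by (auto simp: less_Suc_eq_le)
    then have "card {1..j} \<le> offset (cnt n c) (Suc (c j))"
      unfolding offset_cnt[OF c] by (intro card_mono) auto
    then have "j \<le> offset (cnt n c) (c j) + cnt n c (c j)"
      using offset_Suc[of "c j" "cnt n c"] c j by (simp add: labellings_def)
    with 1 show "j \<in> block (cnt n c) (c j)" by (simp add: block_def)
  qed
next
  assume bl: "\<forall>j \<in> {1..n}. j \<in> block (cnt n c) (c j)"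
  show "mono_on {1..n} c"
  proof (rule mono_onI, rule ccontr)
    fix i j assume "i \<in> {1..n}" "j \<in> {1..n}" "i \<le> j" "\<not> c i \<le> c j"
    then show False using block_less[OF cnt_comps[OF c], of j "c j" i "c i"] bl by auto
  qed
qed

lemma the_block: "\<mu> \<in> comps d n \<Longrightarrow> j \<in> block \<mu> a \<Longrightarrow> (THE a. j \<in> block \<mu> a) = a"
  using block_unique by (intro the_equality) blast+

text \<open>The labels of \<open>chi_0\<close> are the increasing rearrangement of those of
  \<open>c\<close>. This turns the defining property of \<open>pi_chi\<close> into a condition on
  the order of labels that mentions neither \<open>d\<close> nor the roots of unity.\<close>

lemma act_chi0_iff_mono:
  assumes \<xi>: "inj_on \<xi> {1..d}" and c: "c \<in> labellings d n" and w: "w permutes {1..n}"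
  shows "act n w (chi0 \<xi> n (cnt n c)) = label_char \<xi> n c \<longleftrightarrow> mono_on {1..n} (c \<circ> w)"
proof -
  let ?s = "\<lambda>j. THE a. j \<in> block (cnt n c) a"
  note comps = cnt_comps[OF c]
  have s: "?s j \<in> {1..d} \<and> j \<in> block (cnt n c) (?s j)" if "j \<in> {1..n}" for j
    using block_exists[OF comps that] the_block[OF comps] by metis
  have chi0: "chi0 \<xi> n (cnt n c) = label_char \<xi> n ?s" by (simp add: chi0_def label_char_def)
  have cw: "c \<circ> w \<in> labellings d n" using c w by (rule labellings_comp)
  have "act n w (chi0 \<xi> n (cnt n c)) = label_char \<xi> n c \<longleftrightarrow> (\<forall>i \<in> {1..n}. \<xi> (?s (inv_into UNIV w i)) = \<xi> (c i))"
    unfolding chi0 act_label_char[OF w] by (auto simp: label_char_def fun_eq_iff)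
  also have "\<dots> \<longleftrightarrow> (\<forall>j \<in> {1..n}. \<xi> (?s j) = \<xi> (c (w j)))"
    using permutes_in_image[OF w] permutes_in_image[OF permutes_inv[OF w]] permutes_inverses[OF w] by metis
  also have "\<dots> \<longleftrightarrow> (\<forall>j \<in> {1..n}. ?s j = c (w j))"
  proof (rule ball_cong)
    fix j assume "j \<in> {1..n}"
    then show "\<xi> (?s j) = \<xi> (c (w j)) \<longleftrightarrow> ?s j = c (w j)"
      using s cw by (intro inj_on_eq_iff[OF \<xi>]) (auto simp: labellings_def)
  qed simp
  also have "\<dots> \<longleftrightarrow> (\<forall>j \<in> {1..n}. j \<in> block (cnt n c) (c (w j)))"
    using s the_block[OF comps] by metis
  also have "\<dots> \<longleftrightarrow> mono_on {1..n} (c \<circ> w)"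
    using mono_on_iff_block[OF cw] cnt_comp[OF w, of c] by simp
  finally show ?thesis .
qed

lemma ex_sorting:
  assumes c: "c \<in> labellings d n" shows "\<exists>w. w permutes {1..n} \<and> mono_on {1..n} (c \<circ> w)"
proof -
  let ?s = "\<lambda>j. THE a. j \<in> block (cnt n c) a"
  note comps = cnt_comps[OF c]
  \<comment> \<open>The block labels and the values of \<open>c\<close> form the same multiset, so a
    permutation carries one to the other.\<close>
  have "count (image_mset ?s (mset_set {1..n})) a = count (image_mset c (mset_set {1..n})) a" for a
  proof -
    have "{j \<in> {1..n}. ?s j = a} = block (cnt n c) a"
      using block_exists[OF comps] the_block[OF comps] block_subset[OF comps] by blast
    then show ?thesis by (simp add: count_image_mset_eq_card_vimage block_def cnt_def)
  qed
  then have "image_mset ?s (mset_set {1..n}) = image_mset c (mset_set {1..n})" by (rule multiset_eqI)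
  then obtain w where w: "w permutes {1..n}" "\<forall>j \<in> {1..n}. ?s j = c (w j)"
    using image_mset_eq_implies_permutes[of "{1..n}" ?s c] by auto
  have "j \<in> block (cnt n c) (c (w j))" if "j \<in> {1..n}" for j
    using w(2) that block_exists[OF comps that] the_block[OF comps] by metis
  then have "mono_on {1..n} (c \<circ> w)"
    using mono_on_iff_block[OF labellings_comp[OF c w(1)]] cnt_comp[OF w(1), of c] by simp
  with w(1) show ?thesis by blast
qed

lemma sorter_permutes: "c \<in> labellings d n \<Longrightarrow> sorter n c permutes {1..n}"
  using arg_min_nat_lemma[of "\<lambda>w. w permutes {1..n} \<and> mono_on {1..n} (c \<circ> w)" _ "plen n"] ex_sorting
  unfolding sorter_def by blast

lemma pi_char_sorter:
  assumes "inj_on \<xi> {1..d}" "c \<in> labellings d n"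
  shows "pi_char \<xi> d n (label_char \<xi> n c) = sorter n c"
  unfolding pi_char_def sorter_def Comp_label_char[OF assms]
  using act_chi0_iff_mono[OF assms] by (metis (no_types, lifting))

text \<open>\<open>sorter\<close> depends on comparisons between labels only, and these are
  preserved by \<open>\<sigma>\<close>.\<close>

lemma sorter_strict_mono:
  assumes \<sigma>: "strict_mono_on {1..k} \<sigma>" and c: "c \<in> labellings k n"
  shows "sorter n (\<sigma> \<circ> c) = sorter n c"
proof -
  have "mono_on {1..n} (\<sigma> \<circ> c \<circ> w) \<longleftrightarrow> mono_on {1..n} (c \<circ> w)" if "w permutes {1..n}" for w
  proof -
    have "\<sigma> (c (w i)) \<le> \<sigma> (c (w j)) \<longleftrightarrow> c (w i) \<le> c (w j)" if "i \<in> {1..n}" "j \<in> {1..n}" for i j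
      using strict_mono_on_less_eq[OF \<sigma>] labellings_comp[OF c \<open>w permutes {1..n}\<close>] that
      by (simp add: labellings_def)
    then show ?thesis by (simp add: mono_on_def)
  qed
  then show ?thesis unfolding sorter_def by (metis (no_types, lifting))
qed

lemma sorter_mono:
  assumes "mono_on {1..n} c" shows "sorter n c = id"
proof -
  let ?P = "\<lambda>w. w permutes {1..n} \<and> mono_on {1..n} (c \<circ> w)"
  have "?P id" using assms by (simp add: permutes_id)
  then have "?P (sorter n c) \<and> plen n (sorter n c) \<le> plen n id"
    using arg_min_nat_lemma[of ?P id "plen n"] unfolding sorter_def by blast
  then show ?thesis using plen_0_iff[of id n] plen_0_iff[of "sorter n c" n] by (simp add: permutes_id)
qed

section \<open>Scalars and idempotents in Yokonuma--Hecke algebras\<close>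

lemma yh_elem: "x \<in> carrier (yh d n) \<Longrightarrow> (\<And>p. p \<in> FA n \<Longrightarrow> x = cls d n p \<Longrightarrow> thesis) \<Longrightarrow> thesis"
  unfolding yh_carrier by blast

lemma smul_cls: "p \<in> FA n \<Longrightarrow> smul d n r (cls d n p) = cls d n (scal r * p)"
  by (simp add: smul_def cls_simps)

lemma smul_closed: "x \<in> carrier (yh d n) \<Longrightarrow> smul d n r x \<in> carrier (yh d n)"
  by (elim yh_elem) (simp add: smul_cls cls_simps(1))

lemma smul_smul: "x \<in> carrier (yh d n) \<Longrightarrow> smul d n r (smul d n s x) = smul d n (r * s) x"
  by (elim yh_elem) (simp add: smul_cls scal_mult_left)

lemma smul_one: "x \<in> carrier (yh d n) \<Longrightarrow> smul d n 1 x = x"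
  by (elim yh_elem) (simp add: smul_cls scal_1)

lemma smul_zero_left: "x \<in> carrier (yh d n) \<Longrightarrow> smul d n 0 x = \<zero>\<^bsub>yh d n\<^esub>"
  by (elim yh_elem) (simp add: smul_cls scal_0 cls_zero)

lemma smul_zero: "smul d n r \<zero>\<^bsub>yh d n\<^esub> = \<zero>\<^bsub>yh d n\<^esub>"
  by (simp add: cls_zero[symmetric] smul_cls)

lemma smul_mult_right:
  "x \<in> carrier (yh d n) \<Longrightarrow> y \<in> carrier (yh d n) \<Longrightarrow>
    x \<otimes>\<^bsub>yh d n\<^esub> smul d n r y = smul d n r (x \<otimes>\<^bsub>yh d n\<^esub> y)"
  by (elim yh_elem) (simp add: smul_cls cls_simps(2)[symmetric] mult_scal_left)

lemma cst_mult: "cst (a * b) = cst a * cst b" and cst_add: "cst (a + b) = cst a + cst b"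
  and cst_1: "cst 1 = 1" and cst_0: "cst 0 = 0"
  by (simp_all add: cst_def mult_single single_add)

lemma cst_sum: "cst (sum f A) = (\<Sum>a \<in> A. cst (f a))"
  by (induction A rule: infinite_finite_induct) (simp_all add: cst_0 cst_add)

lemma scal_sum: "scal (sum f A) = (\<Sum>a \<in> A. scal (f a))"
  by (induction A rule: infinite_finite_induct) (simp_all add: scal_0 scal_add)

definition idem_factor :: "nat \<Rightarrow> (nat \<Rightarrow> complex) \<Rightarrow> nat \<Rightarrow> free_alg" where
  "idem_factor d \<chi> j = scal (cst (1 / of_nat d)) * (\<Sum>s = 1..d. scal (cst (\<chi> j ^ s)) * tt j ^ (d - s))"

definition idem_elt :: "nat \<Rightarrow> nat \<Rightarrow> (nat \<Rightarrow> complex) \<Rightarrow> free_alg" where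
  "idem_elt d n \<chi> = prod_list (map (idem_factor d \<chi>) [1..<Suc n])"

lemma char_idem_cls: "char_idem d n \<chi> = cls d n (idem_elt d n \<chi>)"
  by (simp add: char_idem_def idem_elt_def idem_factor_def[abs_def])

lemma idem_factor_span: "GenT j \<in> A \<Longrightarrow> idem_factor d \<chi> j \<in> words_span A"
  unfolding idem_factor_def
  by (intro words_span_mult words_span_scal words_span_sum words_span_power tt_in_span)

lemma idem_factors_span: "prod_list (map (idem_factor d \<chi>) [lo..<hi]) \<in> words_span (GenT ` {lo..<hi})"
  by (intro words_span_prod_list) (auto intro!: idem_factor_span)

lemma GenT_FA: "A \<subseteq> {1..n} \<Longrightarrow> words_span (GenT ` A) \<subseteq> FA n"
  unfolding FA_eq gens_def by (intro words_span_mono) auto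

lemma idem_elt_FA [simp]: "idem_elt d n \<chi> \<in> FA n"
  unfolding idem_elt_def using idem_factors_span[of d \<chi> 1 "Suc n"] GenT_FA[of "{1..<Suc n}" n]
  by (simp add: subset_iff less_Suc_eq_le)

text \<open>Multiplication by \<open>t_j\<close> shifts the summation index of the averaging sum by
  one, and so does multiplication by the value \<open>\<chi> j\<close>, in the opposite
  direction.\<close>

lemma idem_factor_tt:
  assumes j: "1 \<le> j" "j \<le> n" and d: "1 \<le> d" and root: "\<chi> j ^ d = 1"
  shows "yeq d n (idem_factor d \<chi> j * tt j) (scal (cst (\<chi> j)) * idem_factor d \<chi> j)"
proof -
  \<comment> \<open>The two sides become the sums of \<open>h\<close> over \<open>0..d - 1\<close>
    and over \<open>1..d\<close>. The end terms agree because \<open>t_j^d\<close> and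
    \<open>\<chi> j ^ d\<close> are both 1.\<close>
  define h where "h s = scal (cst (\<chi> j ^ Suc s)) * tt j ^ (d - s)" for s
  have hF: "h s \<in> FA n" for s using j by (simp add: h_def)
  have "(\<Sum>s = 1..d. scal (cst (\<chi> j ^ s)) * tt j ^ (d - s)) * tt j = (\<Sum>s = 1..d. h (s - 1))"
    unfolding sum_distrib_right
  proof (intro sum.cong refl)
    fix s assume "s \<in> {1..d}"
    then have "d - (s - 1) = Suc (d - s)" "Suc (s - 1) = s" by auto
    then show "scal (cst (\<chi> j ^ s)) * tt j ^ (d - s) * tt j = h (s - 1)"
      by (simp only: h_def power_Suc2 mult.assoc)
  qed
  also have "\<dots> = sum h {0..<d}"
    by (rule sum.reindex_bij_witness[of _ Suc "\<lambda>s. s - 1"]) (auto simp: One_nat_def)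
  also have "\<dots> = h 0 + sum h {1..<d}"
    using d by (simp add: sum.atLeast_Suc_lessThan One_nat_def)
  finally have l: "(\<Sum>s = 1..d. scal (cst (\<chi> j ^ s)) * tt j ^ (d - s)) * tt j = h 0 + sum h {1..<d}" .
  have "scal (cst (\<chi> j)) * (\<Sum>s = 1..d. scal (cst (\<chi> j ^ s)) * tt j ^ (d - s)) = sum h {1..d}"
    unfolding sum_distrib_left by (intro sum.cong refl) (simp add: h_def scal_mult_left cst_mult[symmetric])
  also have "\<dots> = h d + sum h {1..<d}"
    using d by (simp add: atLeastLessThanSuc_atLeastAtMost[symmetric] add.commute)
  finally have r: "scal (cst (\<chi> j)) * (\<Sum>s = 1..d. scal (cst (\<chi> j ^ s)) * tt j ^ (d - s)) = h d + sum h {1..<d}" .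
  have "h d = scal (cst (\<chi> j)) * 1" using root by (simp add: h_def)
  moreover have "h 0 = scal (cst (\<chi> j)) * tt j ^ d" by (simp add: h_def)
  ultimately have "yeq d n (h 0) (h d)"
    using yeq_mult_left[OF yeq_td[OF j], of "scal (cst (\<chi> j))"] by simp
  moreover have "sum h {1..<d} \<in> FA n" using hF by (auto simp: FA_eq intro!: words_span_sum)
  ultimately have "yeq d n (scal (cst (1 / of_nat d)) * (h 0 + sum h {1..<d})) (scal (cst (1 / of_nat d)) * (h d + sum h {1..<d}))"
    by (intro yeq_mult_left yeq_add) auto
  then show ?thesis
    unfolding idem_factor_def l[symmetric] r[symmetric] by (simp only: mult.assoc scal_left_commute)
qed

lemma idem_elt_tt:
  assumes j: "1 \<le> j" "j \<le> n" and d: "1 \<le> d" and root: "\<chi> j ^ d = 1"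
  shows "yeq d n (idem_elt d n \<chi> * tt j) (scal (cst (\<chi> j)) * idem_elt d n \<chi>)"
proof -
  let ?A = "prod_list (map (idem_factor d \<chi>) [1..<j])"
  let ?B = "prod_list (map (idem_factor d \<chi>) [Suc j..<Suc n])"
  let ?F = "idem_factor d \<chi> j"
  have "[1..<Suc n] = [1..<j] @ j # [Suc j..<Suc n]"
    using j upt_add_eq_append[of 1 j "Suc n - j"] upt_conv_Cons[of j "Suc n"] by auto
  then have E: "idem_elt d n \<chi> = ?A * ?F * ?B" by (simp add: idem_elt_def mult.assoc)
  have A: "?A \<in> FA n" using idem_factors_span[of d \<chi> 1 j] GenT_FA[of "{1..<j}" n] j by (simp add: subset_iff)
  have B: "?B \<in> words_span (GenT ` {Suc j..<Suc n})" by (rule idem_factors_span)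
  then have BF: "?B \<in> FA n" using GenT_FA[of "{Suc j..<Suc n}" n] by (simp add: subset_iff less_Suc_eq_le)
  have F: "?F \<in> FA n" unfolding FA_eq using j by (intro idem_factor_span) simp
  have tF: "tt j \<in> FA n" using j by simp
  have "yeq d n (tt j * ?B) (?B * tt j)"
  proof (rule yeq_commute[where lo = "j - 1" and hi = j and lo' = j and hi' = n])
    show "tt j \<in> words_span (letters (j - 1) j)" using j by (auto simp: letters_def)
    have "words_span (GenT ` {Suc j..<Suc n}) \<subseteq> words_span (letters j n)"
      by (intro words_span_mono) (auto simp: letters_def)
    with B show "?B \<in> words_span (letters j n)" by blast
  qed (use j in auto)
  then have "yeq d n (?A * ?F * (?B * tt j)) (?A * ?F * (tt j * ?B))"
    using A F by (intro yeq_mult_left[OF yeq_sym]) auto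
  also have "?A * ?F * (tt j * ?B) = ?A * (?F * tt j) * ?B" by (simp only: mult.assoc)
  also have "yeq d n \<dots> (?A * (scal (cst (\<chi> j)) * ?F) * ?B)"
    using A BF idem_factor_tt[where \<chi> = \<chi>, OF assms] by (intro yeq_mult_left yeq_mult_right) auto
  also have "?A * (scal (cst (\<chi> j)) * ?F) * ?B = scal (cst (\<chi> j)) * (?A * ?F * ?B)"
    by (simp only: mult_scal_left mult.assoc)
  finally show ?thesis unfolding E by (simp only: mult.assoc)
qed

lemma idem_elt_tt_power:
  assumes j: "1 \<le> j" "j \<le> n" and d: "1 \<le> d" and root: "\<chi> j ^ d = 1"
  shows "yeq d n (idem_elt d n \<chi> * tt j ^ s) (scal (cst (\<chi> j ^ s)) * idem_elt d n \<chi>)"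
proof (induction s)
  case 0
  show ?case by (simp add: cst_1 scal_1)
next
  case (Suc s)
  have "idem_elt d n \<chi> * tt j ^ Suc s = idem_elt d n \<chi> * tt j ^ s * tt j"
    by (simp only: power_Suc2 mult.assoc)
  also have "yeq d n \<dots> (scal (cst (\<chi> j ^ s)) * idem_elt d n \<chi> * tt j)"
    using Suc j by (intro yeq_mult_right) auto
  also have "\<dots> = scal (cst (\<chi> j ^ s)) * (idem_elt d n \<chi> * tt j)" by (simp only: mult.assoc)
  also have "yeq d n \<dots> (scal (cst (\<chi> j ^ s)) * (scal (cst (\<chi> j)) * idem_elt d n \<chi>))"
    by (intro yeq_mult_left idem_elt_tt assms) auto
  also have "\<dots> = scal (cst (\<chi> j ^ Suc s)) * idem_elt d n \<chi>"
    by (simp only: scal_mult_left cst_mult[symmetric] power_Suc2)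
  finally show ?case .
qed

lemma root_sum:
  fixes a b :: complex
  assumes "a ^ d = 1" "b ^ d = 1" "1 \<le> d"
  shows "(\<Sum>s = 1..d. a ^ s * b ^ (d - s)) = (if a = b then of_nat d else 0)"
proof -
  have b0: "b \<noteq> 0" using assms by (auto simp: power_0_left)
  have "(\<Sum>s = 1..d. a ^ s * b ^ (d - s)) = (\<Sum>s = 1..d. (a / b) ^ s)"
  proof (intro sum.cong refl)
    fix s assume "s \<in> {1..d}"
    then have "b ^ s * b ^ (d - s) = 1" using assms by (simp add: power_add[symmetric])
    then show "a ^ s * b ^ (d - s) = (a / b) ^ s" using b0 by (simp add: power_divide field_simps)
  qed
  also have "\<dots> = (if a = b then of_nat d else 0)"
  proof (cases "a = b")
    case True
    then show ?thesis using b0 by simp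
  next
    case False
    then have "a / b \<noteq> 1" using b0 by simp
    have "(\<Sum>s = 1..d. (a / b) ^ s) = (\<Sum>s<d. (a / b) ^ Suc s)"
      by (rule sum.reindex_bij_witness[of _ Suc "\<lambda>s. s - 1"]) (auto simp: One_nat_def)
    also have "\<dots> = (a / b) * (\<Sum>s<d. (a / b) ^ s)" by (simp add: sum_distrib_left)
    also have "(\<Sum>s<d. (a / b) ^ s) = 0"
      unfolding geometric_sum[OF \<open>a / b \<noteq> 1\<close>] using assms by (simp add: power_divide)
    finally show ?thesis using False by simp
  qed
  finally show ?thesis .
qed

text \<open>The eigenvalue of \<open>e_i\<close> on \<open>E_chi\<close>. It is polymorphic because
  it is evaluated on characters and on their labellings.\<close>

definition same :: "(nat \<Rightarrow> 'a) \<Rightarrow> nat \<Rightarrow> laurent" where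
  "same \<chi> i = (if \<chi> i = \<chi> (Suc i) then 1 else 0)"

lemma idem_elt_ee:
  assumes i: "1 \<le> i" "i < n" and d: "1 \<le> d" and root: "\<chi> i ^ d = 1" "\<chi> (Suc i) ^ d = 1"
  shows "yeq d n (idem_elt d n \<chi> * ee d i) (scal (same \<chi> i) * idem_elt d n \<chi>)"
proof -
  let ?E = "idem_elt d n \<chi>"
  have termwise: "yeq d n (?E * (tt i ^ s * tt (Suc i) ^ r)) (scal (cst (\<chi> i ^ s * \<chi> (Suc i) ^ r)) * ?E)" for s r
  proof -
    have "?E * (tt i ^ s * tt (Suc i) ^ r) = ?E * tt i ^ s * tt (Suc i) ^ r" by (simp only: mult.assoc)
    also have "yeq d n \<dots> (scal (cst (\<chi> i ^ s)) * ?E * tt (Suc i) ^ r)"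
      using i d root by (intro yeq_mult_right idem_elt_tt_power) auto
    also have "\<dots> = scal (cst (\<chi> i ^ s)) * (?E * tt (Suc i) ^ r)" by (simp only: mult.assoc)
    also have "yeq d n \<dots> (scal (cst (\<chi> i ^ s)) * (scal (cst (\<chi> (Suc i) ^ r)) * ?E))"
      using i d root by (intro yeq_mult_left idem_elt_tt_power) auto
    finally show ?thesis by (simp add: scal_mult_left cst_mult)
  qed
  have "?E * ee d i = scal (cst (1 / of_nat d)) * (\<Sum>s = 1..d. ?E * (tt i ^ s * tt (Suc i) ^ (d - s)))"
    by (simp add: ee_def mult_scal_left sum_distrib_left)
  also have "yeq d n \<dots> (scal (cst (1 / of_nat d)) * (\<Sum>s = 1..d. scal (cst (\<chi> i ^ s * \<chi> (Suc i) ^ (d - s))) * ?E))"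
    by (intro yeq_mult_left yeq_sum termwise) auto
  also have "(\<Sum>s = 1..d. scal (cst (\<chi> i ^ s * \<chi> (Suc i) ^ (d - s))) * ?E)
      = scal (cst (if \<chi> i = \<chi> (Suc i) then of_nat d else 0)) * ?E"
    unfolding sum_distrib_right[symmetric] scal_sum[symmetric] cst_sum[symmetric] root_sum[OF root d] ..
  also have "scal (cst (1 / of_nat d)) * (scal (cst (if \<chi> i = \<chi> (Suc i) then of_nat d else 0)) * ?E)
      = scal (same \<chi> i) * ?E"
    using d by (simp add: scal_mult_left cst_mult[symmetric] same_def cst_1 cst_0)
  finally show ?thesis .
qed

section \<open>Matrix entries of the isomorphism\<close>

abbreviation s_adj :: "nat \<Rightarrow> nat \<Rightarrow> nat" where
  "s_adj i \<equiv> transpose i (Suc i)"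

lemma s_adj_permutes: "1 \<le> i \<Longrightarrow> i < n \<Longrightarrow> s_adj i permutes {1..n}"
  by (intro permutes_swap_id) auto

text \<open>The entry prescribed by \<open>is_Psi\<close> for \<open>w = s_i\<close>, with the
  characters replaced by labellings and \<open>pi_char\<close> by \<open>sorter\<close>.\<close>

definition hecke_word :: "nat \<Rightarrow> (nat \<Rightarrow> nat) \<Rightarrow> nat \<Rightarrow> free_alg set" where
  "hecke_word n c i =
    (let x = inv_into UNIV (sorter n c) \<circ> s_adj i \<circ> sorter n (c \<circ> s_adj i)
     in smul 1 n (upow (int (plen n (s_adj i)) - int (plen n x))) (yg_perm 1 n x))"

text \<open>The entry at \<open>(\<chi>, s\<^sub>i(\<chi>))\<close> of the image of \<open>g\<^sub>i\<close> or of its inverse (according to \<open>b\<close>), for the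
  character \<open>\<chi>\<close> labelled by \<open>c\<close>. It involves neither \<open>d\<close> nor \<open>\<xi>\<close>.\<close>

definition hecke_entry :: "nat \<Rightarrow> (nat \<Rightarrow> nat) \<Rightarrow> nat \<Rightarrow> bool \<Rightarrow> free_alg set" where
  "hecke_entry n c i b =
    (if b then hecke_word n c i
     else smul 1 n (upow (- 2)) (hecke_word n c i \<ominus>\<^bsub>hecke n\<^esub> smul 1 n (Lv * same c i) \<one>\<^bsub>hecke n\<^esub>))"

definition gam :: "bool \<Rightarrow> laurent" where
  "gam b = (if b then Lgam else Lgaminv)"

definition gsgn :: "nat \<Rightarrow> nat \<Rightarrow> bool \<Rightarrow> free_alg" where
  "gsgn d i b = (if b then gg i else gginv d i)"

text \<open>As \<open>e_i\<close> is idempotent, replacing gamma by its inverse inverts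
  \<open>\<gamma> + (1 - \<gamma>) e_i\<close>; this is the factor belonging to a negative
  crossing.\<close>

definition framing :: "nat \<Rightarrow> nat \<Rightarrow> bool \<Rightarrow> free_alg" where
  "framing d i b = scal (gam b) + scal (1 - gam b) * ee d i"

text \<open>The scalar by which \<open>framing\<close> acts on \<open>E_chi\<close>: 1 if the values
  at \<open>i\<close> and \<open>i + 1\<close> agree, and a power of gamma otherwise.\<close>

definition weight :: "(nat \<Rightarrow> 'a) \<Rightarrow> nat \<Rightarrow> bool \<Rightarrow> laurent" where
  "weight \<chi> i b = gam b + (1 - gam b) * same \<chi> i"

lemma weight_inverse: "weight \<chi> i b * weight \<chi> i (\<not> b) = 1"
  using Lgaminv by (auto simp: weight_def gam_def same_def mult.commute)

lemma gsgn_FA [simp]: "1 \<le> i \<Longrightarrow> i < n \<Longrightarrow> gsgn d i b \<in> FA n"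
  by (simp add: gsgn_def)

lemma framing_FA [simp]: "1 \<le> i \<Longrightarrow> i < n \<Longrightarrow> framing d i b \<in> FA n"
  by (simp add: framing_def)

locale yh_iso =
  fixes \<xi> :: "nat \<Rightarrow> complex" and d n :: nat and \<Phi> :: "free_alg set \<Rightarrow> mats"
  assumes d: "1 \<le> d" and n: "1 \<le> n"
    and roots: "bij_betw \<xi> {1..d} {z. z ^ d = 1}"
    and Psi: "is_Psi \<xi> d n \<Phi>"
begin

lemma inj_roots: "inj_on \<xi> {1..d}"
  using roots by (simp add: bij_betw_def)

lemma Phi_iso: "\<Phi> \<in> ring_iso (yh d n) (mat_sum \<xi> d n)"
  and Phi_smul: "x \<in> carrier (yh d n) \<Longrightarrow>
    \<Phi> (smul d n r x) = mk_mats \<xi> d n (\<lambda>\<mu> \<chi> \<chi>'. smul 1 n r (\<Phi> x \<mu> \<chi> \<chi>'))"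
  using Psi unfolding is_Psi_def by auto

lemma chars_of_chars: "\<chi> \<in> chars_of \<xi> d n \<mu> \<Longrightarrow> \<chi> \<in> chars \<xi> d n"
  by (simp add: chars_of_def)

lemma chars_ofE:
  assumes "\<chi> \<in> chars_of \<xi> d n \<mu>"
  obtains c where "c \<in> labellings d n" "\<chi> = label_char \<xi> n c" "\<mu> = cnt n c"
proof -
  obtain c where c: "c \<in> labellings d n" "\<chi> = label_char \<xi> n c"
    using chars_label_char[OF chars_of_chars[OF assms]] by blast
  then show ?thesis using assms Comp_label_char[OF inj_roots c(1)] that[of c] by (simp add: chars_of_def)
qed

lemma label_char_chars_of: "c \<in> labellings d n \<Longrightarrow> label_char \<xi> n c \<in> chars_of \<xi> d n (cnt n c)"
  by (simp add: chars_of_def label_char_chars Comp_label_char[OF inj_roots])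

lemma chars_of_comps: "\<chi> \<in> chars_of \<xi> d n \<mu> \<Longrightarrow> \<mu> \<in> comps d n"
  using chars_ofE cnt_comps by blast

lemma finite_chars: "finite (chars \<xi> d n)"
  unfolding chars_def by (intro finite_PiE) auto

lemma finite_chars_of: "finite (chars_of \<xi> d n \<mu>)"
  unfolding chars_of_def using finite_chars by simp

lemma char_root: "\<chi> \<in> chars \<xi> d n \<Longrightarrow> 1 \<le> j \<Longrightarrow> j \<le> n \<Longrightarrow> \<chi> j ^ d = 1"
proof -
  assume "\<chi> \<in> chars \<xi> d n" "1 \<le> j" "j \<le> n"
  then have "\<chi> j \<in> \<xi> ` {1..d}" by (auto simp: chars_def)
  then show ?thesis using roots by (auto simp: bij_betw_def)
qed

lemma same_label_char:
  assumes "c \<in> labellings d n" "1 \<le> i" "i < n" shows "same (label_char \<xi> n c) i = same c i"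
proof -
  have "c i \<in> {1..d}" "c (Suc i) \<in> {1..d}" using assms by (auto simp: labellings_def)
  then show ?thesis using assms inj_on_eq_iff[OF inj_roots, of "c i" "c (Suc i)"] by (simp add: same_def label_char_def)
qed

lemma mk_mats_apply:
  "\<chi> \<in> chars_of \<xi> d n \<mu> \<Longrightarrow> \<chi>' \<in> chars_of \<xi> d n \<mu> \<Longrightarrow> mk_mats \<xi> d n A \<mu> \<chi> \<chi>' = A \<mu> \<chi> \<chi>'"
  using chars_of_comps by (simp add: mk_mats_def)

lemma entry_hecke_comp:
  assumes "x \<in> carrier (yh d n)" "\<chi> \<in> chars_of \<xi> d n \<mu>" "\<chi>' \<in> chars_of \<xi> d n \<mu>"
  shows "\<Phi> x \<mu> \<chi> \<chi>' \<in> hecke_comp n \<mu>"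
proof -
  have "\<Phi> x \<in> carrier (mat_sum \<xi> d n)" by (rule ring_iso_memE(1)[OF Phi_iso assms(1)])
  then show ?thesis using assms(2,3) chars_of_comps[OF assms(2)] by (auto simp: mat_sum_def PiE_def Pi_def)
qed

lemma hecke_comp_carrier: "hecke_comp n \<mu> \<subseteq> carrier (hecke n)"
  unfolding hecke_comp_def
  by (intro ring.generate_ring_incl[OF ring_yh]) (auto simp: yg_def intro!: cls_simps(1))

lemma entry_carrier:
  assumes "x \<in> carrier (yh d n)" "\<chi> \<in> chars_of \<xi> d n \<mu>" "\<chi>' \<in> chars_of \<xi> d n \<mu>"
  shows "\<Phi> x \<mu> \<chi> \<chi>' \<in> carrier (hecke n)"
  using entry_hecke_comp[OF assms] hecke_comp_carrier by blast

lemma entry_mult: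
  assumes "x \<in> carrier (yh d n)" "y \<in> carrier (yh d n)" "\<chi> \<in> chars_of \<xi> d n \<mu>" "\<chi>' \<in> chars_of \<xi> d n \<mu>"
  shows "\<Phi> (x \<otimes>\<^bsub>yh d n\<^esub> y) \<mu> \<chi> \<chi>' =
    finsum (hecke n) (\<lambda>\<psi>. \<Phi> x \<mu> \<chi> \<psi> \<otimes>\<^bsub>hecke n\<^esub> \<Phi> y \<mu> \<psi> \<chi>') (chars_of \<xi> d n \<mu>)"
  using ring_iso_memE(2)[OF Phi_iso assms(1,2)] assms(3,4) by (simp add: mat_sum_def mk_mats_apply)

lemma entry_add:
  assumes "x \<in> carrier (yh d n)" "y \<in> carrier (yh d n)" "\<chi> \<in> chars_of \<xi> d n \<mu>" "\<chi>' \<in> chars_of \<xi> d n \<mu>"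
  shows "\<Phi> (x \<oplus>\<^bsub>yh d n\<^esub> y) \<mu> \<chi> \<chi>' = \<Phi> x \<mu> \<chi> \<chi>' \<oplus>\<^bsub>hecke n\<^esub> \<Phi> y \<mu> \<chi> \<chi>'"
  using ring_iso_memE(3)[OF Phi_iso assms(1,2)] assms(3,4) by (simp add: mat_sum_def mk_mats_apply)

lemma entry_smul:
  assumes "x \<in> carrier (yh d n)" "\<chi> \<in> chars_of \<xi> d n \<mu>" "\<chi>' \<in> chars_of \<xi> d n \<mu>"
  shows "\<Phi> (smul d n r x) \<mu> \<chi> \<chi>' = smul 1 n r (\<Phi> x \<mu> \<chi> \<chi>')"
  using assms by (simp add: Phi_smul mk_mats_apply)

lemma entry_one:
  assumes "\<chi> \<in> chars_of \<xi> d n \<mu>" "\<chi>' \<in> chars_of \<xi> d n \<mu>"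
  shows "\<Phi> \<one>\<^bsub>yh d n\<^esub> \<mu> \<chi> \<chi>' = (if \<chi> = \<chi>' then \<one>\<^bsub>hecke n\<^esub> else \<zero>\<^bsub>hecke n\<^esub>)"
  using ring_iso_memE(4)[OF Phi_iso] assms by (simp add: mat_sum_def mk_mats_apply)

text \<open>Injectivity of the isomorphism in the form in which the braid relations are checked:
  equality in \<open>Y_{d,n}\<close> follows from equality of all matrix entries.\<close>

lemma Phi_eqI:
  assumes "x \<in> carrier (yh d n)" "y \<in> carrier (yh d n)"
    and eq: "\<And>\<mu> \<chi> \<chi>'. \<chi> \<in> chars_of \<xi> d n \<mu> \<Longrightarrow> \<chi>' \<in> chars_of \<xi> d n \<mu> \<Longrightarrow> \<Phi> x \<mu> \<chi> \<chi>' = \<Phi> y \<mu> \<chi> \<chi>'"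
  shows "x = y"
proof -
  have car: "carrier (mat_sum \<xi> d n) = (\<Pi>\<^sub>E \<mu> \<in> comps d n. \<Pi>\<^sub>E \<chi> \<in> chars_of \<xi> d n \<mu>. \<Pi>\<^sub>E \<chi>' \<in> chars_of \<xi> d n \<mu>. hecke_comp n \<mu>)"
    by (simp add: mat_sum_def)
  have in_car: "\<Phi> x \<in> carrier (mat_sum \<xi> d n)" "\<Phi> y \<in> carrier (mat_sum \<xi> d n)"
    using ring_iso_memE(1)[OF Phi_iso] assms by auto
  have "\<Phi> x = \<Phi> y"
  proof (rule PiE_ext[OF in_car[unfolded car]])
    fix \<mu> assume \<mu>: "\<mu> \<in> comps d n"
    have row: "\<Phi> x \<mu> \<in> (\<Pi>\<^sub>E \<chi> \<in> chars_of \<xi> d n \<mu>. \<Pi>\<^sub>E \<chi>' \<in> chars_of \<xi> d n \<mu>. hecke_comp n \<mu>)"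
      "\<Phi> y \<mu> \<in> (\<Pi>\<^sub>E \<chi> \<in> chars_of \<xi> d n \<mu>. \<Pi>\<^sub>E \<chi>' \<in> chars_of \<xi> d n \<mu>. hecke_comp n \<mu>)"
      using PiE_mem[OF in_car(1)[unfolded car] \<mu>] PiE_mem[OF in_car(2)[unfolded car] \<mu>] .
    show "\<Phi> x \<mu> = \<Phi> y \<mu>"
    proof (rule PiE_ext[OF row])
      fix \<chi> assume \<chi>: "\<chi> \<in> chars_of \<xi> d n \<mu>"
      have ent: "\<Phi> x \<mu> \<chi> \<in> (\<Pi>\<^sub>E \<chi>' \<in> chars_of \<xi> d n \<mu>. hecke_comp n \<mu>)"
        "\<Phi> y \<mu> \<chi> \<in> (\<Pi>\<^sub>E \<chi>' \<in> chars_of \<xi> d n \<mu>. hecke_comp n \<mu>)"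
        using PiE_mem[OF row(1) \<chi>] PiE_mem[OF row(2) \<chi>] .
      show "\<Phi> x \<mu> \<chi> = \<Phi> y \<mu> \<chi>"
        by (rule PiE_ext[OF ent]) (rule eq[OF \<chi>])
    qed
  qed
  then show ?thesis
    using inj_onD[OF bij_betw_imp_inj_on[OF ring_iso_memE(5)[OF Phi_iso]] _ assms(1,2)] by blast
qed

lemma Phi_idem_gen:
  assumes c: "c \<in> labellings d n" and w: "w permutes {1..n}" and x: "x = inv_into UNIV (sorter n c) \<circ> w \<circ> sorter n (c \<circ> w)"
  shows "\<Phi> (char_idem d n (label_char \<xi> n c) \<otimes>\<^bsub>yh d n\<^esub> yg_perm d n w) =
    mat_unit \<xi> d n (label_char \<xi> n c) (label_char \<xi> n (c \<circ> w))
      (smul 1 n (upow (int (plen n w) - int (plen n x))) (yg_perm 1 n x))"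
proof -
  \<comment> \<open>\<open>is_Psi\<close> speaks of \<open>g\<close> at the inverse of its
    parameter. Instantiating that parameter with the inverse of \<open>w\<close> gives
    \<open>g_w\<close> and turns the action on characters into composition with
    \<open>w\<close>.\<close>
  let ?v = "inv_into UNIV w"
  have v: "?v permutes {1..n}" using w by (rule permutes_inv)
  have vv: "inv_into UNIV ?v = w" using w by (rule permutes_inv_inv)
  have "act n ?v (label_char \<xi> n c) = label_char \<xi> n (c \<circ> w)"
    using act_label_char[OF v, of \<xi> c] vv by simp
  moreover have "pi_char \<xi> d n (label_char \<xi> n c) = sorter n c"
    "pi_char \<xi> d n (label_char \<xi> n (c \<circ> w)) = sorter n (c \<circ> w)"
    using pi_char_sorter[OF inj_roots] c labellings_comp[OF c w] by auto
  moreover have "let w' = inv_into UNIV ?v;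
             x = inv_into UNIV (pi_char \<xi> d n (label_char \<xi> n c)) \<circ> w' \<circ> pi_char \<xi> d n (act n ?v (label_char \<xi> n c))
         in \<Phi> (char_idem d n (label_char \<xi> n c) \<otimes>\<^bsub>yh d n\<^esub> yg_perm d n w') =
            mat_unit \<xi> d n (label_char \<xi> n c) (act n ?v (label_char \<xi> n c))
              (smul 1 n (upow (int (plen n w') - int (plen n x))) (yg_perm 1 n x))"
    using Psi v label_char_chars[OF c] unfolding is_Psi_def by blast
  ultimately show ?thesis unfolding Let_def vv x by simp
qed

lemma char_idem_carrier [simp]: "char_idem d n \<chi> \<in> carrier (yh d n)"
  by (simp add: char_idem_cls cls_simps(1))

lemma finsum_sparse:
  assumes "\<psi>0 \<in> B" "finite B" "\<And>\<psi>. \<psi> \<in> B \<Longrightarrow> f \<psi> \<in> carrier (hecke n)"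
    "\<And>\<psi>. \<psi> \<in> B \<Longrightarrow> \<psi> \<noteq> \<psi>0 \<Longrightarrow> f \<psi> = \<zero>\<^bsub>hecke n\<^esub>"
  shows "finsum (hecke n) f B = f \<psi>0"
proof -
  interpret H: ring "hecke n" by (rule ring_yh)
  have "finsum (hecke n) f B = finsum (hecke n) (\<lambda>\<psi>. if \<psi>0 = \<psi> then f \<psi> else \<zero>\<^bsub>hecke n\<^esub>) B"
    using assms by (intro H.finsum_cong') auto
  also have "\<dots> = f \<psi>0" using assms by (intro H.add.finprod_singleton) auto
  finally show ?thesis .
qed

lemma entry_mult_sparse:
  assumes "x \<in> carrier (yh d n)" "y \<in> carrier (yh d n)" "\<chi> \<in> chars_of \<xi> d n \<mu>" "\<chi>' \<in> chars_of \<xi> d n \<mu>"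
    "\<psi>0 \<in> chars_of \<xi> d n \<mu>" "\<And>\<psi>. \<psi> \<in> chars_of \<xi> d n \<mu> \<Longrightarrow> \<psi> \<noteq> \<psi>0 \<Longrightarrow> \<Phi> x \<mu> \<chi> \<psi> = \<zero>\<^bsub>hecke n\<^esub>"
  shows "\<Phi> (x \<otimes>\<^bsub>yh d n\<^esub> y) \<mu> \<chi> \<chi>' = \<Phi> x \<mu> \<chi> \<psi>0 \<otimes>\<^bsub>hecke n\<^esub> \<Phi> y \<mu> \<psi>0 \<chi>'"
proof -
  interpret H: ring "hecke n" by (rule ring_yh)
  show ?thesis
    unfolding entry_mult[OF assms(1-4)]
    using assms by (intro finsum_sparse finite_chars_of) (auto simp: entry_carrier)
qed

lemma entry_idem:
  assumes "\<chi> \<in> chars_of \<xi> d n \<mu>" "\<psi> \<in> chars_of \<xi> d n \<mu>" "\<psi>' \<in> chars_of \<xi> d n \<mu>"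
  shows "\<Phi> (char_idem d n \<chi>) \<mu> \<psi> \<psi>' = (if \<psi> = \<chi> \<and> \<psi>' = \<chi> then \<one>\<^bsub>hecke n\<^esub> else \<zero>\<^bsub>hecke n\<^esub>)"
proof -
  interpret Y: ring "yh d n" by (rule ring_yh)
  interpret H: ring "hecke n" by (rule ring_yh)
  obtain c where c: "c \<in> labellings d n" "\<chi> = label_char \<xi> n c" using chars_ofE[OF assms(1)] by blast
  have "sorter n c permutes {1..n}" using c(1) by (rule sorter_permutes)
  then have "inv_into UNIV (sorter n c) \<circ> id \<circ> sorter n (c \<circ> id) = id"
    using permutes_inv_o(2)[of "sorter n c"] by simp
  then have "\<Phi> (char_idem d n \<chi>) = mat_unit \<xi> d n \<chi> \<chi> (smul 1 n 1 \<one>\<^bsub>hecke n\<^esub>)"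
    using Phi_idem_gen[OF c(1) permutes_id refl] by (simp add: c(2) yg_perm_id)
  then show ?thesis using assms by (simp add: mat_unit_def mk_mats_apply smul_one)
qed

text \<open>As \<open>E\<^sub>\<chi>\<close> is mapped to a diagonal matrix unit, it suffices to compute in \<open>E\<^sub>\<chi> Y\<^bsub>d,n\<^esub>\<close>.\<close>

lemma entry_row:
  assumes "x \<in> carrier (yh d n)" "\<chi> \<in> chars_of \<xi> d n \<mu>" "\<chi>' \<in> chars_of \<xi> d n \<mu>"
  shows "\<Phi> (char_idem d n \<chi> \<otimes>\<^bsub>yh d n\<^esub> x) \<mu> \<chi> \<chi>' = \<Phi> x \<mu> \<chi> \<chi>'"
proof -
  interpret H: ring "hecke n" by (rule ring_yh)
  show ?thesis
    using entry_mult_sparse[of "char_idem d n \<chi>" x \<chi> \<mu> \<chi>' \<chi>] entry_idem[OF assms(2)] assms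
    by (simp add: entry_carrier)
qed

lemma entry_gg:
  assumes i: "1 \<le> i" "i < n" and c: "c \<in> labellings d n" and \<psi>: "\<psi> \<in> chars_of \<xi> d n (cnt n c)"
  shows "\<Phi> (cls d n (gg i)) (cnt n c) (label_char \<xi> n c) \<psi> =
    (if \<psi> = label_char \<xi> n (c \<circ> s_adj i) then hecke_word n c i else \<zero>\<^bsub>hecke n\<^esub>)"
proof -
  note c' = label_char_chars_of[OF c]
  have s: "s_adj i permutes {1..n}" using i by (rule s_adj_permutes)
  have "\<Phi> (cls d n (gg i)) (cnt n c) (label_char \<xi> n c) \<psi>
      = \<Phi> (char_idem d n (label_char \<xi> n c) \<otimes>\<^bsub>yh d n\<^esub> yg_perm d n (s_adj i)) (cnt n c) (label_char \<xi> n c) \<psi>"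
    unfolding yg_perm_adjacent[OF i] yg_def using entry_row[OF _ c' \<psi>] i by (simp add: cls_simps(1))
  also have "\<dots> = (if \<psi> = label_char \<xi> n (c \<circ> s_adj i) then hecke_word n c i else \<zero>\<^bsub>hecke n\<^esub>)"
    unfolding Phi_idem_gen[OF c s refl] using c' \<psi>
    by (simp add: mat_unit_def mk_mats_apply hecke_word_def Let_def)
  finally show ?thesis .
qed

text \<open>By \<open>entry_row\<close> the row of \<open>\<chi>\<close> does not change under left
  multiplication by \<open>E_chi\<close>, which makes \<open>e_i\<close> a scalar. Both the framing
  factors and the correction term of \<open>g_i^{-1}\<close> have the shape
  \<open>a + b e_i\<close>.\<close>

lemma entry_ee:
  assumes i: "1 \<le> i" "i < n" and q: "q \<in> FA n" and \<chi>: "\<chi> \<in> chars_of \<xi> d n \<mu>" "\<chi>' \<in> chars_of \<xi> d n \<mu>"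
  shows "\<Phi> (cls d n ((scal a + scal b * ee d i) * q)) \<mu> \<chi> \<chi>' = smul 1 n (a + b * same \<chi> i) (\<Phi> (cls d n q) \<mu> \<chi> \<chi>')"
proof -
  let ?E = "idem_elt d n \<chi>"
  have E: "yeq d n (?E * ee d i) (scal (same \<chi> i) * ?E)"
    using i char_root[OF chars_of_chars[OF \<chi>(1)]] d by (intro idem_elt_ee) auto
  have "?E * ((scal a + scal b * ee d i) * q) = (scal a * ?E + scal b * (?E * ee d i)) * q"
    by (simp only: mult.assoc[symmetric] distrib_left mult_scal_left scal_commute[of a ?E])
      (simp only: mult.assoc mult_scal_left)
  also have "yeq d n \<dots> ((scal a * ?E + scal b * (scal (same \<chi> i) * ?E)) * q)"
    using E q by (intro yeq_mult_right yeq_add yeq_mult_left) auto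
  also have "(scal a * ?E + scal b * (scal (same \<chi> i) * ?E)) * q = scal (a + b * same \<chi> i) * (?E * q)"
    by (simp only: scal_add scal_mult_left distrib_right mult.assoc)
  finally have "cls d n (?E * ((scal a + scal b * ee d i) * q)) = cls d n (scal (a + b * same \<chi> i) * (?E * q))"
    by (rule yeq_clsD)
  then have "char_idem d n \<chi> \<otimes>\<^bsub>yh d n\<^esub> cls d n ((scal a + scal b * ee d i) * q)
      = smul d n (a + b * same \<chi> i) (char_idem d n \<chi> \<otimes>\<^bsub>yh d n\<^esub> cls d n q)"
    using i q by (simp add: char_idem_cls cls_simps(2)[symmetric] smul_cls)
  moreover have "(scal a + scal b * ee d i) * q \<in> FA n" using i q by simp
  ultimately show ?thesis
    using entry_row[OF cls_simps(1) \<chi>] entry_smul[OF _ \<chi>, of "char_idem d n \<chi> \<otimes>\<^bsub>yh d n\<^esub> cls d n q"] q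
      ring.ring_simprules(5)[OF ring_yh char_idem_carrier cls_simps(1)[OF q]]
    by metis
qed

lemma hecke_word_carrier: "1 \<le> i \<Longrightarrow> i < n \<Longrightarrow> c \<in> labellings d n \<Longrightarrow> hecke_word n c i \<in> carrier (hecke n)"
  using entry_gg[of i c "label_char \<xi> n (c \<circ> s_adj i)"] label_char_chars_of
    labellings_comp[OF _ s_adj_permutes] cnt_comp[OF s_adj_permutes, of i n c]
    entry_carrier[of "cls d n (gg i)" "label_char \<xi> n c" "cnt n c" "label_char \<xi> n (c \<circ> s_adj i)"]
  by (metis FA_gens(1) cls_simps(1))

lemma label_char_adj_eq:
  assumes "1 \<le> i" "i < n" "c i = c (Suc i)" shows "c \<circ> s_adj i = c"
  using assms by (auto simp: fun_eq_iff transpose_def)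

lemma entry_gsgn:
  assumes i: "1 \<le> i" "i < n" and c: "c \<in> labellings d n" and \<psi>: "\<psi> \<in> chars_of \<xi> d n (cnt n c)"
  shows "\<Phi> (cls d n (gsgn d i b)) (cnt n c) (label_char \<xi> n c) \<psi> =
    (if \<psi> = label_char \<xi> n (c \<circ> s_adj i) then hecke_entry n c i b else \<zero>\<^bsub>hecke n\<^esub>)"
proof (cases b)
  case True
  then show ?thesis using entry_gg[OF assms] by (simp add: gsgn_def hecke_entry_def)
next
  case False
  interpret Y: ring "yh d n" by (rule ring_yh)
  interpret H: ring "hecke n" by (rule ring_yh)
  let ?\<chi> = "label_char \<xi> n c" and ?\<mu> = "cnt n c"
  note c' = label_char_chars_of[OF c]
  have F: "gg i \<in> FA n" "ee d i \<in> FA n" using i by auto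
  have "gginv d i = scal (upow (- 2)) * (gg i + (scal 0 + scal (- Lv) * ee d i) * 1)"
    by (simp add: gginv_def scal_0 scal_uminus)
  then have "cls d n (gginv d i) = smul d n (upow (- 2)) (cls d n (gg i) \<oplus>\<^bsub>yh d n\<^esub> cls d n ((scal 0 + scal (- Lv) * ee d i) * 1))"
    using F by (simp only: smul_cls cls_simps(3)[symmetric] FA_intros)
  then have "\<Phi> (cls d n (gginv d i)) ?\<mu> ?\<chi> \<psi> = smul 1 n (upow (- 2))
      (\<Phi> (cls d n (gg i)) ?\<mu> ?\<chi> \<psi> \<oplus>\<^bsub>hecke n\<^esub> \<Phi> (cls d n ((scal 0 + scal (- Lv) * ee d i) * 1)) ?\<mu> ?\<chi> \<psi>)"
    using F c' \<psi> by (simp only: entry_smul entry_add cls_simps(1) FA_intros Y.add.m_closed)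
  also have "\<Phi> (cls d n ((scal 0 + scal (- Lv) * ee d i) * 1)) ?\<mu> ?\<chi> \<psi>
      = smul 1 n (0 + - Lv * same ?\<chi> i) (\<Phi> (cls d n 1) ?\<mu> ?\<chi> \<psi>)"
    by (rule entry_ee[OF i _ c' \<psi>]) simp
  also have "\<dots> = smul 1 n (- (Lv * same c i)) (if ?\<chi> = \<psi> then \<one>\<^bsub>hecke n\<^esub> else \<zero>\<^bsub>hecke n\<^esub>)"
    using entry_one[OF c' \<psi>] by (simp add: cls_simps(4) same_label_char[OF c i])
  \<comment> \<open>The correction \<open>- v e_i\<close> lies on the diagonal, whereas
    \<open>g_i\<close> has its entry in the column of \<open>c \<circ> s_adj i\<close>. The
    correction is non-zero only if \<open>c i = c (Suc i)\<close>, and then the two columns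
    coincide.\<close>
  also have "\<dots> = (if \<psi> = label_char \<xi> n (c \<circ> s_adj i) then \<ominus>\<^bsub>hecke n\<^esub> smul 1 n (Lv * same c i) \<one>\<^bsub>hecke n\<^esub> else \<zero>\<^bsub>hecke n\<^esub>)"
  proof (cases "c i = c (Suc i)")
    case True
    have "smul 1 n (- r) \<one>\<^bsub>hecke n\<^esub> = \<ominus>\<^bsub>hecke n\<^esub> smul 1 n r \<one>\<^bsub>hecke n\<^esub>" for r
      using cls_uminus[of "scal r" n 1] by (simp add: cls_simps(4)[symmetric] smul_cls scal_uminus)
    then show ?thesis using label_char_adj_eq[OF i True] by (auto simp: smul_zero)
  next
    case False
    then show ?thesis by (simp add: same_def smul_zero smul_zero_left)
  qed
  finally show ?thesis
    using False entry_gg[OF assms] by (simp add: gsgn_def hecke_entry_def a_minus_def smul_zero)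
qed

lemma hecke_entry_carrier:
  assumes "1 \<le> i" "i < n" "c \<in> labellings d n" shows "hecke_entry n c i b \<in> carrier (hecke n)"
proof -
  interpret H: ring "hecke n" by (rule ring_yh)
  show ?thesis
    using hecke_word_carrier[OF assms] by (simp add: hecke_entry_def smul_closed)
qed

text \<open>A row of the matrix of a generator has at most one non-zero entry, so the sum in the
  matrix product has one term, taken from the row of \<open>c \<circ> s_adj i\<close>.\<close>

lemma entry_step:
  assumes i: "1 \<le> i" "i < n" and c: "c \<in> labellings d n" and \<psi>: "\<psi> \<in> chars_of \<xi> d n (cnt n c)"
    and q: "q \<in> FA n"
  shows "\<Phi> (cls d n (gsgn d i b * q)) (cnt n c) (label_char \<xi> n c) \<psi> =
      hecke_entry n c i b \<otimes>\<^bsub>hecke n\<^esub> \<Phi> (cls d n q) (cnt n c) (label_char \<xi> n (c \<circ> s_adj i)) \<psi>"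
    "\<Phi> (cls d n (framing d i b' * gsgn d i b * q)) (cnt n c) (label_char \<xi> n c) \<psi> =
      smul 1 n (weight c i b') (\<Phi> (cls d n (gsgn d i b * q)) (cnt n c) (label_char \<xi> n c) \<psi>)"
proof -
  interpret H: ring "hecke n" by (rule ring_yh)
  note s = s_adj_permutes[OF i]
  have c': "label_char \<xi> n (c \<circ> s_adj i) \<in> chars_of \<xi> d n (cnt n c)"
    using label_char_chars_of[OF labellings_comp[OF c s]] cnt_comp[OF s, of c] by simp
  have g: "cls d n (gsgn d i b) \<in> carrier (yh d n)" using i by (simp add: cls_simps(1))
  have "\<Phi> (cls d n (gsgn d i b) \<otimes>\<^bsub>yh d n\<^esub> cls d n q) (cnt n c) (label_char \<xi> n c) \<psi>
      = \<Phi> (cls d n (gsgn d i b)) (cnt n c) (label_char \<xi> n c) (label_char \<xi> n (c \<circ> s_adj i))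
        \<otimes>\<^bsub>hecke n\<^esub> \<Phi> (cls d n q) (cnt n c) (label_char \<xi> n (c \<circ> s_adj i)) \<psi>"
    using entry_gsgn[OF i c] by (intro entry_mult_sparse[OF g cls_simps(1)[OF q] label_char_chars_of[OF c] \<psi> c']) simp
  then show "\<Phi> (cls d n (gsgn d i b * q)) (cnt n c) (label_char \<xi> n c) \<psi> =
      hecke_entry n c i b \<otimes>\<^bsub>hecke n\<^esub> \<Phi> (cls d n q) (cnt n c) (label_char \<xi> n (c \<circ> s_adj i)) \<psi>"
    using i q entry_gsgn[OF i c c', of b] by (simp add: cls_simps(2))
  have "gsgn d i b * q \<in> FA n" using i q by simp
  from entry_ee[OF i this label_char_chars_of[OF c] \<psi>, of "gam b'" "1 - gam b'"]
  show "\<Phi> (cls d n (framing d i b' * gsgn d i b * q)) (cnt n c) (label_char \<xi> n c) \<psi> =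
      smul 1 n (weight c i b') (\<Phi> (cls d n (gsgn d i b * q)) (cnt n c) (label_char \<xi> n c) \<psi>)"
    by (simp add: framing_def weight_def mult.assoc same_label_char[OF c i])
qed

end

section \<open>Braid words\<close>

definition braid_eval :: "('m, 'k) monoid_scheme \<Rightarrow> (nat \<Rightarrow> 'm) \<Rightarrow> braid_word \<Rightarrow> 'm" where
  "braid_eval M f w = foldr (\<lambda>(i, b) y. (if b then f i else inv\<^bsub>M\<^esub> (f i)) \<otimes>\<^bsub>M\<^esub> y) w \<one>\<^bsub>M\<^esub>"

lemma braid_eval_simps [simp]:
  "braid_eval M f [] = \<one>\<^bsub>M\<^esub>"
  "braid_eval M f ((i, b) # w) = (if b then f i else inv\<^bsub>M\<^esub> (f i)) \<otimes>\<^bsub>M\<^esub> braid_eval M f w"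
  by (simp_all add: braid_eval_def)

lemma braid_words_simps [simp]:
  "[] \<in> braid_words n" "(i, b) # w \<in> braid_words n \<longleftrightarrow> 1 \<le> i \<and> i < n \<and> w \<in> braid_words n"
  "v @ w \<in> braid_words n \<longleftrightarrow> v \<in> braid_words n \<and> w \<in> braid_words n"
  by (auto simp: braid_words_def)

lemma braid_words_induct [consumes 1, case_names Nil Cons]:
  assumes "w \<in> braid_words n" "P []"
    "\<And>i b w. 1 \<le> i \<Longrightarrow> i < n \<Longrightarrow> w \<in> braid_words n \<Longrightarrow> P w \<Longrightarrow> P ((i, b) # w)"
  shows "P w"
  using assms(1) by (induction w) (auto intro: assms(2,3))

lemma braid_words_mono: "w \<in> braid_words n \<Longrightarrow> n \<le> m \<Longrightarrow> w \<in> braid_words m"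
  by (induction rule: braid_words_induct) auto

lemma braid_rels_words: "(l, r) \<in> braid_rels n \<Longrightarrow> l \<in> braid_words n \<and> r \<in> braid_words n"
  unfolding braid_rels_def by auto

text \<open>The relations make \<open>braid_eval\<close> constant on classes of words, which gives
  the \<open>the_elem\<close> in \<open>braid_map\<close> its value. The targets are braid groups,
  symmetric groups, Hecke algebras and Yokonuma-Hecke algebras.\<close>

locale braid_rep = monoid M for M :: "('m, 'k) monoid_scheme" (structure) +
  fixes n :: nat and f :: "nat \<Rightarrow> 'm"
  assumes units: "\<And>i. 1 \<le> i \<Longrightarrow> i < n \<Longrightarrow> f i \<in> Units M"
    and far: "\<And>i j. 1 \<le> i \<Longrightarrow> i < n \<Longrightarrow> 1 \<le> j \<Longrightarrow> j < n \<Longrightarrow> i + 1 < j \<or> j + 1 < i \<Longrightarrow> f i \<otimes> f j = f j \<otimes> f i"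
    and braid: "\<And>i. 1 \<le> i \<Longrightarrow> Suc i < n \<Longrightarrow> f i \<otimes> (f (Suc i) \<otimes> f i) = f (Suc i) \<otimes> (f i \<otimes> f (Suc i))"
begin

lemma f_carrier: "1 \<le> i \<Longrightarrow> i < n \<Longrightarrow> f i \<in> carrier M"
  using units by blast

lemma eval_carrier: "w \<in> braid_words n \<Longrightarrow> braid_eval M f w \<in> carrier M"
  by (induction rule: braid_words_induct) (auto simp: units f_carrier)

lemma eval_append:
  "v \<in> braid_words n \<Longrightarrow> w \<in> braid_words n \<Longrightarrow> braid_eval M f (v @ w) = braid_eval M f v \<otimes> braid_eval M f w"
  by (induction rule: braid_words_induct) (auto simp: units f_carrier eval_carrier m_assoc)

lemma eval_rels:
  assumes "(l, r) \<in> braid_rels n" shows "braid_eval M f l = braid_eval M f r"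
proof -
  consider (I) i b where "l = [(i, b), (i, \<not> b)]" "r = []" "1 \<le> i" "i < n"
    | (F) i j where "l = [(i, True), (j, True)]" "r = [(j, True), (i, True)]"
        "1 \<le> i" "i < n" "1 \<le> j" "j < n" "i + 1 < j \<or> j + 1 < i"
    | (B) i where "l = [(i, True), (Suc i, True), (i, True)]" "r = [(Suc i, True), (i, True), (Suc i, True)]"
        "1 \<le> i" "Suc i < n"
    using assms unfolding braid_rels_def by auto
  then show ?thesis
  proof cases
    case I
    then show ?thesis using units[of i] by (cases b) (auto simp: f_carrier)
  next
    case F
    then show ?thesis using far[of i j] by (auto simp: f_carrier)
  next
    case B
    then show ?thesis using braid[of i] by (auto simp: f_carrier)
  qed
qed

lemma eval_step: "(v, w) \<in> braid_step n \<Longrightarrow> braid_eval M f v = braid_eval M f w"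
proof -
  assume "(v, w) \<in> braid_step n"
  then obtain a b l r where v: "v = a @ l @ b" and w: "w = a @ r @ b"
      and ab: "a \<in> braid_words n" "b \<in> braid_words n" and lr: "(l, r) \<in> braid_rels n"
    unfolding braid_step_def by blast
  have "l \<in> braid_words n" "r \<in> braid_words n" using braid_rels_words[OF lr] by auto
  then show ?thesis unfolding v w using ab eval_rels[OF lr] by (simp add: eval_append)
qed

lemma eval_equiv: "(v, w) \<in> braid_equiv n \<Longrightarrow> braid_eval M f v = braid_eval M f w"
  unfolding braid_equiv_def by (induction rule: rtrancl_induct) (auto dest: eval_step)

lemma braid_map_eval: "braid_map M f (braid_equiv n `` {w}) = braid_eval M f w"
proof -
  have "(w, w) \<in> braid_equiv n" by (simp add: braid_equiv_def)
  then have ne: "braid_equiv n `` {w} \<noteq> {}" by blast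
  have "braid_eval M f ` (braid_equiv n `` {w}) = (\<lambda>_. braid_eval M f w) ` (braid_equiv n `` {w})"
    by (intro image_cong refl) (simp add: eval_equiv[symmetric])
  also have "\<dots> = {braid_eval M f w}" using ne by (simp add: image_constant_conv)
  finally have "braid_eval M f ` (braid_equiv n `` {w}) = {braid_eval M f w}" .
  then show ?thesis unfolding braid_map_def braid_eval_def[abs_def] by simp
qed

end

section \<open>The braid group\<close>

abbreviation bcls :: "nat \<Rightarrow> braid_word \<Rightarrow> braid" where
  "bcls n w \<equiv> braid_equiv n `` {w}"

lemma braid_equiv_refl: "(w, w) \<in> braid_equiv n"
  by (simp add: braid_equiv_def)

lemma braid_equiv_sym: "(v, w) \<in> braid_equiv n \<Longrightarrow> (w, v) \<in> braid_equiv n"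
  unfolding braid_equiv_def by (metis converse_Un converse_converse rtrancl_converseI sup_commute)

lemma braid_equiv_trans: "(u, v) \<in> braid_equiv n \<Longrightarrow> (v, w) \<in> braid_equiv n \<Longrightarrow> (u, w) \<in> braid_equiv n"
  unfolding braid_equiv_def by (rule rtrancl_trans)

lemma bcls_eqI: "(v, w) \<in> braid_equiv n \<Longrightarrow> bcls n v = bcls n w"
  using braid_equiv_sym braid_equiv_trans by blast

lemma braid_step_words: "(v, w) \<in> braid_step n \<Longrightarrow> v \<in> braid_words n \<and> w \<in> braid_words n"
  unfolding braid_step_def using braid_rels_words by auto

lemma braid_equiv_words: "(v, w) \<in> braid_equiv n \<Longrightarrow> v \<in> braid_words n \<Longrightarrow> w \<in> braid_words n"
  unfolding braid_equiv_def by (induction rule: rtrancl_induct) (auto dest: braid_step_words)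

lemma braid_step_context:
  assumes "(v, w) \<in> braid_step n" "x \<in> braid_words n" "y \<in> braid_words n"
  shows "(x @ v @ y, x @ w @ y) \<in> braid_step n"
proof -
  obtain a b l r where "v = a @ l @ b" "w = a @ r @ b" "a \<in> braid_words n" "b \<in> braid_words n" "(l, r) \<in> braid_rels n"
    using assms(1) unfolding braid_step_def by blast
  then have "x @ v @ y = (x @ a) @ l @ (b @ y)" "x @ w @ y = (x @ a) @ r @ (b @ y)"
    "x @ a \<in> braid_words n" "b @ y \<in> braid_words n" "(l, r) \<in> braid_rels n"
    using assms by auto
  then show ?thesis unfolding braid_step_def by blast
qed

lemma braid_equiv_context:
  assumes "(v, w) \<in> braid_equiv n" "x \<in> braid_words n" "y \<in> braid_words n"
  shows "(x @ v @ y, x @ w @ y) \<in> braid_equiv n"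
  using assms(1) unfolding braid_equiv_def
proof (induction rule: rtrancl_induct)
  case (step u w)
  then have "(x @ u @ y, x @ w @ y) \<in> braid_step n \<union> (braid_step n)\<inverse>"
    using braid_step_context assms by blast
  with step show ?case by (meson rtrancl.rtrancl_into_rtrancl)
qed simp

lemma bcls_mult:
  assumes v: "v \<in> braid_words n" and w: "w \<in> braid_words n"
  shows "bcls n v \<otimes>\<^bsub>braid_group n\<^esub> bcls n w = bcls n (v @ w)"
proof -
  have congr: "(v @ w, x @ y) \<in> braid_equiv n" if x: "(v, x) \<in> braid_equiv n" and y: "(w, y) \<in> braid_equiv n" for x y
  proof -
    have "(v @ w, x @ w) \<in> braid_equiv n" using braid_equiv_context[OF x, of "[]" w] w by simp
    moreover have "(x @ w, x @ y) \<in> braid_equiv n"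
      using braid_equiv_context[OF y, of x "[]"] braid_equiv_words[OF x v] by simp
    ultimately show ?thesis by (rule braid_equiv_trans)
  qed
  have "braid_equiv n `` {x @ y | x y. x \<in> bcls n v \<and> y \<in> bcls n w} = bcls n (v @ w)"
  proof (intro subset_antisym subsetI)
    fix u assume "u \<in> braid_equiv n `` {x @ y | x y. x \<in> bcls n v \<and> y \<in> bcls n w}"
    then obtain x y where "(v, x) \<in> braid_equiv n" "(w, y) \<in> braid_equiv n" "(x @ y, u) \<in> braid_equiv n" by auto
    then have "(v @ w, u) \<in> braid_equiv n" using congr braid_equiv_trans by blast
    then show "u \<in> bcls n (v @ w)" by simp
  next
    fix u assume "u \<in> bcls n (v @ w)"
    moreover have "v \<in> bcls n v" "w \<in> bcls n w" using braid_equiv_refl by auto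
    ultimately show "u \<in> braid_equiv n `` {x @ y | x y. x \<in> bcls n v \<and> y \<in> bcls n w}" by blast
  qed
  then show ?thesis by (simp add: braid_group_def)
qed

lemma braid_group_carrier: "carrier (braid_group n) = bcls n ` braid_words n"
  by (auto simp: braid_group_def quotient_def)

lemma bcls_carrier: "w \<in> braid_words n \<Longrightarrow> bcls n w \<in> carrier (braid_group n)"
  by (simp add: braid_group_carrier)

lemma bcls_one: "\<one>\<^bsub>braid_group n\<^esub> = bcls n []"
  by (simp add: braid_group_def)

lemma monoid_braid_group: "monoid (braid_group n)"
  by (rule monoidI) (auto simp: braid_group_carrier bcls_one bcls_mult)

lemma bcls_rel: "(l, r) \<in> braid_rels n \<Longrightarrow> bcls n l = bcls n r"
proof -
  assume "(l, r) \<in> braid_rels n"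
  then have "([] @ l @ [], [] @ r @ []) \<in> braid_step n" unfolding braid_step_def using braid_words_simps(1) by blast
  then have "(l, r) \<in> braid_step n" by simp
  then have "(l, r) \<in> braid_equiv n" unfolding braid_equiv_def by blast
  then show ?thesis by (rule bcls_eqI)
qed

lemma sig_bcls: "sig n i = bcls n [(i, True)]"
  by (simp add: sig_def)

lemma sig_inverse:
  assumes "1 \<le> i" "i < n"
  shows "sig n i \<in> Units (braid_group n)" "inv\<^bsub>braid_group n\<^esub> sig n i = bcls n [(i, False)]"
proof -
  interpret monoid "braid_group n" by (rule monoid_braid_group)
  have "([(i, b), (i, \<not> b)], []) \<in> braid_rels n" for b using assms unfolding braid_rels_def by auto
  from bcls_rel[OF this[of True]] bcls_rel[OF this[of False]]
  have e: "sig n i \<otimes>\<^bsub>braid_group n\<^esub> bcls n [(i, False)] = \<one>\<^bsub>braid_group n\<^esub>"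
    "bcls n [(i, False)] \<otimes>\<^bsub>braid_group n\<^esub> sig n i = \<one>\<^bsub>braid_group n\<^esub>"
    using assms by (simp_all add: sig_bcls bcls_mult bcls_one)
  have c: "sig n i \<in> carrier (braid_group n)" "bcls n [(i, False)] \<in> carrier (braid_group n)"
    using assms by (auto simp: sig_bcls intro!: bcls_carrier)
  show "sig n i \<in> Units (braid_group n)" using e c by (auto simp: Units_def)
  show "inv\<^bsub>braid_group n\<^esub> sig n i = bcls n [(i, False)]" using inv_char[OF c e] .
qed

text \<open>Stated for \<open>m \<le> n\<close> to cover the inclusion of a braid group in the next
  one, which occurs in the stabilisation moves.\<close>

lemma braid_rep_sig: "m \<le> n \<Longrightarrow> braid_rep (braid_group n) m (sig n)"
proof -
  assume m: "m \<le> n"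
  interpret monoid "braid_group n" by (rule monoid_braid_group)
  show ?thesis
  proof unfold_locales
    show "sig n i \<in> Units (braid_group n)" if "1 \<le> i" "i < m" for i using sig_inverse that m by simp
    fix i j assume "1 \<le> i" "i < m" "1 \<le> j" "j < m" "i + 1 < j \<or> j + 1 < i"
    then have "([(i, True), (j, True)], [(j, True), (i, True)]) \<in> braid_rels n" and ij: "i < n" "j < n"
      using m unfolding braid_rels_def by auto
    from bcls_rel[OF this(1)] ij \<open>1 \<le> i\<close> \<open>1 \<le> j\<close>
    show "sig n i \<otimes>\<^bsub>braid_group n\<^esub> sig n j = sig n j \<otimes>\<^bsub>braid_group n\<^esub> sig n i"
      by (simp add: sig_bcls bcls_mult)
  next
    fix i assume "1 \<le> i" "Suc i < m"
    then have "([(i, True), (Suc i, True), (i, True)], [(Suc i, True), (i, True), (Suc i, True)]) \<in> braid_rels n"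
      and i: "Suc i < n" using m unfolding braid_rels_def by auto
    from bcls_rel[OF this(1)] i \<open>1 \<le> i\<close>
    show "sig n i \<otimes>\<^bsub>braid_group n\<^esub> (sig n (Suc i) \<otimes>\<^bsub>braid_group n\<^esub> sig n i) =
        sig n (Suc i) \<otimes>\<^bsub>braid_group n\<^esub> (sig n i \<otimes>\<^bsub>braid_group n\<^esub> sig n (Suc i))"
      by (simp add: sig_bcls bcls_mult)
  qed
qed

lemma braid_map_sig:
  assumes "w \<in> braid_words m" "m \<le> n" shows "braid_map (braid_group n) (sig n) (bcls m w) = bcls n w"
proof -
  interpret braid_rep "braid_group n" m "sig n" using assms(2) by (rule braid_rep_sig)
  have "braid_eval (braid_group n) (sig n) w = bcls n w"
    using assms(1)
  proof (induction rule: braid_words_induct)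
    case (Cons i b w)
    have "w \<in> braid_words n" using Cons assms(2) by (auto intro: braid_words_mono)
    then show ?case using Cons assms(2) sig_inverse[of i n] by (cases b) (auto simp: bcls_mult sig_bcls)
  qed (simp add: bcls_one)
  then show ?thesis by (simp add: braid_map_eval)
qed

lemma braid_rep_sym: "braid_rep (sym_group n) n s_adj"
proof -
  interpret group "sym_group n" by (rule sym_group_is_group)
  show ?thesis
  proof unfold_locales
    show "s_adj i \<in> Units (sym_group n)" if "1 \<le> i" "i < n" for i
      using s_adj_permutes[OF that] by (simp add: sym_group_carrier)
    show "s_adj i \<otimes>\<^bsub>sym_group n\<^esub> s_adj j = s_adj j \<otimes>\<^bsub>sym_group n\<^esub> s_adj i"
      if "i + 1 < j \<or> j + 1 < i" for i j
      using that by (auto simp: sym_group_mult fun_eq_iff transpose_def)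
    show "s_adj i \<otimes>\<^bsub>sym_group n\<^esub> (s_adj (Suc i) \<otimes>\<^bsub>sym_group n\<^esub> s_adj i) =
        s_adj (Suc i) \<otimes>\<^bsub>sym_group n\<^esub> (s_adj i \<otimes>\<^bsub>sym_group n\<^esub> s_adj (Suc i))" for i
      by (auto simp: sym_group_mult fun_eq_iff transpose_def)
  qed
qed

definition wperm :: "braid_word \<Rightarrow> nat \<Rightarrow> nat" where
  "wperm w = perm_word (map fst w)"

lemma wperm_simps [simp]: "wperm [] = id" "wperm ((i, b) # w) = s_adj i \<circ> wperm w"
  by (simp_all add: wperm_def)

lemma wperm_permutes: "w \<in> braid_words n \<Longrightarrow> wperm w permutes {1..n}"
proof (induction rule: braid_words_induct)
  case Nil
  show ?case unfolding wperm_simps by (rule permutes_id)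
next
  case (Cons i b w)
  show ?case unfolding wperm_simps by (rule permutes_compose[OF Cons(4) s_adj_permutes[OF Cons(1,2)]])
qed

lemma braid_perm_wperm:
  assumes "w \<in> braid_words n" shows "braid_perm n (bcls n w) = wperm w"
proof -
  interpret braid_rep "sym_group n" n s_adj by (rule braid_rep_sym)
  interpret G: group "sym_group n" by (rule sym_group_is_group)
  have "braid_eval (sym_group n) s_adj w = wperm w"
    using assms
  proof (induction rule: braid_words_induct)
    case (Cons i b w)
    have "inv\<^bsub>sym_group n\<^esub> (s_adj i) = s_adj i"
      using s_adj_permutes[OF Cons(1,2)] by (intro G.inv_equality) (auto simp: sym_group_carrier sym_group_mult sym_group_one)
    then show ?case using Cons by (simp add: sym_group_mult)
  qed (simp add: sym_group_one)
  then show ?thesis by (simp add: braid_perm_def braid_map_eval)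
qed

section \<open>Braids in Yokonuma--Hecke algebras\<close>

definition gword :: "nat \<Rightarrow> braid_word \<Rightarrow> free_alg" where
  "gword d w = foldr (\<lambda>(i, b) y. gsgn d i b * y) w 1"

definition dword :: "nat \<Rightarrow> braid_word \<Rightarrow> free_alg" where
  "dword d w = foldr (\<lambda>(i, b) y. framing d i b * gsgn d i b * y) w 1"

lemma gword_simps [simp]: "gword d [] = 1" "gword d ((i, b) # w) = gsgn d i b * gword d w"
  and dword_simps [simp]: "dword d [] = 1" "dword d ((i, b) # w) = framing d i b * gsgn d i b * dword d w"
  by (simp_all add: gword_def dword_def)

lemma gword_append: "gword d (v @ w) = gword d v * gword d w"
  by (induction v) (auto simp: mult.assoc)

lemma gword_FA: "w \<in> braid_words n \<Longrightarrow> gword d w \<in> FA n"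
  and dword_FA: "w \<in> braid_words n \<Longrightarrow> dword d w \<in> FA n"
  by (induction rule: braid_words_induct) auto

text \<open>The entry at \<open>(\<chi>, \<chi>')\<close> of the image of a braid word, where \<open>\<chi>\<close> is labelled by \<open>c\<close> and \<open>\<chi>'\<close> is
  the only character in whose column row \<open>\<chi>\<close> can be non-zero.\<close>

fun path_entry :: "nat \<Rightarrow> braid_word \<Rightarrow> (nat \<Rightarrow> nat) \<Rightarrow> free_alg set" where
  "path_entry n [] c = \<one>\<^bsub>hecke n\<^esub>"
| "path_entry n ((i, b) # w) c =
    smul 1 n (weight c i b) (hecke_entry n c i b \<otimes>\<^bsub>hecke n\<^esub> path_entry n w (c \<circ> s_adj i))"

lemma hecke_entry_strict_mono:
  assumes \<sigma>: "strict_mono_on {1..k} \<sigma>" and c: "c \<in> labellings k n" and i: "1 \<le> i" "i < n"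
  shows "hecke_entry n (\<sigma> \<circ> c) i b = hecke_entry n c i b" "weight (\<sigma> \<circ> c) i b = weight c i b"
proof -
  have "c i \<in> {1..k}" "c (Suc i) \<in> {1..k}" using c i by (auto simp: labellings_def)
  then have "same (\<sigma> \<circ> c) i = same c i"
    using strict_mono_on_eqD[OF \<sigma>, of "c i" "c (Suc i)"] by (auto simp: same_def)
  moreover have "sorter n (\<sigma> \<circ> c) = sorter n c" "sorter n (\<sigma> \<circ> c \<circ> s_adj i) = sorter n (c \<circ> s_adj i)"
    using sorter_strict_mono[OF \<sigma>] c labellings_comp[OF c s_adj_permutes[OF i]] by (simp_all add: comp_assoc)
  ultimately show "hecke_entry n (\<sigma> \<circ> c) i b = hecke_entry n c i b" "weight (\<sigma> \<circ> c) i b = weight c i b"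
    by (simp_all add: hecke_entry_def hecke_word_def weight_def)
qed

lemma path_entry_strict_mono:
  assumes \<sigma>: "strict_mono_on {1..k} \<sigma>" and w: "w \<in> braid_words n" and c: "c \<in> labellings k n"
  shows "path_entry n w (\<sigma> \<circ> c) = path_entry n w c"
  using w c
proof (induction arbitrary: c rule: braid_words_induct)
  case (Cons i b w)
  have "path_entry n w (\<sigma> \<circ> (c \<circ> s_adj i)) = path_entry n w (c \<circ> s_adj i)"
    using Cons labellings_comp[OF _ s_adj_permutes] by blast
  then show ?case
    unfolding path_entry.simps hecke_entry_strict_mono[OF \<sigma> Cons(5,1,2)] comp_assoc by (rule arg_cong)
qed simp

context yh_iso
begin

text \<open>The braid relations of the elements \<open>(\<gamma> + (1 - \<gamma>) e\<^sub>i) g\<^sub>i\<close> follow from those of the \<open>g\<^sub>i\<close>, since both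
  sides have the same multipliers \<open>f\<close>.\<close>

definition weq :: "free_alg \<Rightarrow> free_alg \<Rightarrow> ((nat \<Rightarrow> nat) \<Rightarrow> laurent) \<Rightarrow> bool" where
  "weq q q' f \<longleftrightarrow> q \<in> FA n \<and> q' \<in> FA n \<and> (\<forall>c \<in> labellings d n. \<forall>\<psi> \<in> chars_of \<xi> d n (cnt n c).
    \<Phi> (cls d n q) (cnt n c) (label_char \<xi> n c) \<psi> = smul 1 n (f c) (\<Phi> (cls d n q') (cnt n c) (label_char \<xi> n c) \<psi>))"

lemma weq_one: "weq 1 1 (\<lambda>c. 1)"
  unfolding weq_def using entry_carrier[OF cls_simps(1) label_char_chars_of] by (auto simp: smul_one)

text \<open>After a generator on the left, the row of \<open>c\<close> is computed from the row of
  \<open>c \<circ> s_adj i\<close> of the remaining product; the multiplier of the latter is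
  therefore evaluated at the moved labelling.\<close>

lemma weq_step:
  assumes i: "1 \<le> i" "i < n" and q: "weq q q' f"
  shows "weq (framing d i b * gsgn d i b * q) (gsgn d i b * q') (\<lambda>c. weight c i b * f (c \<circ> s_adj i))"
  unfolding weq_def
proof (intro conjI ballI)
  have F: "q \<in> FA n" "q' \<in> FA n" using q by (auto simp: weq_def)
  then show "framing d i b * gsgn d i b * q \<in> FA n" "gsgn d i b * q' \<in> FA n" using i by auto
  fix c \<psi> assume c: "c \<in> labellings d n" and \<psi>: "\<psi> \<in> chars_of \<xi> d n (cnt n c)"
  note s = s_adj_permutes[OF i]
  have c': "c \<circ> s_adj i \<in> labellings d n" "cnt n (c \<circ> s_adj i) = cnt n c"
    using labellings_comp[OF c s] cnt_comp[OF s] by auto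
  have E: "\<Phi> (cls d n q') (cnt n c) (label_char \<xi> n (c \<circ> s_adj i)) \<psi> \<in> carrier (hecke n)"
    using entry_carrier[OF cls_simps(1)[OF F(2)] _ \<psi>] label_char_chars_of[OF c'(1)] c'(2) by simp
  have "\<Phi> (cls d n q) (cnt n c) (label_char \<xi> n (c \<circ> s_adj i)) \<psi>
      = smul 1 n (f (c \<circ> s_adj i)) (\<Phi> (cls d n q') (cnt n c) (label_char \<xi> n (c \<circ> s_adj i)) \<psi>)"
    using q c' \<psi> unfolding weq_def by metis
  then show "\<Phi> (cls d n (framing d i b * gsgn d i b * q)) (cnt n c) (label_char \<xi> n c) \<psi>
      = smul 1 n (weight c i b * f (c \<circ> s_adj i)) (\<Phi> (cls d n (gsgn d i b * q')) (cnt n c) (label_char \<xi> n c) \<psi>)"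
    unfolding entry_step(2)[OF i c \<psi> F(1)] entry_step(1)[OF i c \<psi> F(1)] entry_step(1)[OF i c \<psi> F(2)]
    using E hecke_entry_carrier[OF i c] ring.ring_simprules(5)[OF ring_yh]
    by (simp add: smul_mult_right smul_smul)
qed

lemma weq_yeq:
  assumes "weq q1 p1 f1" "weq q2 p2 f2" "yeq d n p1 p2" "\<And>c. f1 c = f2 c"
  shows "yeq d n q1 q2"
proof (rule yeqI)
  show F: "q1 \<in> FA n" "q2 \<in> FA n" using assms by (auto simp: weq_def)
  show "cls d n q1 = cls d n q2"
  proof (rule Phi_eqI)
    fix \<mu> \<chi> \<chi>' assume \<chi>: "\<chi> \<in> chars_of \<xi> d n \<mu>" "\<chi>' \<in> chars_of \<xi> d n \<mu>"
    obtain c where c: "c \<in> labellings d n" "\<chi> = label_char \<xi> n c" "\<mu> = cnt n c" using chars_ofE[OF \<chi>(1)] by blast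
    then show "\<Phi> (cls d n q1) \<mu> \<chi> \<chi>' = \<Phi> (cls d n q2) \<mu> \<chi> \<chi>'"
      using assms(1,2,4) \<chi> yeq_clsD[OF assms(3)] by (simp add: weq_def)
  qed (use F in \<open>auto intro: cls_simps(1)\<close>)
qed

section \<open>Inverses and braid relations of the framed generators\<close>

abbreviation "dgen i b \<equiv> framing d i b * gsgn d i b"

lemma dgen_FA: "1 \<le> i \<Longrightarrow> i < n \<Longrightarrow> dgen i b \<in> FA n"
  by simp

lemma same_comp: "same (c \<circ> s_adj i) i = same c i"
  by (auto simp: same_def)

lemma dgen_inverse:
  assumes i: "1 \<le> i" "i < n" shows "yeq d n (dgen i b * dgen i (\<not> b)) 1"
proof -
  have "yeq d n (dgen i b * (dgen i (\<not> b) * 1)) 1"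
  proof (rule weq_yeq[OF weq_step[OF i weq_step[OF i weq_one]] weq_one])
    show "yeq d n (gsgn d i b * (gsgn d i (\<not> b) * 1)) 1"
      using yeq_gg_gginv[OF d i] by (cases b) (simp_all add: gsgn_def)
    have "weight (c \<circ> s_adj i) i (\<not> b) = weight c i (\<not> b)" for c :: "nat \<Rightarrow> nat" by (simp add: weight_def same_comp)
    then show "weight c i b * (weight (c \<circ> s_adj i) i (\<not> b) * 1) = 1" for c :: "nat \<Rightarrow> nat" by (simp add: weight_inverse)
  qed
  then show ?thesis by simp
qed

lemma dgen_far:
  assumes i: "1 \<le> i" "i < n" and j: "1 \<le> j" "j < n" and ij: "i + 1 < j \<or> j + 1 < i"
  shows "yeq d n (dgen i True * dgen j True) (dgen j True * dgen i True)"
proof -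
  have "yeq d n (dgen i True * (dgen j True * 1)) (dgen j True * (dgen i True * 1))"
  proof (rule weq_yeq[OF weq_step[OF i weq_step[OF j weq_one]] weq_step[OF j weq_step[OF i weq_one]]])
    show "yeq d n (gsgn d i True * (gsgn d j True * 1)) (gsgn d j True * (gsgn d i True * 1))"
      using yeq_far[OF i j ij] by (simp add: gsgn_def)
    have "same (c \<circ> s_adj i) j = same c j" "same (c \<circ> s_adj j) i = same c i" for c :: "nat \<Rightarrow> nat"
      using ij by (auto simp: same_def transpose_def)
    then show "weight c i True * (weight (c \<circ> s_adj i) j True * 1) = weight c j True * (weight (c \<circ> s_adj j) i True * 1)" for c :: "nat \<Rightarrow> nat"
      by (simp add: weight_def ac_simps)
  qed
  then show ?thesis by simp
qed

lemma dgen_braid: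
  assumes i: "1 \<le> i" "Suc i < n"
  shows "yeq d n (dgen i True * (dgen (Suc i) True * dgen i True)) (dgen (Suc i) True * (dgen i True * dgen (Suc i) True))"
proof -
  have i': "1 \<le> i" "i < n" "1 \<le> Suc i" "Suc i < n" using i by auto
  have "yeq d n (dgen i True * (dgen (Suc i) True * (dgen i True * 1))) (dgen (Suc i) True * (dgen i True * (dgen (Suc i) True * 1)))"
  proof (rule weq_yeq[OF weq_step[OF i'(1,2) weq_step[OF i'(3,4) weq_step[OF i'(1,2) weq_one]]]
        weq_step[OF i'(3,4) weq_step[OF i'(1,2) weq_step[OF i'(3,4) weq_one]]]])
    show "yeq d n (gsgn d i True * (gsgn d (Suc i) True * (gsgn d i True * 1))) (gsgn d (Suc i) True * (gsgn d i True * (gsgn d (Suc i) True * 1)))"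
      using yeq_braid[OF i] by (simp add: gsgn_def mult.assoc)
    fix c :: "nat \<Rightarrow> nat"
    \<comment> \<open>Both sides of the braid relation compare the same three pairs among the labels
      at \<open>i\<close>, \<open>i + 1\<close>, \<open>i + 2\<close>, in opposite order, so the
      multipliers agree.\<close>
    have "same (c \<circ> s_adj i) (Suc i) = (if c i = c (Suc (Suc i)) then 1 else 0)"
      "same (c \<circ> s_adj (Suc i)) i = (if c i = c (Suc (Suc i)) then 1 else 0)"
      "same (c \<circ> s_adj i \<circ> s_adj (Suc i)) i = same c (Suc i)"
      "same (c \<circ> s_adj (Suc i) \<circ> s_adj i) (Suc i) = same c i"
      by (simp_all add: same_def transpose_def)
    then show "weight c i True * (weight (c \<circ> s_adj i) (Suc i) True * (weight (c \<circ> s_adj i \<circ> s_adj (Suc i)) i True * 1))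
      = weight c (Suc i) True * (weight (c \<circ> s_adj (Suc i)) i True * (weight (c \<circ> s_adj (Suc i) \<circ> s_adj i) (Suc i) True * 1))"
      by (simp add: weight_def ac_simps)
  qed
  then show ?thesis by simp
qed

lemma dgen_inv:
  assumes "1 \<le> i" "i < n"
  shows "inv\<^bsub>yh d n\<^esub> cls d n (dgen i True) = cls d n (dgen i False)" "cls d n (dgen i True) \<in> Units (yh d n)"
  using inv_cls[OF dgen_inverse[OF assms, of True, simplified] dgen_inverse[OF assms, of False, simplified]] assms by auto

lemma braid_rep_dgen: "braid_rep (yh d n) n (\<lambda>i. cls d n (dgen i True))"
proof -
  interpret Y: ring "yh d n" by (rule ring_yh)
  show ?thesis
  proof unfold_locales
    show "cls d n (dgen i True) \<in> Units (yh d n)" if "1 \<le> i" "i < n" for i using dgen_inv[OF that] by simp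
    fix i j assume "1 \<le> i" "i < n" "1 \<le> j" "j < n" "i + 1 < j \<or> j + 1 < i"
    then show "cls d n (dgen i True) \<otimes>\<^bsub>yh d n\<^esub> cls d n (dgen j True) = cls d n (dgen j True) \<otimes>\<^bsub>yh d n\<^esub> cls d n (dgen i True)"
      using yeq_clsD[OF dgen_far[of i j]] by (simp only: cls_simps(2)[symmetric] dgen_FA)
  next
    fix i assume i: "1 \<le> i" "Suc i < n"
    then have F: "dgen i True \<in> FA n" "dgen (Suc i) True \<in> FA n" by (auto intro!: dgen_FA simp del: FA_intros)
    show "cls d n (dgen i True) \<otimes>\<^bsub>yh d n\<^esub> (cls d n (dgen (Suc i) True) \<otimes>\<^bsub>yh d n\<^esub> cls d n (dgen i True)) =
        cls d n (dgen (Suc i) True) \<otimes>\<^bsub>yh d n\<^esub> (cls d n (dgen i True) \<otimes>\<^bsub>yh d n\<^esub> cls d n (dgen (Suc i) True))"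
      using yeq_clsD[OF dgen_braid[OF i]] F by (simp only: cls_simps(2)[symmetric] FA_intros)
  qed
qed

lemma delta_dword:
  assumes "w \<in> braid_words n" shows "delta d n (bcls n w) = cls d n (dword d w)"
proof -
  interpret braid_rep "yh d n" n "\<lambda>i. cls d n (dgen i True)" by (rule braid_rep_dgen)
  have "braid_eval (yh d n) (\<lambda>i. cls d n (dgen i True)) w = cls d n (dword d w)"
    using assms
  proof (induction rule: braid_words_induct)
    case Nil
    show ?case by (simp add: cls_simps(4))
  next
    case (Cons i b w)
    then show ?case using dgen_inv[OF Cons(1,2)] cls_simps(2)[OF dgen_FA[OF Cons(1,2)] dword_FA[OF Cons(3), of d], of d b]
      by (cases b) auto
  qed
  then show ?thesis
    unfolding delta_def using braid_map_eval[of w] by (simp add: framing_def gam_def gsgn_def)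
qed

lemma entry_dword:
  assumes w: "w \<in> braid_words n" and c: "c \<in> labellings d n" and \<psi>: "\<psi> \<in> chars_of \<xi> d n (cnt n c)"
  shows "\<Phi> (cls d n (dword d w)) (cnt n c) (label_char \<xi> n c) \<psi>
    = (if \<psi> = label_char \<xi> n (c \<circ> wperm w) then path_entry n w c else \<zero>\<^bsub>hecke n\<^esub>)"
  using w c \<psi>
proof (induction arbitrary: c rule: braid_words_induct)
  case Nil
  then show ?case using entry_one[OF label_char_chars_of[OF Nil(1)] Nil(2)] by (auto simp: cls_simps(4))
next
  case (Cons i b w)
  interpret H: ring "hecke n" by (rule ring_yh)
  note s = s_adj_permutes[OF Cons(1,2)]
  have c': "c \<circ> s_adj i \<in> labellings d n" "cnt n (c \<circ> s_adj i) = cnt n c"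
    using labellings_comp[OF Cons(5) s] cnt_comp[OF s] by auto
  have IH: "\<Phi> (cls d n (dword d w)) (cnt n c) (label_char \<xi> n (c \<circ> s_adj i)) \<psi>
      = (if \<psi> = label_char \<xi> n (c \<circ> s_adj i \<circ> wperm w) then path_entry n w (c \<circ> s_adj i) else \<zero>\<^bsub>hecke n\<^esub>)"
    using Cons(4)[OF c'(1), unfolded c'(2), OF Cons(6)] .
  have comp: "c \<circ> wperm ((i, b) # w) = c \<circ> s_adj i \<circ> wperm w" by (simp add: fun_eq_iff)
  define \<chi> where "\<chi> = label_char \<xi> n (c \<circ> s_adj i \<circ> wperm w)"
  show ?case
    unfolding dword_simps entry_step(2)[OF Cons(1,2,5,6) dword_FA[OF Cons(3)]]
      entry_step(1)[OF Cons(1,2,5,6) dword_FA[OF Cons(3)]] IH comp \<chi>_def[symmetric]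
    using hecke_entry_carrier[OF Cons(1,2,5)] by (simp add: smul_zero)
qed

end

section \<open>Basic traces of braids\<close>

text \<open>Extensionality makes the set finite and gives each character one labelling. Surjectivity
  expresses that every block of the support is non-empty.\<close>

definition surj_labellings :: "nat \<Rightarrow> nat \<Rightarrow> (nat \<Rightarrow> nat) set" where
  "surj_labellings k n = {c \<in> {1..n} \<rightarrow>\<^sub>E {1..k}. c ` {1..n} = {1..k}}"

text \<open>Only labellings constant on the components of the closure contribute.\<close>

definition path_sum :: "(nat \<Rightarrow> free_alg set \<Rightarrow> laurent) \<Rightarrow> nat \<Rightarrow> nat \<Rightarrow> braid_word \<Rightarrow> laurent" where
  "path_sum \<tau> k n w = (\<Sum>c \<in> surj_labellings k n.
     if \<forall>j \<in> {1..n}. c (wperm w j) = c j then \<tau> n (path_entry n w c) else 0)"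

lemma surj_labellings_labellings: "c \<in> surj_labellings k n \<Longrightarrow> c \<in> labellings k n"
  by (auto simp: surj_labellings_def labellings_def)

lemma finite_comps: "finite (comps d n)"
proof (rule finite_subset)
  show "comps d n \<subseteq> {\<mu>. \<forall>a. (a \<in> {1..d} \<longrightarrow> \<mu> a \<in> {0..n}) \<and> (a \<notin> {1..d} \<longrightarrow> \<mu> a = 0)}"
  proof
    fix \<mu> assume \<mu>: "\<mu> \<in> comps d n"
    have "\<mu> a \<le> n" if "a \<in> {1..d}" for a
      using member_le_sum[of a "{1..d}" \<mu>] that \<mu> by (simp add: comps_def)
    then show "\<mu> \<in> {\<mu>. \<forall>a. (a \<in> {1..d} \<longrightarrow> \<mu> a \<in> {0..n}) \<and> (a \<notin> {1..d} \<longrightarrow> \<mu> a = 0)}"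
      using \<mu> by (auto simp: comps_def)
  qed
qed (intro finite_set_of_finite_funs; simp)

lemma label_char_cong: "(\<And>j. j \<in> {1..n} \<Longrightarrow> c j = c' j) \<Longrightarrow> label_char \<xi> n c = label_char \<xi> n c'"
  by (auto simp: label_char_def)

lemma label_char_eq_iff:
  assumes "inj_on \<xi> {1..d}" "c \<in> labellings d n" "c' \<in> labellings d n"
  shows "label_char \<xi> n c = label_char \<xi> n c' \<longleftrightarrow> (\<forall>j \<in> {1..n}. c j = c' j)"
proof
  assume e: "label_char \<xi> n c = label_char \<xi> n c'"
  show "\<forall>j \<in> {1..n}. c j = c' j"
  proof
    fix j assume j: "j \<in> {1..n}"
    then have "\<xi> (c j) = \<xi> (c' j)" using fun_cong[OF e, of j] by (simp add: label_char_def)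
    then show "c j = c' j"
      using inj_onD[OF assms(1), of "c j" "c' j"] assms(2,3) j unfolding labellings_def by blast
  qed
qed (auto intro: label_char_cong)

lemma cnt_pos_iff: "cnt n c a \<noteq> 0 \<longleftrightarrow> a \<in> c ` {1..n}"
  by (auto simp: cnt_def card_eq_0_iff)

lemma ex_increasing_enumeration:
  fixes S :: "nat set"
  assumes "finite S"
  obtains \<sigma> where "strict_mono_on {1..card S} \<sigma>" "\<sigma> ` {1..card S} = S"
proof -
  obtain h where h: "bij_betw h {..<card S} S" "strict_mono_on {..<card S} h"
    using ex_bij_betw_strict_mono_card[OF assms] by blast
  \<comment> \<open>The enumeration \<open>h\<close> is indexed from 0, labels are indexed from
    1.\<close>
  have "(\<lambda>i. i - 1) ` {1..card S} = {..<card S}"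
  proof (intro subset_antisym subsetI)
    fix i assume "i \<in> {..<card S}"
    then show "i \<in> (\<lambda>i. i - 1) ` {1..card S}" by (intro image_eqI[of _ _ "Suc i"]) auto
  qed auto
  then have "(h \<circ> (\<lambda>i. i - 1)) ` {1..card S} = S"
    using h(1) unfolding image_comp[symmetric] by (simp add: bij_betw_def)
  moreover have "strict_mono_on {1..card S} (h \<circ> (\<lambda>i. i - 1))"
    by (rule strict_mono_onI) (auto intro!: strict_mono_onD[OF h(2)])
  ultimately show ?thesis using that by blast
qed

lemma (in hecke_trace) tau_zero: "1 \<le> n \<Longrightarrow> \<tau> n \<zero>\<^bsub>hecke n\<^esub> = 0"
  using tr_scal[of n 0 0] by (simp add: tr_def cls_zero[symmetric] scal_0)

lemma (in hecke_trace) tau_finsum: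
  assumes "1 \<le> n" "\<And>a. a \<in> A \<Longrightarrow> f a \<in> carrier (hecke n)"
  shows "\<tau> n (finsum (hecke n) f A) = (\<Sum>a \<in> A. \<tau> n (f a))"
proof -
  interpret H: ring "hecke n" by (rule ring_yh)
  note zero = tau_zero[OF assms(1)]
  show ?thesis using assms(2)
  proof (induction A rule: infinite_finite_induct)
    case (insert a A)
    then have "finsum (hecke n) f A \<in> carrier (hecke n)" by (intro H.finsum_closed) auto
    then have "\<tau> n (f a \<oplus>\<^bsub>hecke n\<^esub> finsum (hecke n) f A) = \<tau> n (f a) + \<tau> n (finsum (hecke n) f A)"
      using tau_linear[OF assms(1)] insert unfolding linear_form_def by simp
    then show ?case using insert by (simp add: H.finsum_insert)
  qed (simp_all add: zero)
qed

lemma (in hecke_trace_comp) finsum_HC: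
  assumes "\<And>a. a \<in> A \<Longrightarrow> f a \<in> HC" shows "finsum (hecke n) f A \<in> HC"
proof -
  interpret H: ring "hecke n" by (rule ring_yh)
  have zero: "\<zero>\<^bsub>hecke n\<^esub> \<in> HC" using HC_closed(3)[of 0] by (simp add: scal_0 cls_zero)
  show ?thesis using assms
  proof (induction A rule: infinite_finite_induct)
    case (insert a A)
    then show ?case using HC_closed(1) HC_carrier by (simp add: H.finsum_insert Pi_def)
  qed (simp_all add: zero)
qed

locale yh_trace = hecke_trace \<tau> + yh_iso \<xi> d n \<Phi>
  for \<tau> and \<xi> :: "nat \<Rightarrow> complex" and d n \<Phi> +
  fixes S :: "nat set"
  assumes S: "S \<subseteq> {1..d}" "S \<noteq> {}"
begin

definition supp_comps :: "(nat \<Rightarrow> nat) set" where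
  "supp_comps = {\<mu> \<in> comps d n. \<forall>a \<in> {1..d}. \<mu> a \<noteq> 0 \<longleftrightarrow> a \<in> S}"

lemma finite_S: "finite S"
  using S finite_subset by blast

text \<open>On \<open>H^mu\<close> the tensor form is the quotient of \<open>\<tau> n\<close> by a
  fixed factor, and \<open>\<tau> n\<close> may be applied to each diagonal entry, which need not
  itself be split into tensors.\<close>

lemma supp_trace:
  assumes x: "x \<in> carrier (yh d n)" and \<mu>: "\<mu> \<in> supp_comps"
  shows "(1 - Lu ^ 2) ^ (card S - 1) * tau_tensor \<tau> n \<mu> S (finsum (hecke n) (\<lambda>\<chi>. \<Phi> x \<mu> \<chi> \<chi>) (chars_of \<xi> d n \<mu>))
    = Lv ^ (card S - 1) * (\<Sum>\<chi> \<in> chars_of \<xi> d n \<mu>. \<tau> n (\<Phi> x \<mu> \<chi> \<chi>))"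
proof -
  interpret T: hecke_trace_comp \<tau> d n \<mu> S
    using \<mu> n S by unfold_locales (auto simp: supp_comps_def)
  have "finsum (hecke n) (\<lambda>\<chi>. \<Phi> x \<mu> \<chi> \<chi>) (chars_of \<xi> d n \<mu>) \<in> hecke_comp n \<mu>"
    using entry_hecke_comp[OF x] by (intro T.finsum_HC) auto
  note quot = T.tau_tensor_quot[OF this]
  have "\<tau> n (finsum (hecke n) (\<lambda>\<chi>. \<Phi> x \<mu> \<chi> \<chi>) (chars_of \<xi> d n \<mu>))
      = (\<Sum>\<chi> \<in> chars_of \<xi> d n \<mu>. \<tau> n (\<Phi> x \<mu> \<chi> \<chi>))"
    by (rule tau_finsum[OF n]) (rule entry_carrier[OF x])
  then show ?thesis using quot unfolding T.quot_tr_def by simp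
qed

lemma supp_sum:
  assumes x: "x \<in> carrier (yh d n)"
  shows "(1 - Lu ^ 2) ^ (card S - 1) *
      (\<Sum>\<mu> \<in> supp_comps. tau_tensor \<tau> n \<mu> S (finsum (hecke n) (\<lambda>\<chi>. \<Phi> x \<mu> \<chi> \<chi>) (chars_of \<xi> d n \<mu>)))
    = Lv ^ (card S - 1) *
      (\<Sum>\<chi> \<in> {\<chi> \<in> chars \<xi> d n. Comp \<xi> d n \<chi> \<in> supp_comps}. \<tau> n (\<Phi> x (Comp \<xi> d n \<chi>) \<chi> \<chi>))"
proof -
  let ?A = "{\<chi> \<in> chars \<xi> d n. Comp \<xi> d n \<chi> \<in> supp_comps}"
  have fin: "finite supp_comps" unfolding supp_comps_def using finite_comps by simp
  have "(1 - Lu ^ 2) ^ (card S - 1) *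
      (\<Sum>\<mu> \<in> supp_comps. tau_tensor \<tau> n \<mu> S (finsum (hecke n) (\<lambda>\<chi>. \<Phi> x \<mu> \<chi> \<chi>) (chars_of \<xi> d n \<mu>)))
    = (\<Sum>\<mu> \<in> supp_comps. Lv ^ (card S - 1) * (\<Sum>\<chi> \<in> chars_of \<xi> d n \<mu>. \<tau> n (\<Phi> x \<mu> \<chi> \<chi>)))"
    unfolding sum_distrib_left[of _ _ supp_comps] by (intro sum.cong refl supp_trace[OF x])
  also have "\<dots> = Lv ^ (card S - 1) * (\<Sum>\<mu> \<in> supp_comps. \<Sum>\<chi> \<in> chars_of \<xi> d n \<mu>. \<tau> n (\<Phi> x \<mu> \<chi> \<chi>))"
    by (simp only: sum_distrib_left)
  also have "(\<Sum>\<mu> \<in> supp_comps. \<Sum>\<chi> \<in> chars_of \<xi> d n \<mu>. \<tau> n (\<Phi> x \<mu> \<chi> \<chi>))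
      = (\<Sum>\<mu> \<in> supp_comps. \<Sum>\<chi> \<in> {\<chi> \<in> ?A. Comp \<xi> d n \<chi> = \<mu>}. \<tau> n (\<Phi> x (Comp \<xi> d n \<chi>) \<chi> \<chi>))"
    by (intro sum.cong refl) (auto simp: chars_of_def)
  also have "\<dots> = (\<Sum>\<chi> \<in> ?A. \<tau> n (\<Phi> x (Comp \<xi> d n \<chi>) \<chi> \<chi>))"
    using finite_chars fin by (intro sum.group) auto
  finally show ?thesis .
qed

text \<open>Characters with support \<open>S\<close> are reindexed by labellings in
  \<open>{1..card S}\<close> along the increasing enumeration \<open>\<sigma>\<close> of
  \<open>S\<close>; its monotonicity leaves the path entries unchanged.\<close>

lemma supp_sum_path_sum:
  assumes w: "w \<in> braid_words n"
  shows "(\<Sum>\<chi> \<in> {\<chi> \<in> chars \<xi> d n. Comp \<xi> d n \<chi> \<in> supp_comps}. \<tau> n (\<Phi> (cls d n (dword d w)) (Comp \<xi> d n \<chi>) \<chi> \<chi>))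
    = path_sum \<tau> (card S) n w"
proof -
  let ?A = "{\<chi> \<in> chars \<xi> d n. Comp \<xi> d n \<chi> \<in> supp_comps}" and ?k = "card S"
  obtain \<sigma> where \<sigma>: "strict_mono_on {1..?k} \<sigma>" "\<sigma> ` {1..?k} = S"
    using ex_increasing_enumeration[OF finite_S] by blast
  have inj_\<sigma>: "inj_on \<sigma> {1..?k}" using \<sigma>(1) by (rule strict_mono_on_imp_inj_on)
  have lab: "\<sigma> \<circ> c \<in> labellings d n" if "c \<in> labellings ?k n" for c
    using that \<sigma>(2) S(1) unfolding labellings_def by fastforce
  note zero = tau_zero[OF n]
  let ?g = "\<lambda>c. label_char \<xi> n (\<sigma> \<circ> c)"
  have bij: "bij_betw ?g (surj_labellings ?k n) ?A"
    unfolding bij_betw_def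
  proof
    show "inj_on ?g (surj_labellings ?k n)"
    proof (rule inj_onI)
      fix c c' assume c: "c \<in> surj_labellings ?k n" "c' \<in> surj_labellings ?k n" and e: "?g c = ?g c'"
      note l = surj_labellings_labellings[OF c(1)] surj_labellings_labellings[OF c(2)]
      have "\<forall>j \<in> {1..n}. \<sigma> (c j) = \<sigma> (c' j)"
        using e label_char_eq_iff[OF inj_roots lab[OF l(1)] lab[OF l(2)]] by simp
      then have "c j = c' j" if "j \<in> {1..n}" for j
        using inj_onD[OF inj_\<sigma>, of "c j" "c' j"] l that unfolding labellings_def by blast
      then show "c = c'" using c by (intro PiE_ext[of c "{1..n}" "\<lambda>_. {1..?k}" c']) (auto simp: surj_labellings_def)
    qed
    show "?g ` surj_labellings ?k n = ?A"
    proof (intro subset_antisym subsetI)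
      fix \<chi> assume "\<chi> \<in> ?g ` surj_labellings ?k n"
      then obtain c where c: "c \<in> surj_labellings ?k n" "\<chi> = ?g c" by blast
      note l = lab[OF surj_labellings_labellings[OF c(1)]]
      have "(\<sigma> \<circ> c) ` {1..n} = S" using c(1) \<sigma>(2) unfolding image_comp[symmetric] by (simp add: surj_labellings_def)
      then have "cnt n (\<sigma> \<circ> c) \<in> supp_comps"
        using cnt_comps[OF l] cnt_pos_iff[of n "\<sigma> \<circ> c"] unfolding supp_comps_def by blast
      then show "\<chi> \<in> ?A" using c(2) label_char_chars[OF l] Comp_label_char[OF inj_roots l] by simp
    next
      fix \<chi> assume \<chi>: "\<chi> \<in> ?A"
      then obtain c' where c': "c' \<in> labellings d n" "\<chi> = label_char \<xi> n c'" using chars_label_char by blast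
      have "cnt n c' \<in> supp_comps" using \<chi> c' Comp_label_char[OF inj_roots c'(1)] by simp
      then have "a \<in> c' ` {1..n} \<longleftrightarrow> a \<in> S" if "a \<in> {1..d}" for a
        using that cnt_pos_iff[of n c'] unfolding supp_comps_def by blast
      moreover have "c' ` {1..n} \<subseteq> {1..d}" using c'(1) unfolding labellings_def by blast
      ultimately have im: "c' ` {1..n} = S" using S(1) by blast
      \<comment> \<open>Each label is replaced by its rank in \<open>S\<close>, and restricted to
        make the labelling extensional.\<close>
      define c where "c = (\<lambda>j \<in> {1..n}. inv_into {1..?k} \<sigma> (c' j))"
      have \<sigma>c: "c j \<in> {1..?k} \<and> \<sigma> (c j) = c' j" if "j \<in> {1..n}" for j
      proof -
        have "c' j \<in> \<sigma> ` {1..?k}" using im that \<sigma>(2) by blast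
        then show ?thesis using that inv_into_into[of "c' j" \<sigma> "{1..?k}"] f_inv_into_f[of "c' j" \<sigma> "{1..?k}"]
          by (simp add: c_def)
      qed
      have "c ` {1..n} = {1..?k}"
      proof (intro subset_antisym subsetI)
        fix b assume b: "b \<in> {1..?k}"
        then have "\<sigma> b \<in> c' ` {1..n}" using im \<sigma>(2) by blast
        then obtain j where j: "j \<in> {1..n}" "\<sigma> b = c' j" by blast
        then have "c j = b" using \<sigma>c[OF j(1)] inj_onD[OF inj_\<sigma>, of "c j" b] b by simp
        then show "b \<in> c ` {1..n}" using j by blast
      qed (use \<sigma>c in blast)
      then have "c \<in> surj_labellings ?k n" unfolding surj_labellings_def c_def by auto
      moreover have "\<chi> = ?g c" unfolding c'(2) by (intro label_char_cong) (simp add: \<sigma>c)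
      ultimately show "\<chi> \<in> ?g ` surj_labellings ?k n" by blast
    qed
  qed
  have entry: "\<tau> n (\<Phi> (cls d n (dword d w)) (Comp \<xi> d n (?g c)) (?g c) (?g c))
      = (if \<forall>j \<in> {1..n}. c (wperm w j) = c j then \<tau> n (path_entry n w c) else 0)"
    if "c \<in> surj_labellings ?k n" for c
  proof -
    note l = surj_labellings_labellings[OF that]
    note wp = wperm_permutes[OF w]
    have "?g c = label_char \<xi> n (\<sigma> \<circ> c \<circ> wperm w) \<longleftrightarrow> (\<forall>j \<in> {1..n}. \<sigma> (c j) = \<sigma> (c (wperm w j)))"
      using label_char_eq_iff[OF inj_roots lab[OF l] labellings_comp[OF lab[OF l] wp]] by simp
    also have "\<dots> \<longleftrightarrow> (\<forall>j \<in> {1..n}. c (wperm w j) = c j)"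
    proof (rule ball_cong)
      fix j assume j: "j \<in> {1..n}"
      then have "c j \<in> {1..?k}" "c (wperm w j) \<in> {1..?k}"
        using l labellings_comp[OF l wp] by (auto simp: labellings_def)
      then show "\<sigma> (c j) = \<sigma> (c (wperm w j)) \<longleftrightarrow> c (wperm w j) = c j"
        using inj_on_eq_iff[OF inj_\<sigma>] by auto
    qed simp
    \<comment> \<open>The diagonal entry sits in the only possibly non-zero column exactly when the
      labelling is invariant under the permutation of the braid.\<close>
    finally have iff: "?g c = label_char \<xi> n (\<sigma> \<circ> c \<circ> wperm w) \<longleftrightarrow> (\<forall>j \<in> {1..n}. c (wperm w j) = c j)" .
    show ?thesis
      unfolding Comp_label_char[OF inj_roots lab[OF l]] entry_dword[OF w lab[OF l] label_char_chars_of[OF lab[OF l]]]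
        iff path_entry_strict_mono[OF \<sigma>(1) w l] using zero by simp
  qed
  show ?thesis
    unfolding path_sum_def sum.reindex_bij_betw[OF bij, symmetric] by (intro sum.cong refl entry)
qed

end

text \<open>The right-hand side involves \<open>d\<close>, the roots of unity and the isomorphism no
  longer, and \<open>S\<close> only through its size; all comparisons of invariants rest on
  this.\<close>

lemma basic_trace_delta:
  assumes "hecke_trace \<tau>" "yh_iso (\<xi> d) d n (\<Psi> d n)" "S \<subseteq> {1..d}" "S \<noteq> {}" "w \<in> braid_words n"
  shows "(1 - Lu ^ 2) ^ (card S - 1) * link_inv d (basic_trace \<xi> \<tau> \<Psi> d S) n (bcls n w)
    = Lv ^ (card S - 1) * path_sum \<tau> (card S) n w"
proof -
  interpret yh_trace \<tau> "\<xi> d" d n "\<Psi> d n" S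
    using assms(1-4) by (intro yh_trace.intro yh_trace_axioms.intro)
  have "cls d n (dword d w) \<in> carrier (yh d n)" using dword_FA[OF assms(5)] by (rule cls_simps(1))
  from supp_sum[OF this] show ?thesis
    unfolding link_inv_def delta_dword[OF assms(5)] basic_trace_def supp_comps_def[symmetric]
      supp_sum_path_sum[OF assms(5)] .
qed

lemma path_sum_eq_0:
  assumes w: "w \<in> braid_words n" and k: "num_components n (bcls n w) < k"
  shows "path_sum \<tau> k n w = 0"
  unfolding path_sum_def
proof (intro sum.neutral ballI)
  fix c assume c: "c \<in> surj_labellings k n"
  let ?p = "wperm w"
  have p: "?p permutes {1..n}" using w by (rule wperm_permutes)
  have "\<not> (\<forall>j \<in> {1..n}. c (?p j) = c j)"
  proof
    assume fix_c: "\<forall>j \<in> {1..n}. c (?p j) = c j"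
    have orbit: "i \<in> {1..n} \<and> c i = c j" if "i \<in> Orbits.orbit ?p j" "j \<in> {1..n}" for i j
      using that by induction (use fix_c permutes_in_image[OF p] in auto)
    have self: "j \<in> Orbits.orbit ?p j" for j
      using p by (intro permutation_self_in_orbit) (auto simp: permutation_permutes)
    \<comment> \<open>A labelling constant on cycles factors through the set of cycles, by
      evaluation at a chosen element of each. Being onto \<open>{1..k}\<close>, it needs at least
      \<open>k\<close> cycles.\<close>
    have "{1..k} = (\<lambda>B. c (SOME i. i \<in> B)) ` (Orbits.orbit ?p ` {1..n})"
    proof -
      have "c (SOME i. i \<in> Orbits.orbit ?p j) = c j" if "j \<in> {1..n}" for j
        using orbit[OF someI[of "\<lambda>i. i \<in> Orbits.orbit ?p j", OF self] that] by simp
      then have "c ` {1..n} = (\<lambda>j. c (SOME i. i \<in> Orbits.orbit ?p j)) ` {1..n}" by (intro image_cong) auto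
      then show ?thesis using c by (simp add: surj_labellings_def image_comp o_def)
    qed
    then have "card {1..k} \<le> card (Orbits.orbit ?p ` {1..n})"
      by (metis card_image_le finite_atLeastAtMost finite_imageI)
    then show False using k by (simp add: num_components_def braid_perm_wperm[OF w])
  qed
  then show "(if \<forall>j \<in> {1..n}. c (?p j) = c j then \<tau> n (path_entry n w c) else 0) = 0" by (rule if_not_P)
qed

section \<open>The HOMFLYPT polynomial\<close>

lemma braid_rep_yg: "braid_rep (hecke n) n (yg 1 n)"
proof -
  interpret H: ring "hecke n" by (rule ring_yh)
  show ?thesis
  proof unfold_locales
    show "yg 1 n i \<in> Units (hecke n)" if "1 \<le> i" "i < n" for i using inv_yg(2)[of 1 i n] that by simp
    fix i j assume ij: "1 \<le> i" "i < n" "1 \<le> j" "j < n" "i + 1 < j \<or> j + 1 < i"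
    then show "yg 1 n i \<otimes>\<^bsub>hecke n\<^esub> yg 1 n j = yg 1 n j \<otimes>\<^bsub>hecke n\<^esub> yg 1 n i"
      using yeq_clsD[OF yeq_far[OF ij, of 1]] by (simp add: yg_def cls_simps(2)[symmetric])
  next
    fix i assume i: "1 \<le> i" "Suc i < n"
    then show "yg 1 n i \<otimes>\<^bsub>hecke n\<^esub> (yg 1 n (Suc i) \<otimes>\<^bsub>hecke n\<^esub> yg 1 n i) =
        yg 1 n (Suc i) \<otimes>\<^bsub>hecke n\<^esub> (yg 1 n i \<otimes>\<^bsub>hecke n\<^esub> yg 1 n (Suc i))"
      using yeq_clsD[OF yeq_braid[OF i, of 1]] by (simp add: yg_def cls_simps(2)[symmetric] mult.assoc)
  qed
qed

lemma braid_map_yg: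
  assumes "w \<in> braid_words n" shows "braid_map (hecke n) (yg 1 n) (bcls n w) = cls 1 n (gword 1 w)"
proof -
  interpret braid_rep "hecke n" n "yg 1 n" by (rule braid_rep_yg)
  have "braid_eval (hecke n) (yg 1 n) w = cls 1 n (gword 1 w)"
    using assms
  proof (induction rule: braid_words_induct)
    case Nil
    show ?case by (simp add: cls_simps(4))
  next
    case (Cons i b w)
    then show ?case
      using inv_yg(1)[of 1 i n] cls_simps(2)[OF gsgn_FA[OF Cons(1,2)] gword_FA[OF Cons(3)], of 1 1 b 1]
      by (cases b) (simp_all add: gsgn_def yg_def)
  qed
  then show ?thesis by (simp add: braid_map_eval)
qed

text \<open>For a constant labelling the sorting permutations are trivial and the framing weights
  are 1, so the path entry is the image of the braid in \<open>H_n\<close>. This is how the case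
  \<open>k = 1\<close> becomes the HOMFLYPT polynomial.\<close>

lemma path_entry_const:
  assumes "w \<in> braid_words n" "\<And>j. j \<in> {1..n} \<Longrightarrow> c j = 1"
  shows "path_entry n w c = cls 1 n (gword 1 w)"
  using assms
proof (induction arbitrary: c rule: braid_words_induct)
  case Nil
  show ?case by (simp add: cls_simps(4))
next
  case (Cons i b w)
  note i = Cons(1,2)
  have perm: "s_adj i permutes {1..n}" using i by (rule s_adj_permutes)
  have c': "(c \<circ> s_adj i) j = 1" if "j \<in> {1..n}" for j
    using Cons(5) permutes_in_image[OF perm] that by simp
  have "c i = 1" "c (Suc i) = 1" using Cons(5) i by auto
  then have same: "same c i = 1" by (simp add: same_def)
  have "mono_on {1..n} c" "mono_on {1..n} (c \<circ> s_adj i)"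
    using Cons(5) c' by (auto simp: mono_on_def)
  then have "sorter n c = id" "sorter n (c \<circ> s_adj i) = id" using sorter_mono by blast+
  then have word: "hecke_word n c i = cls 1 n (gg i)"
    using i by (simp add: hecke_word_def yg_perm_adjacent smul_one cls_simps(1) yg_def)
  have F: "gg i \<in> FA n" "tt i \<in> FA n" using i by auto
  have "hecke_entry n c i b = cls 1 n (gsgn 1 i b)"
  proof (cases b)
    case True
    then show ?thesis by (simp add: hecke_entry_def word gsgn_def)
  next
    case False
    have "hecke_entry n c i b = smul 1 n (upow (- 2)) (cls 1 n (gg i) \<oplus>\<^bsub>hecke n\<^esub> cls 1 n (- scal Lv))"
      using False cls_uminus[of "scal Lv" n 1]
      by (simp add: hecke_entry_def word same a_minus_def cls_simps(4)[symmetric] smul_cls)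
    also have "\<dots> = cls 1 n (scal (upow (- 2)) * (gg i - scal Lv * 1))"
      using F by (simp add: smul_cls cls_simps(3)[symmetric])
    \<comment> \<open>The matrix entry contains the unit where \<open>gginv 1 i\<close> contains
      \<open>t_i\<close>; they agree in the Hecke algebra only.\<close>
    also have "\<dots> = cls 1 n (gginv 1 i)"
      unfolding gginv_def ee_1 using F i
      by (intro yeq_clsD yeq_mult_left yeq_diff yeq_sym[OF yeq_tt_1]) auto
    finally show ?thesis using False by (simp add: gsgn_def)
  qed
  moreover have "path_entry n w (c \<circ> s_adj i) = cls 1 n (gword 1 w)" using c' by (rule Cons(4))
  moreover have "weight c i b = 1" by (simp add: weight_def same)
  ultimately show ?case
    unfolding path_entry.simps gword_simps
    using gsgn_FA[OF i, of 1 b] gword_FA[OF Cons(3), of 1] by (simp add: cls_simps(2)[symmetric] cls_simps(1) smul_one)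
qed

lemma path_sum_1:
  assumes "1 \<le> n" "w \<in> braid_words n" shows "path_sum \<tau> 1 n w = \<tau> n (cls 1 n (gword 1 w))"
proof -
  let ?c = "\<lambda>j \<in> {1..n}. 1 :: nat"
  have "surj_labellings 1 n = {?c}"
  proof -
    have "{1..n} \<rightarrow>\<^sub>E {1..1} = {?c}" by (simp add: PiE_singleton[of ?c "{1..n}", symmetric])
    moreover have "?c ` {1..n} = {1..1}" using assms(1) by auto
    ultimately show ?thesis unfolding surj_labellings_def by auto
  qed
  moreover have "\<forall>j \<in> {1..n}. ?c (wperm w j) = ?c j"
    using permutes_in_image[OF wperm_permutes[OF assms(2)]] by auto
  ultimately show ?thesis using path_entry_const[OF assms(2), of ?c] by (simp add: path_sum_def)
qed

context hecke_trace
begin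

lemma hecke_inv_tr: "w \<in> braid_words n \<Longrightarrow> hecke_inv \<tau> n (bcls n w) = tr n (gword 1 w)"
  by (simp add: hecke_inv_def braid_map_yg tr_def)

text \<open>The relation \<open>g_i - u^2 g_i^{-1} = v\<close> between arbitrary factors, which
  stand for the rest of the braid.\<close>

lemma tr_skein:
  assumes "1 \<le> i" "i < n" "p \<in> FA n" "q \<in> FA n"
  shows "tr n (p * gg i * q) - Lu ^ 2 * tr n (p * gginv 1 i * q) = Lv * tr n (p * q)"
proof -
  have F: "gg i \<in> FA n" "gginv 1 i \<in> FA n" "tt i \<in> FA n" using assms by auto
  have e: "gg i - scal (Lu ^ 2) * gginv 1 i = scal Lv * tt i"
    by (simp add: gginv_def scal_mult_left Lu_power2 upow_add scal_1 ee_1)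
  have "tr n (p * gg i * q) - Lu ^ 2 * tr n (p * gginv 1 i * q) = tr n (p * gg i * q - scal (Lu ^ 2) * (p * gginv 1 i * q))"
    using F assms by (simp add: tr_diff tr_scal)
  also have "p * gg i * q - scal (Lu ^ 2) * (p * gginv 1 i * q) = p * (gg i - scal (Lu ^ 2) * gginv 1 i) * q"
    by (simp only: right_diff_distrib left_diff_distrib mult_scal_left mult.assoc)
  also have "\<dots> = scal Lv * (p * tt i * q)" unfolding e by (simp only: mult_scal_left mult.assoc)
  also have "tr n (scal Lv * (p * tt i * q)) = Lv * tr n (p * tt i * q)"
    using F assms by (intro tr_scal) auto
  also have "tr n (p * tt i * q) = tr n (p * 1 * q)"
    using assms by (intro tr_cong yeq_mult_right yeq_mult_left yeq_tt_1) auto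
  finally show ?thesis by simp
qed

lemma is_homflypt_hecke_inv: "is_homflypt (hecke_inv \<tau>)"
proof -
  have conj: "hecke_inv \<tau> n (\<alpha> \<otimes>\<^bsub>braid_group n\<^esub> \<beta>) = hecke_inv \<tau> n (\<beta> \<otimes>\<^bsub>braid_group n\<^esub> \<alpha>)"
    if n: "1 \<le> n" and ab: "\<alpha> \<in> carrier (braid_group n)" "\<beta> \<in> carrier (braid_group n)" for n \<alpha> \<beta>
  proof -
    obtain v w where "\<alpha> = bcls n v" "\<beta> = bcls n w" "v \<in> braid_words n" "w \<in> braid_words n"
      using ab unfolding braid_group_carrier by blast
    then show ?thesis using tr_commute[OF n, of "gword 1 v" "gword 1 w"]
      by (simp add: bcls_mult hecke_inv_tr gword_append gword_FA)
  qed
  have stab: "hecke_inv \<tau> (n + 1) (braid_map (braid_group (n + 1)) (sig (n + 1)) \<beta> \<otimes>\<^bsub>braid_group (n + 1)\<^esub> sig (n + 1) n) = hecke_inv \<tau> n \<beta>"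
    "hecke_inv \<tau> (n + 1) (braid_map (braid_group (n + 1)) (sig (n + 1)) \<beta> \<otimes>\<^bsub>braid_group (n + 1)\<^esub> inv\<^bsub>braid_group (n + 1)\<^esub> sig (n + 1) n) = hecke_inv \<tau> n \<beta>"
    if n: "1 \<le> n" and \<beta>: "\<beta> \<in> carrier (braid_group n)" for n \<beta>
  proof -
    obtain w where w: "\<beta> = bcls n w" "w \<in> braid_words n" using \<beta> unfolding braid_group_carrier by blast
    have w': "w \<in> braid_words (n + 1)" using w(2) by (rule braid_words_mono) simp
    have b: "braid_map (braid_group (n + 1)) (sig (n + 1)) \<beta> = bcls (n + 1) w"
      unfolding w(1) using w(2) by (intro braid_map_sig) auto
    have inv: "inv\<^bsub>braid_group (n + 1)\<^esub> sig (n + 1) n = bcls (n + 1) [(n, False)]"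
      using n by (intro sig_inverse) auto
    have words: "[(n, s)] \<in> braid_words (n + 1)" "w @ [(n, s)] \<in> braid_words (n + 1)" for s using n w' by auto
    have "hecke_inv \<tau> (n + 1) (bcls (n + 1) (w @ [(n, s)])) = hecke_inv \<tau> n \<beta>" for s
      using tr_gg[OF n gword_FA[OF w(2), of 1]] words[of s]
      unfolding w(1) hecke_inv_tr[OF w(2)] hecke_inv_tr[OF words(2)]
      by (cases s) (simp_all add: gword_append gsgn_def Suc_eq_plus1)
    then show "hecke_inv \<tau> (n + 1) (braid_map (braid_group (n + 1)) (sig (n + 1)) \<beta> \<otimes>\<^bsub>braid_group (n + 1)\<^esub> sig (n + 1) n) = hecke_inv \<tau> n \<beta>"
      "hecke_inv \<tau> (n + 1) (braid_map (braid_group (n + 1)) (sig (n + 1)) \<beta> \<otimes>\<^bsub>braid_group (n + 1)\<^esub> inv\<^bsub>braid_group (n + 1)\<^esub> sig (n + 1) n) = hecke_inv \<tau> n \<beta>"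
      unfolding b inv unfolding sig_bcls bcls_mult[OF w' words(1)] by blast+
  qed
  have unknot: "hecke_inv \<tau> 1 \<one>\<^bsub>braid_group 1\<^esub> = 1"
    using hecke_inv_tr[of "[]" 1] tau_1 by (simp add: bcls_one tr_def cls_simps(4))
  have skein: "hecke_inv \<tau> n (\<alpha> \<otimes>\<^bsub>braid_group n\<^esub> sig n i \<otimes>\<^bsub>braid_group n\<^esub> \<beta>)
        - Lu ^ 2 * hecke_inv \<tau> n (\<alpha> \<otimes>\<^bsub>braid_group n\<^esub> inv\<^bsub>braid_group n\<^esub> sig n i \<otimes>\<^bsub>braid_group n\<^esub> \<beta>)
        = Lv * hecke_inv \<tau> n (\<alpha> \<otimes>\<^bsub>braid_group n\<^esub> \<beta>)"
    if i: "i \<in> {1..<n}" and ab: "\<alpha> \<in> carrier (braid_group n)" "\<beta> \<in> carrier (braid_group n)" for n i \<alpha> \<beta>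
  proof -
    obtain v w where vw: "\<alpha> = bcls n v" "\<beta> = bcls n w" "v \<in> braid_words n" "w \<in> braid_words n"
      using ab unfolding braid_group_carrier by blast
    have i': "1 \<le> i" "i < n" using i by auto
    have "bcls n v \<otimes>\<^bsub>braid_group n\<^esub> bcls n [(i, s)] \<otimes>\<^bsub>braid_group n\<^esub> bcls n w = bcls n (v @ (i, s) # w)" for s
      using vw i' by (simp add: bcls_mult)
    moreover have "v @ (i, s) # w \<in> braid_words n" for s using vw i' by simp
    ultimately show ?thesis
      using tr_skein[OF i' gword_FA[OF vw(3)] gword_FA[OF vw(4)], of 1 1] vw(3,4)
      unfolding vw(1,2) sig_inverse(2)[OF i'] unfolding sig_bcls
      by (simp add: bcls_mult hecke_inv_tr gword_append gsgn_def mult.assoc)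
  qed
  show ?thesis
    unfolding is_homflypt_def Let_def using conj stab unknot skein by blast
qed

end

text \<open>Agreement is available on braids only, so each argument occurring in
  \<open>is_homflypt\<close> has to be recognised as an element of a braid group.\<close>

lemma is_homflypt_cong:
  assumes eq: "\<And>n \<beta>. 1 \<le> n \<Longrightarrow> \<beta> \<in> carrier (braid_group n) \<Longrightarrow> P n \<beta> = Q n \<beta>" and Q: "is_homflypt Q"
  shows "is_homflypt P"
proof -
  have mult: "\<alpha> \<otimes>\<^bsub>braid_group n\<^esub> \<beta> \<in> carrier (braid_group n)"
    if "\<alpha> \<in> carrier (braid_group n)" "\<beta> \<in> carrier (braid_group n)" for n \<alpha> \<beta>
    using that monoid.m_closed[OF monoid_braid_group] by blast
  have sig: "sig n i \<in> carrier (braid_group n)" "inv\<^bsub>braid_group n\<^esub> sig n i \<in> carrier (braid_group n)"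
    if "i \<in> {1..<n}" for n i
  proof -
    have "sig n i \<in> Units (braid_group n)" using sig_inverse(1) that by simp
    then show "sig n i \<in> carrier (braid_group n)" "inv\<^bsub>braid_group n\<^esub> sig n i \<in> carrier (braid_group n)"
      using monoid.Units_closed[OF monoid_braid_group] monoid.Units_inv_closed[OF monoid_braid_group] by blast+
  qed
  have up: "braid_map (braid_group (n + 1)) (sig (n + 1)) \<beta> \<in> carrier (braid_group (n + 1))"
    if \<beta>: "\<beta> \<in> carrier (braid_group n)" for n \<beta>
  proof -
    obtain w where w: "\<beta> = bcls n w" "w \<in> braid_words n" using \<beta> unfolding braid_group_carrier by blast
    have "w \<in> braid_words (n + 1)" using w(2) by (rule braid_words_mono) simp
    then show ?thesis unfolding w(1) using braid_map_sig[OF w(2), of "n + 1"] by (simp add: bcls_carrier)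
  qed
  have one: "\<one>\<^bsub>braid_group n\<^esub> \<in> carrier (braid_group n)" for n
    by (rule monoid.one_closed[OF monoid_braid_group])
  have last: "n \<in> {1..<n + 1}" if "1 \<le> n" for n :: nat using that by simp
  show ?thesis
    unfolding is_homflypt_def Let_def
  proof (intro conjI allI impI ballI)
    fix n :: nat and \<alpha> \<beta> assume a: "1 \<le> n" "\<alpha> \<in> carrier (braid_group n)" "\<beta> \<in> carrier (braid_group n)"
    show "P n (\<alpha> \<otimes>\<^bsub>braid_group n\<^esub> \<beta>) = P n (\<beta> \<otimes>\<^bsub>braid_group n\<^esub> \<alpha>)"
      using Q a unfolding is_homflypt_def by (simp add: eq mult)
    fix i assume i: "i \<in> {1..<n}"
    show "P n (\<alpha> \<otimes>\<^bsub>braid_group n\<^esub> sig n i \<otimes>\<^bsub>braid_group n\<^esub> \<beta>)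
        - Lu ^ 2 * P n (\<alpha> \<otimes>\<^bsub>braid_group n\<^esub> inv\<^bsub>braid_group n\<^esub> sig n i \<otimes>\<^bsub>braid_group n\<^esub> \<beta>)
        = Lv * P n (\<alpha> \<otimes>\<^bsub>braid_group n\<^esub> \<beta>)"
      unfolding eq[OF a(1) mult[OF mult[OF a(2) sig(1)[OF i]] a(3)]]
        eq[OF a(1) mult[OF mult[OF a(2) sig(2)[OF i]] a(3)]] eq[OF a(1) mult[OF a(2,3)]]
      using Q a i unfolding is_homflypt_def by blast
  next
    fix n :: nat and \<beta> assume a: "1 \<le> n" "\<beta> \<in> carrier (braid_group n)"
    let ?b = "braid_map (braid_group (n + 1)) (sig (n + 1)) \<beta>"
    have "P (n + 1) (?b \<otimes>\<^bsub>braid_group (n + 1)\<^esub> x) = Q (n + 1) (?b \<otimes>\<^bsub>braid_group (n + 1)\<^esub> x)"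
      if "x \<in> carrier (braid_group (n + 1))" for x
      using that up[OF a(2)] by (intro eq mult) auto
    note this[OF sig(1)[OF last[OF a(1)]]] this[OF sig(2)[OF last[OF a(1)]]]
    then show "P (n + 1) (?b \<otimes>\<^bsub>braid_group (n + 1)\<^esub> sig (n + 1) n) = P n \<beta>"
      "P (n + 1) (?b \<otimes>\<^bsub>braid_group (n + 1)\<^esub> inv\<^bsub>braid_group (n + 1)\<^esub> sig (n + 1) n) = P n \<beta>"
      using Q a eq[OF a] unfolding is_homflypt_def Let_def by metis+
  next
    show "P 1 \<one>\<^bsub>braid_group 1\<^esub> = 1" using Q one eq[of 1] unfolding is_homflypt_def by simp
  qed
qed

lemma laurent_uv_sum: "(\<And>a. a \<in> A \<Longrightarrow> f a \<in> laurent_uv) \<Longrightarrow> sum f A \<in> laurent_uv"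
proof (induction A rule: infinite_finite_induct)
  case (insert a A)
  then have "f a \<in> laurent_uv" "sum f A \<in> laurent_uv" by auto
  then have "f a + sum f A \<in> laurent_uv"
    unfolding laurent_uv_def using Poly_Mapping.keys_add[of "f a" "sum f A"] by blast
  then show ?case using insert by simp
qed (simp_all add: laurent_uv_def)

theorem mainTheorem9:
  fixes N :: nat
    and \<xi> :: "nat \<Rightarrow> nat \<Rightarrow> complex"
    and \<tau> :: "nat \<Rightarrow> free_alg set \<Rightarrow> laurent"
    and \<Psi> :: "nat \<Rightarrow> nat \<Rightarrow> free_alg set \<Rightarrow> mats"
  assumes N: "N \<ge> 1"
    and \<xi>: "\<And>d. d \<ge> 1 \<Longrightarrow> bij_betw (\<xi> d) {1..d} {z. z ^ d = 1}"
    and \<tau>: "markov_trace 1 \<tau>" "\<tau> 1 \<one>\<^bsub>hecke 1\<^esub> = 1"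
    and \<Psi>: "\<And>d n. d \<ge> 1 \<Longrightarrow> n \<ge> 1 \<Longrightarrow> is_Psi (\<xi> d) d n (\<Psi> d n)"
  shows "(\<forall>d \<ge> 1. \<forall>\<rho>. markov_trace d \<rho> \<and> in_basic_span \<xi> \<tau> \<Psi> d \<rho> \<longrightarrow>
            (\<exists>c. (\<forall>k \<in> {1..N}. c k \<in> laurent_uv) \<and>
               (\<forall>n \<ge> 1. \<forall>\<beta> \<in> carrier (braid_group n). num_components n \<beta> = N \<longrightarrow>
                  link_inv d \<rho> n \<beta> =
                  (\<Sum>k = 1..N. c k * link_inv k (basic_trace \<xi> \<tau> \<Psi> k {1..k}) n \<beta>))))
       \<and> (\<forall>n \<ge> 1. \<forall>\<beta> \<in> carrier (braid_group n).
            link_inv 1 (basic_trace \<xi> \<tau> \<Psi> 1 {1}) n \<beta> = hecke_inv \<tau> n \<beta>)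
       \<and> is_homflypt (link_inv 1 (basic_trace \<xi> \<tau> \<Psi> 1 {1}))"
proof -
  interpret hecke_trace \<tau> using \<tau> by unfold_locales
  let ?P = "\<lambda>d S. link_inv d (basic_trace \<xi> \<tau> \<Psi> d S)"
  have trace: "hecke_trace \<tau>" by unfold_locales
  have iso: "yh_iso (\<xi> d) d n (\<Psi> d n)" if "1 \<le> d" "1 \<le> n" for d n
    using that \<xi> \<Psi> by unfold_locales
  note formula = basic_trace_delta[where \<xi> = \<xi> and \<Psi> = \<Psi>, OF trace iso]
  have vanish: "?P d S n (bcls n w) = 0"
    if "1 \<le> d" "1 \<le> n" "S \<subseteq> {1..d}" "S \<noteq> {}" "w \<in> braid_words n" "num_components n (bcls n w) < card S" for d n S w
  proof (rule one_minus_Lu2_cancel[of "card S - 1"])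
    show "(1 - Lu ^ 2) ^ (card S - 1) * ?P d S n (bcls n w) = (1 - Lu ^ 2) ^ (card S - 1) * 0"
      using formula[OF that(1-5)] path_sum_eq_0[OF that(5,6), of \<tau>] by simp
  qed
  \<comment> \<open>\<open>formula\<close> gives the same right-hand side for \<open>(d, S)\<close>
    and for \<open>(card S, {1..card S})\<close>, and the common power of \<open>1 - u^2\<close>
    cancels.\<close>
  have depends_card: "?P d S n (bcls n w) = ?P (card S) {1..card S} n (bcls n w)"
    if "1 \<le> d" "1 \<le> n" "S \<subseteq> {1..d}" "S \<noteq> {}" "w \<in> braid_words n" for d n S w
  proof (rule one_minus_Lu2_cancel[of "card S - 1"])
    have "finite S" using that finite_subset by blast
    then have k: "1 \<le> card S" using that card_gt_0_iff[of S] by simp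
    then have "{1..card S} \<noteq> {}" by simp
    then show "(1 - Lu ^ 2) ^ (card S - 1) * ?P d S n (bcls n w)
        = (1 - Lu ^ 2) ^ (card S - 1) * ?P (card S) {1..card S} n (bcls n w)"
      using formula[OF that] formula[OF k that(2) subset_refl _ that(5)] by simp
  qed
  have homflypt: "?P 1 {1} n \<beta> = hecke_inv \<tau> n \<beta>" if n: "1 \<le> n" and \<beta>: "\<beta> \<in> carrier (braid_group n)" for n \<beta>
  proof -
    obtain w where w: "\<beta> = bcls n w" "w \<in> braid_words n" using \<beta> unfolding braid_group_carrier by blast
    \<comment> \<open>For a single label the exponents \<open>card S - 1\<close> vanish, so the
      formula is already free of factors.\<close>
    have "?P 1 {1} n (bcls n w) = path_sum \<tau> 1 n w" using formula[OF _ n _ _ w(2), of 1 "{1}"] by (simp add: One_nat_def)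
    then show ?thesis unfolding w(1) path_sum_1[OF n w(2)] hecke_inv_tr[OF w(2)] tr_def .
  qed
  have span: "\<exists>c. (\<forall>k \<in> {1..N}. c k \<in> laurent_uv) \<and>
      (\<forall>n \<ge> 1. \<forall>\<beta> \<in> carrier (braid_group n). num_components n \<beta> = N \<longrightarrow>
        link_inv d \<rho> n \<beta> = (\<Sum>k = 1..N. c k * ?P k {1..k} n \<beta>))"
    if d: "1 \<le> d" and \<rho>: "in_basic_span \<xi> \<tau> \<Psi> d \<rho>" for d \<rho>
  proof -
    obtain c where c: "range c \<subseteq> laurent_uv"
        "\<And>n x. n \<ge> 1 \<Longrightarrow> x \<in> carrier (yh d n) \<Longrightarrow>
          \<rho> n x = (\<Sum>S \<in> Pow {1..d} - {{}}. c S * basic_trace \<xi> \<tau> \<Psi> d S n x)"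
      using \<rho> unfolding in_basic_span_def by blast
    let ?A = "Pow {1..d} - {{}}"
    \<comment> \<open>The coefficients of all \<open>S\<close> of one size are added up; they depend
      neither on \<open>n\<close> nor on the braid. The nested set has the form in which
      \<open>sum.group\<close> presents the summands.\<close>
    define c' where "c' k = (\<Sum>S \<in> {S \<in> {S \<in> ?A. card S \<le> N}. card S = k}. c S)" for k
    have "c' k \<in> laurent_uv" for k unfolding c'_def using c(1) by (intro laurent_uv_sum) auto
    moreover have "link_inv d \<rho> n \<beta> = (\<Sum>k = 1..N. c' k * ?P k {1..k} n \<beta>)"
      if n: "1 \<le> n" and \<beta>: "\<beta> \<in> carrier (braid_group n)" and comp: "num_components n \<beta> = N" for n \<beta>
    proof -
      obtain w where w: "\<beta> = bcls n w" "w \<in> braid_words n" using \<beta> unfolding braid_group_carrier by blast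
      interpret yh_iso "\<xi> d" d n "\<Psi> d n" using iso[OF d n] .
      have "delta d n \<beta> \<in> carrier (yh d n)"
        unfolding w(1) delta_dword[OF w(2)] using dword_FA[OF w(2)] by (rule cls_simps(1))
      then have "link_inv d \<rho> n \<beta> = (\<Sum>S \<in> ?A. c S * ?P d S n \<beta>)"
        using c(2)[OF n] by (simp add: link_inv_def)
      \<comment> \<open>Sets with more elements than the link has components contribute 0 by
        \<open>vanish\<close>; this bounds the number of invariants by \<open>N\<close>.\<close>
      also have "\<dots> = (\<Sum>S \<in> {S \<in> ?A. card S \<le> N}. c S * ?P d S n \<beta>)"
      proof (rule sum.mono_neutral_right)
        show "\<forall>S \<in> ?A - {S \<in> ?A. card S \<le> N}. c S * ?P d S n \<beta> = 0"
        proof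
          fix S assume "S \<in> ?A - {S \<in> ?A. card S \<le> N}"
          then have "S \<subseteq> {1..d}" "S \<noteq> {}" "num_components n (bcls n w) < card S"
            using comp unfolding w(1) by auto
          then show "c S * ?P d S n \<beta> = 0" unfolding w(1) using vanish[OF d n _ _ w(2)] by simp
        qed
      qed auto
      also have "\<dots> = (\<Sum>S \<in> {S \<in> ?A. card S \<le> N}. c S * ?P (card S) {1..card S} n \<beta>)"
        unfolding w(1) using depends_card[OF d n _ _ w(2)] by (intro sum.cong refl) auto
      also have "\<dots> = (\<Sum>k = 1..N. \<Sum>S \<in> {S \<in> {S \<in> ?A. card S \<le> N}. card S = k}. c S * ?P (card S) {1..card S} n \<beta>)"
      proof (rule sum.group[symmetric])
        have "1 \<le> card S" if "S \<in> ?A" for S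
          using that finite_subset[of S "{1..d}"] card_gt_0_iff[of S] by auto
        then show "card ` {S \<in> ?A. card S \<le> N} \<subseteq> {1..N}"
          by (intro image_subsetI) (simp only: mem_Collect_eq atLeastAtMost_iff simp_thms)
      qed auto
      also have "\<dots> = (\<Sum>k = 1..N. c' k * ?P k {1..k} n \<beta>)"
        unfolding c'_def sum_distrib_right by (intro sum.cong refl) auto
      finally show ?thesis .
    qed
    ultimately show ?thesis by blast
  qed
  show ?thesis
    using span homflypt is_homflypt_cong[OF homflypt is_homflypt_hecke_inv] by blast
qed

end
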